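(* Let $m\ge2$, let $X$ be a space, let $\mathrm{pr}_i\colon X^m\to X$ be the projection onto the $i$-th coordinate, and let $f\colon X\to Y$ be a map. Then $$\mathsf{TC}^{\mathcal D}_m(f)=\mathsf{D}^{\mathcal D}(f\circ\mathrm{pr}_1,\dots,f\circ\mathrm{pr}_m)\quad\text{and}\quad\mathsf{dTC}^{\mathcal D}_m(f)=\mathsf{dD}^{\mathcal D}(f\circ\mathrm{pr}_1,\dots,f\circ\mathrm{pr}_m).$$ Moreover, if $h\colon Y\to Z$ is a map that induces an isomorphism of fundamental groups and $*\colon Y\to Z$ is the constant map to a basepoint $z_0\in Z$, then $$\mathsf{cat}_1(f)=\mathsf{D}^{\mathcal D}(h\circ f,*\circ f)=\mathsf{D}^{\mathcal D}( *\circ f,h\circ f)\quad\text{and}\quad\mathsf{dcat}_1(f)=\mathsf{dD}^{\mathcal D}(h\circ f,*\circ f)=\mathsf{dD}^{\mathcal D}( *\circ f,h\circ f).$$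
   Context: The spaces $Y$ and $Z$ are assumed connected, locally path-connected and semi-locally simply connected. For a fibration $p\colon E\to B$, $\mathsf{secat}(p)$ is the least $n\ge 0$ such that $B$ is covered by $n+1$ open sets over each of which $p$ has a continuous partial section. For $k\ge1$ let $E_k(p)$ be the space of probability measures $\sum_{i=1}^k\lambda_ie_i$ on $E$ supported on at most $k$ points, all in a single fiber of $p$, as a subspace of the space $\mathcal B_k(E)$ of probability measures with support of size at most $k$ (with the L\'evy--Prokhorov metric topology when $E$ is metrizable; the results are asserted equally for the quotient topology from the symmetric join $\ast^kE/\Sigma_k$), and $p_k\colon E_k(p)\to B$, $p_k(\sum\lambda_ie_i)=p(e_i)$. $\mathsf{dsecat}(p)$ is the least $n\ge0$ such that $p_{n+1}$ has a continuous section. With $\pi=\pi_1(Y,y_0)$, $\widehat\pi^Y_m\colon\widehat Y^m\to Y^m$ is the connected covering corresponding to the diagonal subgroup $\Delta<\pi^m$. For maps $g_1,\dots,g_m\colon W\to Y$ with $(g_1,\dots,g_m)(w)=(g_1(w),\dots,g_m(w))$: $\mathsf{D}^{\mathcal D}(g_1,\dots,g_m)$ is the least $n\ge0$ such that $W$ is covered by $n+1$ open sets $U_j$ such that, for each $j$ and every $u_j\in U_j$, the homomorphism $\pi_1(U_j,u_j)\to\pi_1(Y^m,(g_1(u_j),\dots,g_m(u_j)))$ induced by $(g_1,\dots,g_m)|_{U_j}$ takes values in a subgroup conjugate to $\Delta$; equivalently $\mathsf{secat}((g_1,\dots,g_m)^*\widehat\pi^Y_m)$. $\mathsf{dD}^{\mathcal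 D}(g_1,\dots,g_m):=\mathsf{dsecat}((g_1,\dots,g_m)^*\widehat\pi^Y_m)$. With $f^m\colon X^m\to Y^m$ the power map: $\mathsf{TC}^{\mathcal D}_m(f):=\mathsf{secat}((f^m)^*\widehat\pi^Y_m)$, $\mathsf{dTC}^{\mathcal D}_m(f):=\mathsf{dsecat}((f^m)^*\widehat\pi^Y_m)$. With $\widetilde p^Y\colon\widetilde Y\to Y$ the universal covering: $\mathsf{cat}_1(f):=\mathsf{secat}(f^*\widetilde p^Y)$, $\mathsf{dcat}_1(f):=\mathsf{dsecat}(f^*\widetilde p^Y)$.
   Formalization: The two descriptions of D^D differ for general X (Warsaw circle collapsed onto a circle); the equalities are proved for every X with D^D read as secat of the pulled-back covering, and with D^D read by fundamental groups when X is locally path-connected. *)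

theory Defs
  imports
    "HOL-Analysis.Analysis"
    "HOL-Probability.Probability_Mass_Function"
    "HOL-Algebra.Group"
begin

section \<open>Fundamental groups and coverings\<close>

text \<open>Spaces are subsets, with the subspace topology, of types of class
  \<^class>\<open>topological_space\<close>. Elements of the fundamental group are homotopy classes rel endpoints,
  as sets of paths.\<close>

definition path_class :: "'a::topological_space set \<Rightarrow> (real \<Rightarrow> 'a) \<Rightarrow> (real \<Rightarrow> 'a) set" where
  "path_class S p = {q. homotopic_paths S p q}"

definition fund_group :: "'a::topological_space set \<Rightarrow> 'a \<Rightarrow> (real \<Rightarrow> 'a) set monoid" where
  "fund_group S x =
    \<lparr>carrier = path_class S ` {p. path p \<and> path_image p \<subseteq> S \<and> pathstart p = x \<and> pathfinish p = x},
     monoid.mult = (\<lambda>A B. \<Union>p\<in>A. \<Union>q\<in>B. path_class S (p +++ q)),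
     one = path_class S (\<lambda>_. x)\<rparr>"

definition fund_map ::
  "'b::topological_space set \<Rightarrow> ('a::topological_space \<Rightarrow> 'b) \<Rightarrow> (real \<Rightarrow> 'a) set \<Rightarrow> (real \<Rightarrow> 'b) set" where
  "fund_map T f A = (\<Union>p\<in>A. path_class T (f \<circ> p))"

text \<open>The change of basepoint from the start to the end of a path \<open>g\<close>.\<close>

definition fund_transport ::
  "'a::topological_space set \<Rightarrow> (real \<Rightarrow> 'a) \<Rightarrow> (real \<Rightarrow> 'a) set \<Rightarrow> (real \<Rightarrow> 'a) set" where
  "fund_transport S g A = (\<Union>p\<in>A. path_class S (reversepath g +++ (p +++ g)))"

text \<open>A subgroup of the group at \<open>y\<close> is conjugate to a subgroup \<open>H\<close> of the group at \<open>x\<close> if it is the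
  image of \<open>H\<close> under the change of basepoint along some path from \<open>x\<close> to \<open>y\<close>; a different path changes
  the image by an inner automorphism.\<close>

definition conjugate_at ::
  "'a::topological_space set \<Rightarrow> 'a \<Rightarrow> (real \<Rightarrow> 'a) set set \<Rightarrow> 'a \<Rightarrow> (real \<Rightarrow> 'a) set set \<Rightarrow> bool" where
  "conjugate_at S x H y K \<longleftrightarrow>
    (\<exists>g. path g \<and> path_image g \<subseteq> S \<and> pathstart g = x \<and> pathfinish g = y \<and> K = fund_transport S g ` H)"

definition semilocally_simply_connected :: "'a::topological_space set \<Rightarrow> bool" where
  "semilocally_simply_connected S \<longleftrightarrow>
    (\<forall>x\<in>S. \<exists>U. openin (top_of_set S) U \<and> x \<in> U \<and>
       (\<forall>p. path p \<and> path_image p \<subseteq> U \<and> pathstart p = x \<and> pathfinish p = x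
          \<longrightarrow> homotopic_paths S p (\<lambda>_. x)))"

definition standing_space :: "'a::topological_space set \<Rightarrow> bool" where
  "standing_space S \<longleftrightarrow>
    connected S \<and> locally path_connected S \<and> semilocally_simply_connected S"

text \<open>The connected covering of \<open>(B, b)\<close> that corresponds to the subgroup \<open>H\<close> of the fundamental
  group at \<open>b\<close>.\<close>

definition connected_covering ::
  "'e::topological_space set \<Rightarrow> ('e \<Rightarrow> 'b::topological_space) \<Rightarrow> 'b set \<Rightarrow> 'b \<Rightarrow> (real \<Rightarrow> 'b) set set \<Rightarrow> bool" where
  "connected_covering E q B b H \<longleftrightarrow>
    covering_space E q B \<and> connected E \<and>
    (\<exists>e\<in>E. q e = b \<and> fund_map B q ` carrier (fund_group E e) = H)"

definition universal_covering ::
  "'e::topological_space set \<Rightarrow> ('e \<Rightarrow> 'b::topological_space) \<Rightarrow> 'b set \<Rightarrow> bool" where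
  "universal_covering E q B \<longleftrightarrow> covering_space E q B \<and> simply_connected E"

section \<open>Powers\<close>

text \<open>Coordinates are indexed by \<open>{..<m}\<close>.\<close>

definition power_space :: "nat \<Rightarrow> 'a set \<Rightarrow> (nat \<Rightarrow> 'a) set" where
  "power_space m S = (\<Pi>\<^sub>E i\<in>{..<m}. S)"

definition power_map :: "nat \<Rightarrow> ('a \<Rightarrow> 'b) \<Rightarrow> (nat \<Rightarrow> 'a) \<Rightarrow> nat \<Rightarrow> 'b" where
  "power_map m f x = (\<lambda>i\<in>{..<m}. f (x i))"

definition proj :: "nat \<Rightarrow> (nat \<Rightarrow> 'a) \<Rightarrow> 'a" where
  "proj i x = x i"

definition tuple_map :: "('w \<Rightarrow> 'y) list \<Rightarrow> 'w \<Rightarrow> nat \<Rightarrow> 'y" where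
  "tuple_map gs w = (\<lambda>i\<in>{..<length gs}. (gs ! i) w)"

definition diagonal_point :: "nat \<Rightarrow> 'a \<Rightarrow> nat \<Rightarrow> 'a" where
  "diagonal_point m y = (\<lambda>i\<in>{..<m}. y)"

text \<open>The diagonal of the \<open>m\<close>-th power of the fundamental group of \<open>(Y, y)\<close>, inside the fundamental
  group of the \<open>m\<close>-th power of \<open>Y\<close>; the identification of the two groups has the maps
  induced by the projections as its components.\<close>

definition diagonal_subgroup ::
  "nat \<Rightarrow> 'y::topological_space set \<Rightarrow> 'y \<Rightarrow> (real \<Rightarrow> nat \<Rightarrow> 'y) set set" where
  "diagonal_subgroup m Y y =
    {A \<in> carrier (fund_group (power_space m Y) (diagonal_point m y)).
       \<exists>a\<in>carrier (fund_group Y y). \<forall>i<m. fund_map Y (proj i) A = a}"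

definition diagonal_covering ::
  "nat \<Rightarrow> 'y::topological_space set \<Rightarrow> 'y \<Rightarrow> 'e::topological_space set \<Rightarrow> ('e \<Rightarrow> nat \<Rightarrow> 'y) \<Rightarrow> bool" where
  "diagonal_covering m Y y E q \<longleftrightarrow>
    connected_covering E q (power_space m Y) (diagonal_point m y) (diagonal_subgroup m Y y)"

section \<open>Sectional category\<close>

text \<open>Infima are taken in \<^typ>\<open>enat\<close>, so the value is infinite if no \<open>n\<close> is admissible.\<close>

definition secat ::
  "'e::topological_space set \<Rightarrow> ('e \<Rightarrow> 'b::topological_space) \<Rightarrow> 'b set \<Rightarrow> enat" where
  "secat E p B = Inf {enat n | n.
    \<exists>U s. B = (\<Union>j\<le>n. U j) \<and>
      (\<forall>j\<le>n. openin (top_of_set B) (U j) \<and> continuous_on (U j) (s j) \<and> s j ` U j \<subseteq> E \<and>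
             (\<forall>b\<in>U j. p (s j b) = b))}"

text \<open>Total space of the pullback of \<open>q\<close>, defined on \<open>E\<close>, along \<open>g\<close>, defined on \<open>W\<close>; its map to \<open>W\<close>
  is \<^const>\<open>fst\<close>.\<close>

definition pullback :: "'w set \<Rightarrow> ('w \<Rightarrow> 'b) \<Rightarrow> 'e set \<Rightarrow> ('e \<Rightarrow> 'b) \<Rightarrow> ('w \<times> 'e) set" where
  "pullback W g E q = {(w, e). w \<in> W \<and> e \<in> E \<and> g w = q e}"

section \<open>Distributional sectional category\<close>

definition fin_prob :: "nat \<Rightarrow> 'e set \<Rightarrow> 'e pmf set" where
  "fin_prob k E = {\<mu>. set_pmf \<mu> \<subseteq> E \<and> finite (set_pmf \<mu>) \<and> card (set_pmf \<mu>) \<le> k}"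

definition levy_prokhorov :: "'e set \<Rightarrow> ('e \<Rightarrow> 'e \<Rightarrow> real) \<Rightarrow> 'e pmf \<Rightarrow> 'e pmf \<Rightarrow> real" where
  "levy_prokhorov E d \<mu> \<nu> = Inf {r. 0 < r \<and>
     (\<forall>A\<in>sigma_sets E {U. openin (Metric_space.mtopology E d) U}.
        measure_pmf.prob \<mu> A \<le> measure_pmf.prob \<nu> {x\<in>E. \<exists>a\<in>A. d a x < r} + r \<and>
        measure_pmf.prob \<nu> A \<le> measure_pmf.prob \<mu> {x\<in>E. \<exists>a\<in>A. d a x < r} + r)}"

text \<open>On finitely supported measures the topology does not depend on the metric chosen for \<open>E\<close>. Only
  meaningful for metrizable \<open>E\<close>.\<close>

definition LP_topology :: "nat \<Rightarrow> 'e::topological_space set \<Rightarrow> 'e pmf topology" where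
  "LP_topology k E =
    Metric_space.mtopology (fin_prob k E)
      (levy_prokhorov E (SOME d. Metric_space E d \<and> Metric_space.mtopology E d = top_of_set E))"

definition quotient_topology :: "'a topology \<Rightarrow> ('a \<Rightarrow> 'b) \<Rightarrow> 'b topology" where
  "quotient_topology T h = topology (\<lambda>U. U \<subseteq> h ` topspace T \<and> openin T {x \<in> topspace T. h x \<in> U})"

text \<open>The \<open>k\<close>-fold join of \<open>E\<close> is a quotient of the product of the standard simplex with the power of
  \<open>E\<close>, and the finitely supported measures are a quotient of the symmetric join; successive quotients
  compose, so the topology is the quotient topology along \<open>(t, e) \<mapsto> \<Sum>i<k. t i \<cdot> e i\<close>.\<close>

definition prob_simplex :: "nat \<Rightarrow> (nat \<Rightarrow> real) set" where
  "prob_simplex k = {t \<in> {..<k} \<rightarrow>\<^sub>E {0..1}. (\<Sum>i<k. t i) = 1}"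

definition convex_comb :: "nat \<Rightarrow> (nat \<Rightarrow> real) \<times> (nat \<Rightarrow> 'e) \<Rightarrow> 'e pmf" where
  "convex_comb k = (\<lambda>(t, e). embed_pmf (\<lambda>x. \<Sum>i\<in>{i. i < k \<and> e i = x}. t i))"

definition join_topology :: "nat \<Rightarrow> 'e::topological_space set \<Rightarrow> 'e pmf topology" where
  "join_topology k E = quotient_topology (top_of_set (prob_simplex k \<times> power_space k E)) (convex_comb k)"

definition fibre_prob :: "nat \<Rightarrow> 'e set \<Rightarrow> ('e \<Rightarrow> 'b) \<Rightarrow> 'b set \<Rightarrow> 'e pmf set" where
  "fibre_prob k E p B = {\<mu> \<in> fin_prob k E. \<exists>b\<in>B. p ` set_pmf \<mu> = {b}}"

definition fibre_proj :: "('e \<Rightarrow> 'b) \<Rightarrow> 'e pmf \<Rightarrow> 'b" where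
  "fibre_proj p \<mu> = the_elem (p ` set_pmf \<mu>)"

text \<open>The parameter \<open>T\<close> is \<^const>\<open>LP_topology\<close> or \<^const>\<open>join_topology\<close>.\<close>

definition dsecat ::
  "(nat \<Rightarrow> 'e::topological_space set \<Rightarrow> 'e pmf topology) \<Rightarrow>
   'e set \<Rightarrow> ('e \<Rightarrow> 'b::topological_space) \<Rightarrow> 'b set \<Rightarrow> enat" where
  "dsecat T E p B = Inf {enat n | n.
    \<exists>s. continuous_map (top_of_set B) (subtopology (T (n + 1) E) (fibre_prob (n + 1) E p B)) s \<and>
        (\<forall>b\<in>B. fibre_proj p (s b) = b)}"

section \<open>The invariants\<close>

text \<open>The covering enters as a parameter. Any two coverings for the same subgroup are isomorphic, so
  the values do not depend on it.\<close>

definition TCD ::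
  "nat \<Rightarrow> 'x::topological_space set \<Rightarrow> ('x \<Rightarrow> 'y::topological_space) \<Rightarrow>
   'e::topological_space set \<Rightarrow> ('e \<Rightarrow> nat \<Rightarrow> 'y) \<Rightarrow> enat" where
  "TCD m X f E q =
    secat (pullback (power_space m X) (power_map m f) E q) fst (power_space m X)"

definition dTCD ::
  "(nat \<Rightarrow> ((nat \<Rightarrow> 'x) \<times> 'e) set \<Rightarrow> ((nat \<Rightarrow> 'x) \<times> 'e) pmf topology) \<Rightarrow>
   nat \<Rightarrow> 'x::topological_space set \<Rightarrow> ('x \<Rightarrow> 'y::topological_space) \<Rightarrow>
   'e::topological_space set \<Rightarrow> ('e \<Rightarrow> nat \<Rightarrow> 'y) \<Rightarrow> enat" where
  "dTCD T m X f E q =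
    dsecat T (pullback (power_space m X) (power_map m f) E q) fst (power_space m X)"

definition cat1 ::
  "'x::topological_space set \<Rightarrow> ('x \<Rightarrow> 'y::topological_space) \<Rightarrow>
   'e::topological_space set \<Rightarrow> ('e \<Rightarrow> 'y) \<Rightarrow> enat" where
  "cat1 X f E q = secat (pullback X f E q) fst X"

definition dcat1 ::
  "(nat \<Rightarrow> ('x \<times> 'e) set \<Rightarrow> ('x \<times> 'e) pmf topology) \<Rightarrow>
   'x::topological_space set \<Rightarrow> ('x \<Rightarrow> 'y::topological_space) \<Rightarrow>
   'e::topological_space set \<Rightarrow> ('e \<Rightarrow> 'y) \<Rightarrow> enat" where
  "dcat1 T X f E q = dsecat T (pullback X f E q) fst X"

text \<open>\<open>DD_pi1\<close> is the definition by fundamental groups and \<open>DD\<close> the one by sectional category. They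
  agree when \<open>W\<close> is locally path-connected, but not for arbitrary \<open>W\<close>: if \<open>W\<close> is the Warsaw circle and
  both \<open>g\<close> and \<open>h\<close> map to the circle, \<open>g\<close> by collapsing the limit arc and \<open>h\<close> constantly, then
  \<open>DD_pi1\<close> of \<open>[g, h]\<close> is 0, and \<open>DD\<close> is not.\<close>

definition DD_pi1 ::
  "'y::topological_space set \<Rightarrow> 'y \<Rightarrow> 'w::topological_space set \<Rightarrow> ('w \<Rightarrow> 'y) list \<Rightarrow> enat" where
  "DD_pi1 Y y W gs = Inf {enat n | n.
    \<exists>U. W = (\<Union>j\<le>n. U j) \<and>
      (\<forall>j\<le>n. openin (top_of_set W) (U j) \<and>
        (\<forall>u\<in>U j. \<exists>K.
           conjugate_at (power_space (length gs) Y) (diagonal_point (length gs) y)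
             (diagonal_subgroup (length gs) Y y) (tuple_map gs u) K \<and>
           fund_map (power_space (length gs) Y) (tuple_map gs) ` carrier (fund_group (U j) u) \<subseteq> K))}"

definition DD ::
  "'w::topological_space set \<Rightarrow> ('w \<Rightarrow> 'y::topological_space) list \<Rightarrow>
   'e::topological_space set \<Rightarrow> ('e \<Rightarrow> nat \<Rightarrow> 'y) \<Rightarrow> enat" where
  "DD W gs E q = secat (pullback W (tuple_map gs) E q) fst W"

definition dDD ::
  "(nat \<Rightarrow> ('w \<times> 'e) set \<Rightarrow> ('w \<times> 'e) pmf topology) \<Rightarrow>
   'w::topological_space set \<Rightarrow> ('w \<Rightarrow> 'y::topological_space) list \<Rightarrow>
   'e::topological_space set \<Rightarrow> ('e \<Rightarrow> nat \<Rightarrow> 'y) \<Rightarrow> enat" where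
  "dDD T W gs E q = dsecat T (pullback W (tuple_map gs) E q) fst W"

end

theory Submission
  imports Defs
begin

text \<open>
  The power map of \<open>f\<close> and the tuple of the maps \<open>f \<circ> pr\<^sub>i\<close> are the same map, so the
  invariants defined by sectional category are those of one and the same covering. The content is the
  description by fundamental groups (\<open>DD_eq_DD_pi1\<close>). A section over \<open>U\<close> of the pullback of a covering \<open>q\<close>
  along \<open>G\<close> is a lift of \<open>G\<close> on \<open>U\<close>. If \<open>U\<close> is locally path-connected, such a lift exists if and only if for
  every \<open>u\<close> in \<open>U\<close> there is a point over \<open>G u\<close> at which the images of all loops of \<open>U\<close> at \<open>u\<close> lift to loops
  (\<open>lifting_criterion\<close>). By the change of basepoint, this says that the induced homomorphism takes values
  in a conjugate of the subgroup that defines \<open>q\<close> (\<open>conjugate_subgroup_iff_loops_lift\<close>).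

  For \<open>cat\<^sub>1\<close>, let \<open>G = (h, z0)\<close> or \<open>G = (z0, h)\<close>. The universal covering of \<open>Y\<close> is homeomorphic
  over \<open>Y\<close> to the pullback of the diagonal covering of \<open>Z \<times> Z\<close> along \<open>G\<close>
  (\<open>universal_covering_pullback_diagonal\<close>). The reason is that a loop of \<open>Z \<times> Z\<close> lifts to a loop of the
  diagonal covering if and only if its two coordinates become homotopic after conjugation with the
  coordinates of a fixed path. For the loop \<open>G \<circ> r\<close> one coordinate is constant, so the condition is that
  \<open>h \<circ> r\<close> is null-homotopic, and then so is \<open>r\<close>, because \<open>h\<close> is injective on fundamental groups.
  Therefore the map from the universal covering to the pullback is injective. It is surjective because
  \<open>h\<close> is surjective on fundamental groups, so that the lifts of the loops \<open>G \<circ> r\<close> join any two points of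
  a fibre of the pullback. Pulling back along \<open>f\<close> gives two coverings of \<open>X\<close> that are homeomorphic
  over \<open>X\<close>.

  Both sectional categories are invariant under homeomorphisms over the base
  (\<open>fibrewise_homeomorphism_invariance\<close>). In the distributional case this requires that the push-forward
  of finitely supported measures along a continuous map is continuous. For the quotient topology the
  push-forward is covered by a continuous map of the products of simplices and powers. For the
  Levy-Prokhorov topology, the distance is shown to be a metric on the finitely supported measures,
  and continuity of a push-forward at a measure follows from continuity of the map at its atoms.
\<close>

section \<open>Paths with prescribed endpoints\<close>

definition path_between :: "'a::topological_space set \<Rightarrow> (real \<Rightarrow> 'a) \<Rightarrow> 'a \<Rightarrow> 'a \<Rightarrow> bool" where
  "path_between S p a b \<longleftrightarrow> path p \<and> path_image p \<subseteq> S \<and> pathstart p = a \<and> pathfinish p = b"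

lemma path_between_const: "a \<in> S \<Longrightarrow> path_between S (\<lambda>_. a) a a"
  by (auto simp: path_between_def path_def path_image_def pathstart_def pathfinish_def)

lemma path_between_join:
  "path_between S p a b \<Longrightarrow> path_between S r b c \<Longrightarrow> path_between S (p +++ r) a c"
  by (auto simp: path_between_def path_image_join)

lemma path_between_reverse: "path_between S p a b \<Longrightarrow> path_between S (reversepath p) b a"
  by (auto simp: path_between_def)

lemma path_between_image:
  assumes "path_between S p a b" "continuous_on S f" "f ` S \<subseteq> T"
  shows "path_between T (f \<circ> p) (f a) (f b)"
  using assms unfolding path_between_def
  by (auto simp: path_image_compose pathstart_compose pathfinish_compose
      intro!: path_continuous_image intro: continuous_on_subset)

lemma path_between_mono: "path_between S p a b \<Longrightarrow> S \<subseteq> T \<Longrightarrow> path_between T p a b"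
  by (auto simp: path_between_def)

lemma path_between_in: "path_between S p a b \<Longrightarrow> t \<in> {0..1} \<Longrightarrow> p t \<in> S"
  by (auto simp: path_between_def path_image_def)

lemma path_between_ends:
  assumes "path_between S p a b" shows "p 0 = a" "p 1 = b" "a \<in> S" "b \<in> S"
  using assms path_between_in[OF assms, of 0] path_between_in[OF assms, of 1]
  by (auto simp: path_between_def pathstart_def pathfinish_def)

lemma path_component_iff_path_between: "path_component S a b \<longleftrightarrow> (\<exists>p. path_between S p a b)"
  by (auto simp: path_component_def path_between_def)

lemma simply_connected_path_connected:
  fixes S :: "'a::topological_space set"
  assumes "simply_connected S"
  shows "path_connected S"
  unfolding path_connected_component
proof (intro ballI)
  fix a b assume ab: "a \<in> S" "b \<in> S"
  have "homotopic_loops S (\<lambda>_. a) (\<lambda>_. b)"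
    using assms ab path_between_const[of a S] path_between_const[of b S]
    unfolding simply_connected_def path_between_def by metis
  then show "path_component S a b"
    by (drule_tac homotopic_loops_imp_path_component_value[of _ _ _ 0]) auto
qed

section \<open>Lifting paths and homotopies through a covering\<close>

text \<open>The spaces need not satisfy any separation axiom. What replaces the Hausdorff property of the total space is
  that distinct points of one fibre lie in different sheets, and these are disjoint.\<close>

lemma covering_sheets:
  assumes "covering_space E q B" "b \<in> B"
  obtains T where "b \<in> T" "openin (top_of_set B) T"
    "\<And>e. e \<in> E \<Longrightarrow> q e \<in> T \<Longrightarrow> \<exists>u s. e \<in> u \<and> openin (top_of_set E) u \<and> homeomorphism u T q s"
    "\<And>e e'. e \<in> E \<Longrightarrow> e' \<in> E \<Longrightarrow> q e = q e' \<Longrightarrow> q e \<in> T \<Longrightarrow> e \<noteq> e' \<Longrightarrow>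
       \<exists>u u'. e \<in> u \<and> e' \<in> u' \<and> openin (top_of_set E) u \<and> openin (top_of_set E) u' \<and>
         u \<inter> u' = {}"
proof -
  from assms obtain T v where T: "b \<in> T" "openin (top_of_set B) T" "\<Union>v = E \<inter> q -` T"
    and v: "\<And>u. u \<in> v \<Longrightarrow> openin (top_of_set E) u" "pairwise disjnt v"
      "\<And>u. u \<in> v \<Longrightarrow> \<exists>s. homeomorphism u T q s"
    unfolding covering_space_def by metis
  show thesis
  proof (rule that[OF T(1,2)])
    fix e assume "e \<in> E" "q e \<in> T"
    then have "e \<in> \<Union>v" by (simp add: T(3))
    with v show "\<exists>u s. e \<in> u \<and> openin (top_of_set E) u \<and> homeomorphism u T q s" by blast
  next
    fix e e' assume e: "e \<in> E" "e' \<in> E" "q e = q e'" "q e \<in> T" "e \<noteq> e'"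
    then have "e \<in> \<Union>v" "e' \<in> \<Union>v" by (simp_all add: T(3))
    then obtain u u' where u: "u \<in> v" "u' \<in> v" "e \<in> u" "e' \<in> u'" by blast
    have "u \<noteq> u'"
    proof
      assume "u = u'"
      then have "inj_on q u" "e' \<in> u"
        using v(3)[OF u(1)] u by (auto simp: homeomorphism_def intro: inj_on_inverseI)
      with e u show False by (auto dest: inj_onD)
    qed
    with u v(2) have "u \<inter> u' = {}" by (auto simp: pairwise_def disjnt_def)
    with u v show "\<exists>u u'. e \<in> u \<and> e' \<in> u' \<and> openin (top_of_set E) u \<and>
        openin (top_of_set E) u' \<and> u \<inter> u' = {}" by blast
  qed
qed

text \<open>Two lifts agree on an open set because \<open>q\<close> is injective on a sheet, and differ on an open set
  because different sheets over the same set are disjoint.\<close>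

lemma covering_lift_unique:
  assumes cov: "covering_space E q B" and T: "connected T" "a \<in> T" "x \<in> T"
    and f: "continuous_on T f" "f ` T \<subseteq> E" and g: "continuous_on T g" "g ` T \<subseteq> E"
    and eq: "\<And>x. x \<in> T \<Longrightarrow> q (f x) = q (g x)" and a: "f a = g a"
  shows "f x = g x"
proof -
  define A where "A = {x \<in> T. f x = g x}"
  have qB: "q (f x) \<in> B" if "x \<in> T" for x
    using covering_space_imp_surjective[OF cov] f(2) that by blast
  have pre: "openin (top_of_set T) (T \<inter> k -` u)"
    if "continuous_on T k" "k ` T \<subseteq> E" "openin (top_of_set E) u" for k u
    using that by (meson continuous_openin_preimage image_subset_iff_funcset)
  have "openin (top_of_set T) A"
  proof (subst openin_subopen, rule ballI)
    fix z assume "z \<in> A"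
    then have z: "z \<in> T" "f z = g z" by (auto simp: A_def)
    obtain V where V: "q (f z) \<in> V" "openin (top_of_set B) V"
      "\<And>e. e \<in> E \<Longrightarrow> q e \<in> V \<Longrightarrow> \<exists>u s. e \<in> u \<and> openin (top_of_set E) u \<and> homeomorphism u V q s"
      by (rule covering_sheets[OF cov qB[OF z(1)]]) metis
    obtain u s where u: "f z \<in> u" "openin (top_of_set E) u" "homeomorphism u V q s"
      using V f z by blast
    have inj: "inj_on q u" using u(3) by (auto simp: homeomorphism_def intro: inj_on_inverseI)
    have "openin (top_of_set T) ((T \<inter> f -` u) \<inter> (T \<inter> g -` u))"
      using pre f g u by blast
    moreover have "z \<in> (T \<inter> f -` u) \<inter> (T \<inter> g -` u)" using z u by auto
    moreover have "(T \<inter> f -` u) \<inter> (T \<inter> g -` u) \<subseteq> A"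
      using inj eq by (auto simp: A_def dest: inj_onD)
    ultimately show "\<exists>U. openin (top_of_set T) U \<and> z \<in> U \<and> U \<subseteq> A" by blast
  qed
  moreover have "openin (top_of_set T) (T - A)"
  proof (subst openin_subopen, rule ballI)
    fix z assume "z \<in> T - A"
    then have z: "z \<in> T" "f z \<noteq> g z" by (auto simp: A_def)
    obtain V where V: "q (f z) \<in> V" "openin (top_of_set B) V"
      "\<And>e e'. e \<in> E \<Longrightarrow> e' \<in> E \<Longrightarrow> q e = q e' \<Longrightarrow> q e \<in> V \<Longrightarrow> e \<noteq> e' \<Longrightarrow>
       \<exists>u u'. e \<in> u \<and> e' \<in> u' \<and> openin (top_of_set E) u \<and> openin (top_of_set E) u' \<and>
         u \<inter> u' = {}"
      by (rule covering_sheets[OF cov qB[OF z(1)]]) metis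
    have "f z \<in> E" "g z \<in> E" using f g z by auto
    then obtain u u' where u: "f z \<in> u" "g z \<in> u'" "openin (top_of_set E) u"
      "openin (top_of_set E) u'" "u \<inter> u' = {}"
      using V(3)[OF _ _ eq[OF z(1)] V(1) z(2)] by blast
    have "openin (top_of_set T) ((T \<inter> f -` u) \<inter> (T \<inter> g -` u'))"
      using pre f g u by blast
    moreover have "z \<in> (T \<inter> f -` u) \<inter> (T \<inter> g -` u')" using z u by auto
    moreover have "(T \<inter> f -` u) \<inter> (T \<inter> g -` u') \<subseteq> T - A"
      using u(5) by (auto simp: A_def)
    ultimately show "\<exists>U. openin (top_of_set T) U \<and> z \<in> U \<and> U \<subseteq> T - A" by blast
  qed
  then have "closedin (top_of_set T) A" by (auto simp: closedin_def A_def)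
  ultimately have "A = {} \<or> A = T" using T(1) connected_clopen by blast
  moreover have "a \<in> A" using a T by (auto simp: A_def)
  ultimately show ?thesis using T by (auto simp: A_def)
qed

definition lift_on :: "'e::topological_space set \<Rightarrow> ('e \<Rightarrow> 'b) \<Rightarrow> 'w::topological_space set \<Rightarrow> ('w \<Rightarrow> 'b) \<Rightarrow> ('w \<Rightarrow> 'e) \<Rightarrow> bool"
  where "lift_on E q R H L \<longleftrightarrow> continuous_on R L \<and> L ` R \<subseteq> E \<and> (\<forall>z\<in>R. q (L z) = H z)"

text \<open>The value of the lift may be prescribed at any point of \<open>R\<close>, not only at a corner: this is what
  makes the property pass to unions.\<close>

definition lifts_from_points :: "'e::topological_space set \<Rightarrow> ('e \<Rightarrow> 'b) \<Rightarrow> ('w::topological_space \<Rightarrow> 'b) \<Rightarrow> 'w set \<Rightarrow> bool"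
  where "lifts_from_points E q H R \<longleftrightarrow>
    (\<forall>z\<in>R. \<forall>e\<in>E. q e = H z \<longrightarrow> (\<exists>L. lift_on E q R H L \<and> L z = e))"

text \<open>A lift on one part is continued by the lift on the other part that has the same value at one point
  of the intersection. Both agree on the whole intersection, because it is connected.\<close>

lemma lifts_from_points_Un:
  assumes cov: "covering_space E q B"
    and l: "lifts_from_points E q H R1" "lifts_from_points E q H R2"
    and cl: "closed R1" "closed R2" and con: "connected (R1 \<inter> R2)" and ne: "R1 \<inter> R2 \<noteq> {}"
  shows "lifts_from_points E q H (R1 \<union> R2)"
proof -
  obtain w where w: "w \<in> R1" "w \<in> R2" using ne by blast
  have glue: "lift_on E q (R1 \<union> R2) H (\<lambda>x. if x \<in> R1 then L1 x else L2 x) \<and>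
      (\<forall>x\<in>R2. (if x \<in> R1 then L1 x else L2 x) = L2 x)"
    if "lift_on E q R1 H L1" "lift_on E q R2 H L2" "L1 w = L2 w" for L1 L2
  proof -
    have "L1 x = L2 x" if "x \<in> R1 \<inter> R2" for x
      by (rule covering_lift_unique[OF cov con _ that, of w])
        (use \<open>lift_on E q R1 H L1\<close> \<open>lift_on E q R2 H L2\<close> \<open>L1 w = L2 w\<close> w in
          \<open>auto simp: lift_on_def intro: continuous_on_subset\<close>)
    with that cl show ?thesis
      by (auto simp: lift_on_def intro!: continuous_on_cases)
  qed
  show ?thesis unfolding lifts_from_points_def
  proof (intro ballI impI)
    fix z e assume z: "z \<in> R1 \<union> R2" and e: "e \<in> E" "q e = H z"
    show "\<exists>L. lift_on E q (R1 \<union> R2) H L \<and> L z = e"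
    proof (cases "z \<in> R1")
      case True
      then obtain L1 where L1: "lift_on E q R1 H L1" "L1 z = e"
        using l(1) e by (auto simp: lifts_from_points_def)
      have "L1 w \<in> E" "q (L1 w) = H w" using L1 w by (auto simp: lift_on_def)
      then obtain L2 where L2: "lift_on E q R2 H L2" "L2 w = L1 w"
        using l(2) w by (auto simp: lifts_from_points_def)
      from glue[OF L1(1) L2(1) L2(2)[symmetric]] L1(2) True show ?thesis
        by (intro exI[of _ "\<lambda>x. if x \<in> R1 then L1 x else L2 x"]) auto
    next
      case False
      then have z: "z \<in> R2" using z by auto
      then obtain L2 where L2: "lift_on E q R2 H L2" "L2 z = e"
        using l(2) e by (auto simp: lifts_from_points_def)
      have "L2 w \<in> E" "q (L2 w) = H w" using L2 w by (auto simp: lift_on_def)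
      then obtain L1 where L1: "lift_on E q R1 H L1" "L1 w = L2 w"
        using l(1) w by (auto simp: lifts_from_points_def)
      from glue[OF L1(1) L2(1) L1(2)] L2(2) z show ?thesis
        by (intro exI[of _ "\<lambda>x. if x \<in> R1 then L1 x else L2 x"]) auto
    qed
  qed
qed

text \<open>Small squares are mapped into evenly covered sets, where a local section gives the lift. Bisection
  in the second coordinate assembles a thin strip around each value of the first coordinate from
  small squares, and bisection in the first coordinate assembles the rectangle from thin strips.\<close>

lemma lifts_from_points_rectangle:
  fixes H :: "real \<times> real \<Rightarrow> 'b::topological_space"
  assumes cov: "covering_space E q B" and H: "continuous_on UNIV H" "range H \<subseteq> B"
    and ab: "a \<le> b" and cd: "c \<le> d"
  shows "lifts_from_points E q H ({a..b} \<times> {c..d})"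
proof -
  have small: "\<exists>\<delta>>0. \<forall>a b c d. a \<le> x \<and> x \<le> b \<and> b - a < \<delta> \<longrightarrow> c \<le> y \<and> y \<le> d \<and> d - c < \<delta> \<longrightarrow>
      lifts_from_points E q H ({a..b} \<times> {c..d})" for x y
  proof -
    have "H (x, y) \<in> B" using H by auto
    then obtain T where T: "H (x, y) \<in> T" "openin (top_of_set B) T"
      "\<And>e. e \<in> E \<Longrightarrow> q e \<in> T \<Longrightarrow> \<exists>u s. e \<in> u \<and> openin (top_of_set E) u \<and> homeomorphism u T q s"
      by (rule covering_sheets[OF cov]) metis
    obtain O' where O': "open O'" "T = B \<inter> O'" using T(2) by (auto simp: openin_open)
    have "open (H -` O')" using H(1) O'(1) by (simp add: open_vimage)
    moreover have "(x, y) \<in> H -` O'" using T O' by auto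
    ultimately obtain A C where AC: "open A" "open C" "x \<in> A" "y \<in> C" "A \<times> C \<subseteq> H -` O'"
      by (auto elim: open_prod_elim)
    obtain \<delta>1 where d1: "\<delta>1 > 0" "ball x \<delta>1 \<subseteq> A" using AC open_contains_ball by metis
    obtain \<delta>2 where d2: "\<delta>2 > 0" "ball y \<delta>2 \<subseteq> C" using AC open_contains_ball by metis
    have "lifts_from_points E q H ({a..b} \<times> {c..d})"
      if "a \<le> x" "x \<le> b" "b - a < min \<delta>1 \<delta>2" "c \<le> y" "y \<le> d" "d - c < min \<delta>1 \<delta>2" for a b c d
    proof -
      have "{a..b} \<subseteq> ball x \<delta>1" "{c..d} \<subseteq> ball y \<delta>2"
        using that by (auto simp: dist_real_def)
      then have R: "H z \<in> T" if "z \<in> {a..b} \<times> {c..d}" for z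
        using that d1 d2 AC O' H(2) by (cases z) fastforce
      show ?thesis unfolding lifts_from_points_def
      proof (intro ballI impI)
        fix z e assume z: "z \<in> {a..b} \<times> {c..d}" and e: "e \<in> E" "q e = H z"
        obtain u s where u: "e \<in> u" "openin (top_of_set E) u" "homeomorphism u T q s"
          using T(3)[OF e(1)] R[OF z] e(2) by auto
        have "u \<subseteq> E" using u(2) by (simp add: openin_imp_subset)
        moreover have "s ` T = u" "continuous_on T s" "\<And>y. y \<in> T \<Longrightarrow> q (s y) = y" "s (q e) = e"
          using u by (auto simp: homeomorphism_def)
        moreover have "continuous_on ({a..b} \<times> {c..d}) (s \<circ> H)"
          using R H \<open>continuous_on T s\<close>
          by (intro continuous_on_compose) (auto intro: continuous_on_subset)
        ultimately show "\<exists>L. lift_on E q ({a..b} \<times> {c..d}) H L \<and> L z = e"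
          using R e by (intro exI[of _ "s \<circ> H"]) (auto simp: lift_on_def)
      qed
    qed
    then show ?thesis using d1 d2 by (intro exI[of _ "min \<delta>1 \<delta>2"]) auto
  qed
  have con: "connected ({s..t} \<times> {s'..t'})" for s t s' t' :: real
    by (intro convex_connected convex_Times) auto
  have strip: "\<exists>\<delta>>0. \<forall>a b. a \<le> x \<and> x \<le> b \<and> b - a < \<delta> \<longrightarrow> lifts_from_points E q H ({a..b} \<times> {c..d})" for x
  proof (rule Bolzano[OF cd])
    fix c d e :: real
    assume cd: "\<exists>\<delta>>0. \<forall>a b. a \<le> x \<and> x \<le> b \<and> b - a < \<delta> \<longrightarrow> lifts_from_points E q H ({a..b} \<times> {c..d})"
      and de: "\<exists>\<delta>>0. \<forall>a b. a \<le> x \<and> x \<le> b \<and> b - a < \<delta> \<longrightarrow> lifts_from_points E q H ({a..b} \<times> {d..e})"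
      and le: "c \<le> d" "d \<le> e"
    from cd obtain \<delta>1 where d1: "\<delta>1 > 0" "\<And>a b. a \<le> x \<Longrightarrow> x \<le> b \<Longrightarrow> b - a < \<delta>1 \<Longrightarrow> lifts_from_points E q H ({a..b} \<times> {c..d})"
      by blast
    from de obtain \<delta>2 where d2: "\<delta>2 > 0" "\<And>a b. a \<le> x \<Longrightarrow> x \<le> b \<Longrightarrow> b - a < \<delta>2 \<Longrightarrow> lifts_from_points E q H ({a..b} \<times> {d..e})"
      by blast
    have "lifts_from_points E q H ({a..b} \<times> {c..e})" if "a \<le> x" "x \<le> b" "b - a < min \<delta>1 \<delta>2" for a b
    proof -
      have "{a..b} \<times> {c..e} = {a..b} \<times> {c..d} \<union> {a..b} \<times> {d..e}" using le by auto
      moreover have "({a..b} \<times> {c..d}) \<inter> ({a..b} \<times> {d..e}) = {a..b} \<times> {d..d}" using le by auto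
      moreover have "{a..b} \<times> {d..d} \<noteq> {}" using that by auto
      ultimately show ?thesis
        using lifts_from_points_Un[OF cov d1(2)[of a b] d2(2)[of a b]] that con[of a b d d]
        by (simp add: closed_Times)
    qed
    then show "\<exists>\<delta>>0. \<forall>a b. a \<le> x \<and> x \<le> b \<and> b - a < \<delta> \<longrightarrow> lifts_from_points E q H ({a..b} \<times> {c..e})"
      using d1 d2 by (intro exI[of _ "min \<delta>1 \<delta>2"]) auto
  next
    fix y
    obtain \<delta> where "\<delta> > 0" "\<And>a b c d. a \<le> x \<and> x \<le> b \<and> b - a < \<delta> \<Longrightarrow> c \<le> y \<and> y \<le> d \<and> d - c < \<delta> \<Longrightarrow>
      lifts_from_points E q H ({a..b} \<times> {c..d})" using small[of x y] by metis
    then show "\<exists>d>0. \<forall>a b. a \<le> y \<and> y \<le> b \<and> b - a < d \<longrightarrow>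
       (\<exists>\<delta>>0. \<forall>aa ba. aa \<le> x \<and> x \<le> ba \<and> ba - aa < \<delta> \<longrightarrow> lifts_from_points E q H ({aa..ba} \<times> {a..b}))"
      by metis
  qed
  show ?thesis
  proof (rule Bolzano[OF ab _ strip])
    fix a b e
    assume 1: "lifts_from_points E q H ({a..b} \<times> {c..d})" "lifts_from_points E q H ({b..e} \<times> {c..d})" 
      and le: "a \<le> b" "b \<le> e"
    have "{a..e} \<times> {c..d} = {a..b} \<times> {c..d} \<union> {b..e} \<times> {c..d}" using le by auto
    moreover have "({a..b} \<times> {c..d}) \<inter> ({b..e} \<times> {c..d}) = {b..b} \<times> {c..d}" using le by auto
    moreover have "{b..b} \<times> {c..d} \<noteq> {}" using cd by auto
    ultimately show "lifts_from_points E q H ({a..e} \<times> {c..d})"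
      using lifts_from_points_Un[OF cov 1] con[of b b c d] by (simp add: closed_Times)
  qed
qed

lemma homotopy_lifting_square:
  fixes h :: "real \<times> real \<Rightarrow> 'b::topological_space"
  assumes cov: "covering_space E q B" and h: "continuous_on ({0..1} \<times> {0..1}) h" "h ` ({0..1} \<times> {0..1}) \<subseteq> B"
    and e: "e \<in> E" "q e = h (0, 0)"
  obtains L where "lift_on E q ({0..1} \<times> {0..1}) h L" "L (0, 0) = e"
proof -
  \<comment> \<open>Composition with the retraction of the plane onto the square extends \<open>h\<close> to the plane.\<close>
  define clip :: "real \<Rightarrow> real" where "clip = (\<lambda>t. max 0 (min 1 t))"
  define H where "H = (\<lambda>z. h (clip (fst z), clip (snd z)))"
  have "continuous_on UNIV H" unfolding H_def clip_def
    by (rule continuous_on_compose2[OF h(1)]) (auto intro!: continuous_intros)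
  moreover have "range H \<subseteq> B" using h(2) by (auto simp: H_def clip_def)
  ultimately have l: "lifts_from_points E q H ({0..1} \<times> {0..1})"
    using cov by (intro lifts_from_points_rectangle) auto
  have Hh: "H z = h z" if "z \<in> {0..1} \<times> {0..1}" for z using that by (auto simp: H_def clip_def)
  obtain L where L: "lift_on E q ({0..1} \<times> {0..1}) H L" "L (0, 0) = e"
    using l[unfolded lifts_from_points_def, rule_format, of "(0,0)" e] e Hh[of "(0,0)"] by auto
  have "lift_on E q ({0..1} \<times> {0..1}) h L"
    using L(1) Hh by (simp add: lift_on_def)
  with L that show thesis by blast
qed

text \<open>The lift of \<open>g\<close> that starts at \<open>a\<close> ends at \<open>b\<close>. This is the action of the paths of the base on the
  fibres. Subgroups of the fundamental group are handled below through the loops that fix a point of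
  a fibre.\<close>

definition lift_ends :: "'e::topological_space set \<Rightarrow> ('e \<Rightarrow> 'b) \<Rightarrow> (real \<Rightarrow> 'b) \<Rightarrow> 'e \<Rightarrow> 'e \<Rightarrow> bool" where
  "lift_ends E q g a b \<longleftrightarrow> (\<exists>d. path_between E d a b \<and> (\<forall>t\<in>{0..1}. q (d t) = g t))"

lemma lift_ends_compose: "path_between E d a b \<Longrightarrow> lift_ends E q (q \<circ> d) a b"
  by (auto simp: lift_ends_def)

lemma lift_ends_endpoints: "lift_ends E q g a b \<Longrightarrow> a \<in> E \<and> b \<in> E \<and> q a = pathstart g \<and> q b = pathfinish g"
  by (auto simp: lift_ends_def pathstart_def pathfinish_def dest: path_between_ends)

lemma lift_ends_cong: "(\<And>t. t \<in> {0..1} \<Longrightarrow> g t = g' t) \<Longrightarrow> lift_ends E q g a b \<Longrightarrow> lift_ends E q g' a b"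
  by (auto simp: lift_ends_def)

lemma lift_ends_exists:
  assumes cov: "covering_space E q B" and g: "path g" "path_image g \<subseteq> B" and a: "a \<in> E" "q a = pathstart g"
  shows "\<exists>b. lift_ends E q g a b"
proof -
  have "continuous_on ({0..1} \<times> {0..1}) (\<lambda>z. g (snd z))"
    by (rule continuous_on_compose2[of "{0..1}" g _ snd])
      (use g in \<open>auto simp: path_def intro: continuous_on_snd continuous_on_id\<close>)
  moreover have "(\<lambda>z. g (snd z)) ` ({0..1} \<times> {0..1}) \<subseteq> B" using g by (auto simp: path_image_def)
  moreover have "q a = g (snd (0::real, 0::real))" using a by (simp add: pathstart_def)
  ultimately obtain L where L: "lift_on E q ({0..1::real} \<times> {0..1}) (\<lambda>z. g (snd z)) L" "L (0, 0) = a"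
    using homotopy_lifting_square[OF cov _ _ a(1)] by metis
  have "continuous_on {0..1} (\<lambda>t. L (0, t))"
    using L(1) unfolding lift_on_def
    by (intro continuous_on_compose2[of "{0..1} \<times> {0..1}" L "{0..1}" "Pair 0"]) (auto intro!: continuous_intros)
  then have "path_between E (\<lambda>t. L (0, t)) a (L (0, 1))"
    using L by (auto simp: path_between_def path_def path_image_def pathstart_def pathfinish_def lift_on_def)
  then show ?thesis using L(1) by (force simp: lift_ends_def lift_on_def)
qed

lemma lift_ends_unique:
  assumes cov: "covering_space E q B" and "lift_ends E q g a b" "lift_ends E q g a b'"
  shows "b = b'"
proof -
  from assms obtain d d' where d: "path_between E d a b" "path_between E d' a b'"
    "\<And>t. t \<in> {0..1} \<Longrightarrow> q (d t) = q (d' t)" by (auto simp: lift_ends_def)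
  have "d 1 = d' 1"
    by (rule covering_lift_unique[OF cov, of "{0..1}" 0])
      (use d path_between_ends(1)[OF d(1)] path_between_ends(1)[OF d(2)] in
        \<open>auto simp: path_between_def path_def path_image_def\<close>)
  then show ?thesis using d path_between_ends(2) by metis
qed

lemma lift_ends_const: "a \<in> E \<Longrightarrow> q a = b \<Longrightarrow> lift_ends E q (\<lambda>_. b) a a"
  using path_between_const[of a E] by (auto simp: lift_ends_def)

lemma lift_ends_const_unique:
  "covering_space E q B \<Longrightarrow> lift_ends E q (\<lambda>_. b) a a' \<Longrightarrow> a' = a"
  using lift_ends_unique[of E q B "\<lambda>_. b" a a' a] lift_ends_const[of a E q b] lift_ends_endpoints
  by (metis pathstart_def)

lemma lift_ends_join:
  assumes "lift_ends E q g a b" "lift_ends E q g' b c"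
  shows "lift_ends E q (g +++ g') a c"
proof -
  from assms obtain d d' where d: "path_between E d a b" "path_between E d' b c"
    "\<And>t. t \<in> {0..1} \<Longrightarrow> q (d t) = g t" "\<And>t. t \<in> {0..1} \<Longrightarrow> q (d' t) = g' t" by (auto simp: lift_ends_def)
  then show ?thesis unfolding lift_ends_def
    by (intro exI[of _ "d +++ d'"] conjI path_between_join) (auto simp: joinpaths_def)
qed

lemma lift_ends_reverse:
  assumes "lift_ends E q g a b" shows "lift_ends E q (reversepath g) b a"
proof -
  from assms obtain d where d: "path_between E d a b"
    "\<And>t. t \<in> {0..1} \<Longrightarrow> q (d t) = g t" by (auto simp: lift_ends_def)
  then show ?thesis unfolding lift_ends_def
    by (intro exI[of _ "reversepath d"]) (auto simp: reversepath_def intro: path_between_reverse[unfolded reversepath_def])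
qed

lemma lift_ends_reverse_iff: "lift_ends E q (reversepath g) b a \<longleftrightarrow> lift_ends E q g a b"
  using lift_ends_reverse[of E q g a b] lift_ends_reverse[of E q "reversepath g" b a] by auto

lemma lift_ends_joinE:
  assumes cov: "covering_space E q B" and g: "path g" "path_image g \<subseteq> B" "pathfinish g = pathstart g'"
    and g': "path g'" "path_image g' \<subseteq> B"
    and l: "lift_ends E q (g +++ g') a c"
  obtains b where "lift_ends E q g a b" "lift_ends E q g' b c"
proof -
  have "a \<in> E" "q a = pathstart g" using lift_ends_endpoints[OF l] by auto
  then obtain b where b: "lift_ends E q g a b" using lift_ends_exists[OF cov g(1,2)] by blast
  have "b \<in> E" "q b = pathstart g'" using lift_ends_endpoints[OF b] g by auto
  then obtain c' where c': "lift_ends E q g' b c'" using lift_ends_exists[OF cov g'] by blast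
  have "c' = c" by (rule lift_ends_unique[OF cov lift_ends_join[OF b c'] l])
  with b c' that show thesis by blast
qed

lemma lift_ends_along_square:
  fixes h :: "real \<times> real \<Rightarrow> 'b::topological_space"
  assumes L: "lift_on E q ({0..1} \<times> {0..1}) h L"
    and k: "continuous_on {0..1} k" "k ` {0..1} \<subseteq> {0..1} \<times> {0..1}"
  shows "lift_ends E q (\<lambda>t. h (k t)) (L (k 0)) (L (k 1))"
proof -
  have "continuous_on {0..1} (\<lambda>t. L (k t))"
    using L k unfolding lift_on_def
    by (intro continuous_on_compose2[of "{0..1} \<times> {0..1}" L "{0..1}" k]) auto
  then have "path_between E (\<lambda>t. L (k t)) (L (k 0)) (L (k 1))"
    using L k by (auto simp: path_between_def path_def path_image_def pathstart_def pathfinish_def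
        lift_on_def image_subset_iff)
  then show ?thesis using L k by (force simp: lift_ends_def lift_on_def image_subset_iff)
qed

text \<open>In the lift of a homotopy rel endpoints, the two sides over the endpoints are lifts of constant
  paths, hence constant.\<close>

lemma lift_ends_homotopic:
  fixes B :: "'b::topological_space set"
  assumes cov: "covering_space E q B" and h: "homotopic_paths B g g'" and l: "lift_ends E q g a b"
  shows "lift_ends E q g' a b"
proof -
  obtain h :: "real \<times> real \<Rightarrow> 'b" where h: "continuous_on ({0..1} \<times> {0..1}) h" "h \<in> ({0..1} \<times> {0..1}) \<rightarrow> B"
    "\<And>x. x \<in> {0..1} \<Longrightarrow> h (0, x) = g x" "\<And>x. x \<in> {0..1} \<Longrightarrow> h (1, x) = g' x"
    "\<And>t. t \<in> {0..1} \<Longrightarrow> h (t, 0) = g 0 \<and> h (t, 1) = g 1"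
    using h unfolding homotopic_paths pathstart_def pathfinish_def comp_def by blast
  have a: "a \<in> E" "q a = g 0" using lift_ends_endpoints[OF l] by (auto simp: pathstart_def)
  obtain L where L: "lift_on E q ({0..1::real} \<times> {0..1}) h L" "L (0, 0) = a"
    by (rule homotopy_lifting_square[OF cov h(1) _ a(1)]) (use h(2) h(3)[of 0] a in auto)
  note side = lift_ends_along_square[OF L(1)]
  have "lift_ends E q (\<lambda>t. h (0, t)) (L (0, 0)) (L (0, 1))"
    by (rule side) (auto intro!: continuous_intros)
  then have "lift_ends E q g a (L (0, 1))" 
    using lift_ends_cong[of "\<lambda>t. h (0, t)" g] L(2) h(3) by simp
  then have L01: "L (0, 1) = b" using lift_ends_unique[OF cov _ l] by blast
  have "lift_ends E q (\<lambda>t. h (t, 1)) (L (0, 1)) (L (1, 1))"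
    by (rule side) (auto intro!: continuous_intros)
  then have "lift_ends E q (\<lambda>_. g 1) (L (0, 1)) (L (1, 1))" by (rule lift_ends_cong[rotated]) (use h(5) in auto)
  then have L11: "L (1, 1) = b" using lift_ends_const_unique[OF cov] L01 by metis
  have "lift_ends E q (\<lambda>t. h (t, 0)) (L (0, 0)) (L (1, 0))"
    by (rule side) (auto intro!: continuous_intros)
  then have "lift_ends E q (\<lambda>_. g 0) (L (0, 0)) (L (1, 0))" by (rule lift_ends_cong[rotated]) (use h(5) in auto)
  then have L10: "L (1, 0) = a" using lift_ends_const_unique[OF cov] L(2) by metis
  have "lift_ends E q (\<lambda>t. h (1, t)) (L (1, 0)) (L (1, 1))"
    by (rule side) (auto intro!: continuous_intros)
  then show ?thesis 
    using lift_ends_cong[of "\<lambda>t. h (1, t)" g'] L10 L11 h(4) by simp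
qed

text \<open>During a free homotopy from a loop to a constant, the start and the end of the loop run along the
  same path. Its two lifts, from the start and the end of the lifted loop, arrive at the same point,
  so they also depart from the same point.\<close>

lemma lift_ends_null_loop:
  fixes B :: "'b::topological_space set"
  assumes cov: "covering_space E q B" and h: "homotopic_loops B g (\<lambda>_. c)" and l: "lift_ends E q g a b"
  shows "b = a"
proof -
  obtain h :: "real \<times> real \<Rightarrow> 'b" where h: "continuous_on ({0..1} \<times> {0..1}) h" "h \<in> ({0..1} \<times> {0..1}) \<rightarrow> B"
    "\<And>x. x \<in> {0..1} \<Longrightarrow> h (0, x) = g x" "\<And>x. x \<in> {0..1} \<Longrightarrow> h (1, x) = c"
    "\<And>t. t \<in> {0..1} \<Longrightarrow> h (t, 1) = h (t, 0)"
    using h unfolding homotopic_loops pathstart_def pathfinish_def comp_def by blast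
  have a: "a \<in> E" "q a = g 0" using lift_ends_endpoints[OF l] by (auto simp: pathstart_def)
  obtain L where L: "lift_on E q ({0..1::real} \<times> {0..1}) h L" "L (0, 0) = a"
    by (rule homotopy_lifting_square[OF cov h(1) _ a(1)]) (use h(2) h(3)[of 0] a in auto)
  note side = lift_ends_along_square[OF L(1)]
  have "lift_ends E q (\<lambda>t. h (0, t)) (L (0, 0)) (L (0, 1))"
    by (rule side) (auto intro!: continuous_intros)
  then have "lift_ends E q g a (L (0, 1))"
    using lift_ends_cong[of "\<lambda>t. h (0, t)" g] L(2) h(3) by simp
  then have L01: "L (0, 1) = b" using lift_ends_unique[OF cov _ l] by blast
  have "lift_ends E q (\<lambda>t. h (1, t)) (L (1, 0)) (L (1, 1))"
    by (rule side) (auto intro!: continuous_intros)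
  then have "lift_ends E q (\<lambda>_. c) (L (1, 0)) (L (1, 1))" by (rule lift_ends_cong[rotated]) (use h(4) in auto)
  then have L11: "L (1, 1) = L (1, 0)" using lift_ends_const_unique[OF cov] by metis
  have "lift_ends E q (\<lambda>t. h (1 - t, 0)) (L (1 - 0, 0)) (L (1 - 1, 0))"
    by (rule side) (auto intro!: continuous_intros)
  moreover have "lift_ends E q (\<lambda>t. h (1 - t, 1)) (L (1 - 0, 1)) (L (1 - 1, 1))"
    by (rule side) (auto intro!: continuous_intros)
  then have "lift_ends E q (\<lambda>t. h (1 - t, 0)) (L (1 - 0, 1)) (L (1 - 1, 1))"
    by (rule lift_ends_cong[rotated]) (use h(5) in auto)
  ultimately have "L (0, 0) = L (0, 1)" using lift_ends_unique[OF cov] L11 by fastforce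
  then show ?thesis using L(2) L01 by simp
qed

section \<open>Local path connectedness\<close>

lemma connected_locally_path_connected_imp_path_connected:
  fixes S :: "'a::topological_space set"
  assumes "connected S" "locally path_connected S"
  shows "path_connected S"
  unfolding path_connected_component
proof (intro ballI)
  fix a b assume ab: "a \<in> S" "b \<in> S"
  have "openin (top_of_set S) (path_component_set S a)" "closedin (top_of_set S) (path_component_set S a)"
    using assms(2) by (auto intro: openin_path_component_locally_path_connected
        closedin_path_component_locally_path_connected)
  then have "path_component_set S a = {} \<or> path_component_set S a = S"
    using assms(1) connected_clopen by blast
  moreover have "a \<in> path_component_set S a" using ab by (simp add: path_component_refl)
  ultimately show "path_component S a b" using ab by auto
qed

lemma covering_locally_path_connected:
  fixes E :: "'e::topological_space set" and B :: "'b::topological_space set"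
  assumes cov: "covering_space E q B" and B: "locally path_connected B"
  shows "locally path_connected E"
  unfolding locally_path_connected
proof (intro allI impI, elim conjE)
  fix V x assume V: "openin (top_of_set E) V" "x \<in> V"
  then have x: "x \<in> E" using openin_imp_subset by blast
  obtain u T s where u: "x \<in> u" "openin (top_of_set E) u" "q x \<in> T" "openin (top_of_set B) T"
    "homeomorphism u T q s"
    using covering_space_local_homeomorphism[OF cov x] by metis
  have "openin (top_of_set u) (u \<inter> V)"
    using V(1) u(2) by (metis inf.absorb_iff2 inf_commute openin_Int openin_imp_subset openin_subset_trans inf_le1)
  then have "openin (top_of_set T) (q ` (u \<inter> V))"
    using homeomorphism_imp_open_map[OF u(5)] by blast
  then have "openin (top_of_set B) (q ` (u \<inter> V))" using u(4) openin_trans by blast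
  moreover have "q x \<in> q ` (u \<inter> V)" using u V by blast
  ultimately obtain U where U: "openin (top_of_set B) U" "path_connected U" "q x \<in> U" "U \<subseteq> q ` (u \<inter> V)"
    using B unfolding locally_path_connected by meson
  have UT: "U \<subseteq> T" using U(4) u(5) by (auto simp: homeomorphism_def)
  have "openin (top_of_set T) U"
    using U(1) UT u(4) by (meson openin_imp_subset openin_subset_trans)
  then have "openin (top_of_set u) (s ` U)"
    using homeomorphism_imp_open_map[OF homeomorphism_symD[OF u(5)]] by blast
  then have "openin (top_of_set E) (s ` U)" using u(2) openin_trans by blast
  moreover have "path_connected (s ` U)"
    using u(5) UT U(2) by (intro path_connected_continuous_image)
      (auto simp: homeomorphism_def intro: continuous_on_subset)
  moreover have "x \<in> s ` U" using u U by (metis homeomorphism_apply1 image_eqI)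
  moreover have "s ` U \<subseteq> V" using U(4) u(5) by (fastforce simp: homeomorphism_def)
  ultimately show "\<exists>U. openin (top_of_set E) U \<and> path_connected U \<and> x \<in> U \<and> U \<subseteq> V" by blast
qed

lemma path_between_power:
  assumes "\<And>i. i < m \<Longrightarrow> path_between (W i) (p i) (x i) (y i)"
    "x \<in> extensional {..<m}" "y \<in> extensional {..<m}"
  shows "path_between (\<Pi>\<^sub>E i\<in>{..<m}. W i) (\<lambda>t. \<lambda>i\<in>{..<m}. p i t) x y"
proof -
  have "continuous_on {0..1} (\<lambda>t. (\<lambda>i\<in>{..<m}. p i t) i)" for i
  proof (cases "i < m")
    case True
    then show ?thesis using assms(1)[OF True] by (simp add: path_between_def path_def)
  qed simp
  then have "path (\<lambda>t. \<lambda>i\<in>{..<m}. p i t)"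
    unfolding path_def by (intro continuous_on_coordinatewise_then_product) auto
  moreover have "p i t \<in> W i" if "i < m" "t \<in> {0..1}" for i t
    using assms(1)[OF that(1)] that(2) by (rule path_between_in)
  moreover have "(\<lambda>i\<in>{..<m}. p i 0) = x" "(\<lambda>i\<in>{..<m}. p i 1) = y"
    using assms(1)[THEN path_between_ends(1)] assms(1)[THEN path_between_ends(2)] assms(2,3)
    by (auto intro!: ext simp: restrict_def extensional_def)
  ultimately show ?thesis
    by (auto simp: path_between_def path_image_def pathstart_def pathfinish_def PiE_iff split: if_splits)
qed

lemma locally_path_connected_power_space:
  fixes S :: "'a::topological_space set"
  assumes S: "locally path_connected S"
  shows "locally path_connected (power_space m S)"
  unfolding locally_path_connected
proof (intro allI impI, elim conjE)
  fix V x assume V: "openin (top_of_set (power_space m S)) V" "x \<in> V"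
  then obtain O' where O': "open O'" "V = power_space m S \<inter> O'" by (auto simp: openin_open)
  then have x: "x \<in> power_space m S" "x \<in> O'" using V by auto
  have "openin (product_topology (\<lambda>i. euclidean) UNIV) O'" using O' by (simp add: open_fun_def)
  from product_topology_open_contains_basis[OF this x(2)]
  obtain U where U: "x \<in> Pi\<^sub>E UNIV U" "\<And>i. open (U i)" "Pi\<^sub>E UNIV U \<subseteq> O'" by auto
  have "\<exists>W. openin (top_of_set S) W \<and> path_connected W \<and> x i \<in> W \<and> W \<subseteq> S \<inter> U i" if "i < m" for i
  proof -
    have "openin (top_of_set S) (S \<inter> U i)" "x i \<in> S \<inter> U i"
      using U x that by (auto simp: power_space_def)
    then show ?thesis using S unfolding locally_path_connected by meson
  qed
  then obtain W where W: "\<And>i. i < m \<Longrightarrow> openin (top_of_set S) (W i)" "\<And>i. i < m \<Longrightarrow> path_connected (W i)"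
     "\<And>i. i < m \<Longrightarrow> x i \<in> W i" "\<And>i. i < m \<Longrightarrow> W i \<subseteq> S \<inter> U i" by metis
  obtain P where P: "\<And>i. i < m \<Longrightarrow> open (P i)" "\<And>i. i < m \<Longrightarrow> W i = S \<inter> P i"
    using W(1) unfolding openin_open by metis
  define N where "N = (\<Pi>\<^sub>E i\<in>{..<m}. W i)"
  have "open (\<Inter>i<m. {y. y i \<in> P i})"
  proof (intro open_INT ballI)
    fix i assume "i \<in> {..<m}"
    then show "open {y. y i \<in> P i}"
      using open_vimage[OF P(1)[of i] continuous_on_product_coordinates[of i]] by (simp add: vimage_def)
  qed simp
  moreover have "N = power_space m S \<inter> (\<Inter>i<m. {y. y i \<in> P i})"
    using P(2) by (auto simp: N_def power_space_def PiE_iff)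
  ultimately have "openin (top_of_set (power_space m S)) N" by (auto simp: openin_open)
  moreover have "path_connected N"
    unfolding path_connected_component
  proof (intro ballI)
    fix y z assume yz: "y \<in> N" "z \<in> N"
    have "\<exists>p. path_between (W i) p (y i) (z i)" if "i < m" for i
      using W(2)[OF that] yz that unfolding path_connected_component path_component_iff_path_between
      by (metis N_def PiE_mem lessThan_iff)
    then obtain p where "\<And>i. i < m \<Longrightarrow> path_between (W i) (p i) (y i) (z i)" by metis
    with yz show "path_component N y z"
      unfolding N_def path_component_iff_path_between
      by (intro exI) (rule path_between_power, auto simp: PiE_iff)
  qed
  moreover have "x \<in> N" using x W(3) by (auto simp: N_def power_space_def PiE_iff)
  moreover have "N \<subseteq> V"
  proof
    fix y assume y: "y \<in> N"
    have "y i \<in> U i" for i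
    proof (cases "i < m")
      case True then show ?thesis using y W(4) by (auto simp: N_def)
    next
      case False
      \<comment> \<open>Outside the index range every point of the power takes the value \<^const>\<open>undefined\<close>.\<close>
      then have "y i = x i" using y x by (auto simp: N_def power_space_def PiE_iff extensional_def)
      then show ?thesis using U(1) by auto
    qed
    then have "y \<in> O'" using U(3) by auto
    moreover have "y \<in> power_space m S" using y W(4) by (fastforce simp: N_def power_space_def PiE_iff)
    ultimately show "y \<in> V" using O' by auto
  qed
  ultimately show "\<exists>U. openin (top_of_set (power_space m S)) U \<and> path_connected U \<and> x \<in> U \<and> U \<subseteq> V"
    by blast
qed

section \<open>The lifting criterion\<close>

lemma continuous_on_if_locally:
  assumes "\<And>x. x \<in> W \<Longrightarrow> \<exists>V. openin (top_of_set W) V \<and> x \<in> V \<and> continuous_on V f"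
  shows "continuous_on W f"
  unfolding continuous_on_def
proof
  fix x assume x: "x \<in> W"
  then obtain V where V: "openin (top_of_set W) V" "x \<in> V" "continuous_on V f" using assms by blast
  then obtain O' where O': "open O'" "V = W \<inter> O'" by (auto simp: openin_open)
  have "at x within V = at x within W"
    using O' V(2) at_within_nhd[of x O' W V] by (auto simp: Int_ac)
  moreover have "(f \<longlongrightarrow> f x) (at x within V)" using V by (auto simp: continuous_on_def)
  ultimately show "(f \<longlongrightarrow> f x) (at x within W)" by simp
qed

text \<open>\<open>W\<close> may be disconnected, so \<open>base\<close> picks a point in each path component and \<open>e\<close> a point over its
  image. The lift sends \<open>w\<close> to the end of the lifted image of any path from \<open>base w\<close> to \<open>w\<close>; the condition
  on loops makes this independent of the path. It is continuous because on a path-connected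
  neighbourhood it is \<open>G\<close> followed by a local section of \<open>q\<close>.\<close>

lemma lift_exists_if_loops_lift:
  fixes E :: "'e::topological_space set" and B :: "'b::topological_space set" and W :: "'w::topological_space set"
  assumes cov: "covering_space E q B" and W: "locally path_connected W"
    and G: "continuous_on W G" "G ` W \<subseteq> B"
    and base: "\<And>w. w \<in> W \<Longrightarrow> path_component W (base w) w"
      "\<And>w w'. path_component W w w' \<Longrightarrow> base w = base w'"
    and e: "\<And>w. w \<in> W \<Longrightarrow> e (base w) \<in> E \<and> q (e (base w)) = G (base w)"
    and loops: "\<And>w r. w \<in> W \<Longrightarrow> path_between W r (base w) (base w) \<Longrightarrow>
       lift_ends E q (G \<circ> r) (e (base w)) (e (base w))"
  shows "\<exists>F. lift_on E q W G F"
proof -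
  define F where "F w = (SOME x. \<exists>p. path_between W p (base w) w \<and> lift_ends E q (G \<circ> p) (e (base w)) x)" for w
  have Gp: "path (G \<circ> p)" "path_image (G \<circ> p) \<subseteq> B" "pathstart (G \<circ> p) = G a" "pathfinish (G \<circ> p) = G b"
    if "path_between W p a b" for p a b
    using path_between_image[OF that G] by (auto simp: path_between_def)
  have key: "lift_ends E q (G \<circ> p) (e (base w)) (F w)" if w: "w \<in> W" and p: "path_between W p (base w) w" for w p
  proof -
    have ex: "\<exists>x. lift_ends E q (G \<circ> p) (e (base w)) x" if p: "path_between W p (base w) w" for p
      using lift_ends_exists[OF cov Gp(1,2)[OF p], of "e (base w)"] e[OF w] Gp(3)[OF p] by simp
    then have "\<exists>x p. path_between W p (base w) w \<and> lift_ends E q (G \<circ> p) (e (base w)) x"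
      using p by blast
    then have "\<exists>p. path_between W p (base w) w \<and> lift_ends E q (G \<circ> p) (e (base w)) (F w)"
      unfolding F_def by (rule someI_ex)
    then obtain p1 where p1: "path_between W p1 (base w) w" "lift_ends E q (G \<circ> p1) (e (base w)) (F w)"
      by blast
    have r: "path_between W (p +++ reversepath p1) (base w) (base w)"
      using p p1 by (blast intro: path_between_join path_between_reverse)
    have l: "lift_ends E q ((G \<circ> p) +++ reversepath (G \<circ> p1)) (e (base w)) (e (base w))"
      using loops[OF w r] by (simp add: path_compose_join path_compose_reversepath)
    obtain b where b: "lift_ends E q (G \<circ> p) (e (base w)) b" "lift_ends E q (reversepath (G \<circ> p1)) b (e (base w))"
      by (rule lift_ends_joinE[OF cov _ _ _ _ _ l]) (use Gp[OF p] Gp[OF p1(1)] in auto)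
    then have "lift_ends E q (G \<circ> p1) (e (base w)) b" by (simp add: lift_ends_reverse_iff)
    then have "b = F w" using lift_ends_unique[OF cov _ p1(2)] by blast
    with b show ?thesis by simp
  qed
  have pe: "\<exists>p. path_between W p (base w) w" if "w \<in> W" for w
    using base(1)[OF that] by (simp add: path_component_iff_path_between)
  have F: "F w \<in> E" "q (F w) = G w" if "w \<in> W" for w
  proof -
    obtain p where p: "path_between W p (base w) w" using pe[OF \<open>w \<in> W\<close>] by blast
    from lift_ends_endpoints[OF key[OF that p]] Gp(4)[OF p] show "F w \<in> E" "q (F w) = G w" by auto
  qed
  have "continuous_on W F"
  proof (rule continuous_on_if_locally)
    fix w assume w: "w \<in> W"
    obtain u T s where u: "F w \<in> u" "openin (top_of_set E) u" "q (F w) \<in> T" "openin (top_of_set B) T"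
      "homeomorphism u T q s"
      using covering_space_local_homeomorphism[OF cov F(1)[OF w]] by metis
    have "openin (top_of_set W) (W \<inter> G -` T)"
      using G u(4) by (meson continuous_openin_preimage image_subset_iff_funcset)
    moreover have "w \<in> W \<inter> G -` T" using w u F by auto
    ultimately obtain V where V: "openin (top_of_set W) V" "path_connected V" "w \<in> V" "V \<subseteq> W \<inter> G -` T"
      using W unfolding locally_path_connected by meson
    have s: "continuous_on T s" "s ` T = u" "\<And>y. y \<in> T \<Longrightarrow> q (s y) = y" "s (G w) = F w"
      using u F(2)[OF w] by (auto simp: homeomorphism_def)
    have sG: "continuous_on V (s \<circ> G)"
      using V(4) s G by (intro continuous_on_compose) (auto intro: continuous_on_subset)
    have uE: "u \<subseteq> E" using u(2) by (simp add: openin_imp_subset)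
    have "F w' = s (G w')" if w': "w' \<in> V" for w'
    proof -
      obtain d where d: "path_between V d w w'"
        using V(2,3) w' unfolding path_connected_component path_component_iff_path_between by blast
      have dW: "path_between W d w w'" using d V(4) by (blast intro: path_between_mono)
      have "path_between E ((s \<circ> G) \<circ> d) ((s \<circ> G) w) ((s \<circ> G) w')"
        by (rule path_between_image[OF d sG]) (use s(2) V(4) uE in force)
      then have "lift_ends E q (q \<circ> ((s \<circ> G) \<circ> d)) (F w) (s (G w'))"
        using s(4) lift_ends_compose by fastforce
      then have l: "lift_ends E q (G \<circ> d) (F w) (s (G w'))"
        by (rule lift_ends_cong[rotated]) (use path_between_in[OF d] V(4) s(3) in auto)
      obtain p where p: "path_between W p (base w) w" using pe[OF w] by blast
      have pd: "path_between W (p +++ d) (base w) w'" using p dW by (rule path_between_join)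
      have bw: "base w = base w'" using base(2) dW by (auto simp: path_component_iff_path_between)
      have w'W: "w' \<in> W" using w' V by auto
      have "lift_ends E q (G \<circ> (p +++ d)) (e (base w)) (s (G w'))"
        using lift_ends_join[OF key[OF w p] l] by (simp add: path_compose_join)
      moreover have "lift_ends E q (G \<circ> (p +++ d)) (e (base w)) (F w')"
        using key[OF w'W, of "p +++ d"] pd bw by simp
      ultimately show ?thesis by (rule lift_ends_unique[OF cov, symmetric])
    qed
    then have "continuous_on V F" using sG by (auto cong: continuous_on_cong)
    with V show "\<exists>V. openin (top_of_set W) V \<and> w \<in> V \<and> continuous_on V F" by blast
  qed
  then have "lift_on E q W G F" using F by (auto simp: lift_on_def)
  then show ?thesis by blast
qed

lemma lifting_criterion:
  fixes E :: "'e::topological_space set" and B :: "'b::topological_space set" and W :: "'w::topological_space set"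
  assumes cov: "covering_space E q B" and W: "locally path_connected W"
    and G: "continuous_on W G" "G ` W \<subseteq> B"
  shows "(\<exists>F. lift_on E q W G F) \<longleftrightarrow>
    (\<forall>w\<in>W. \<exists>e\<in>E. q e = G w \<and> (\<forall>r. path_between W r w w \<longrightarrow> lift_ends E q (G \<circ> r) e e))"
proof
  assume "\<exists>F. lift_on E q W G F"
  then obtain F where F: "continuous_on W F" "F ` W \<subseteq> E" "\<And>w. w \<in> W \<Longrightarrow> q (F w) = G w"
    by (auto simp: lift_on_def)
  show "\<forall>w\<in>W. \<exists>e\<in>E. q e = G w \<and> (\<forall>r. path_between W r w w \<longrightarrow> lift_ends E q (G \<circ> r) e e)"
  proof (intro ballI bexI conjI allI impI)
    fix w r assume r: "path_between W r w w"
    show "lift_ends E q (G \<circ> r) (F w) (F w)"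
      using path_between_image[OF r F(1,2)] path_between_in[OF r] F(3)
      by (auto simp: lift_ends_def)
  qed (use F in auto)
next
  assume *: "\<forall>w\<in>W. \<exists>e\<in>E. q e = G w \<and> (\<forall>r. path_between W r w w \<longrightarrow> lift_ends E q (G \<circ> r) e e)"
  then obtain e where e: "\<And>w. w \<in> W \<Longrightarrow> e w \<in> E \<and> q (e w) = G w"
    "\<And>w r. w \<in> W \<Longrightarrow> path_between W r w w \<Longrightarrow> lift_ends E q (G \<circ> r) (e w) (e w)" by metis
  define base where "base w = (SOME v. path_component W w v)" for w
  have b1: "path_component W w (base w)" if "w \<in> W" for w
    unfolding base_def using that by (metis path_component_refl someI)
  have b2: "base w = base w'" if "path_component W w w'" for w w'
  proof -
    have "path_component W w = path_component W w'"
      using that by (auto intro!: ext intro: path_component_trans path_component_sym)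
    then show ?thesis by (simp add: base_def)
  qed
  have b3: "base w \<in> W" if "w \<in> W" for w using b1[OF that] path_component_mem by blast
  show "\<exists>F. lift_on E q W G F"
    by (rule lift_exists_if_loops_lift[OF cov W G, of base e])
      (use b1 b2 b3 e in \<open>auto intro: path_component_sym\<close>)
qed

section \<open>Homotopy algebra of paths\<close>

lemma homotopic_paths_const_right:
  fixes S :: "'a::topological_space set"
  assumes "path_between S p a b"
  shows "homotopic_paths S (p +++ (\<lambda>_. b)) p"
proof (rule homotopic_paths_sym, rule homotopic_paths_reparametrize[where f = "\<lambda>t. if t \<le> 1/2 then 2 * t else 1"])
  show "continuous_on {0..1} (\<lambda>t::real. if t \<le> 1/2 then 2 * t else 1)"
    unfolding split_01 by (rule continuous_on_cases continuous_intros | force)+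
qed (use assms path_between_ends[OF assms] in \<open>auto simp: path_between_def joinpaths_def\<close>)

lemma homotopic_paths_const_left:
  assumes "path_between S p a b"
  shows "homotopic_paths S ((\<lambda>_. a) +++ p) p"
proof -
  have "homotopic_paths S (reversepath (reversepath p +++ (\<lambda>_. a))) (reversepath (reversepath p))"
    by (rule homotopic_paths_reversepath_D, rule homotopic_paths_const_right, rule path_between_reverse[OF assms])
  moreover have "reversepath (\<lambda>_. a) = (\<lambda>_. a)" by (simp add: reversepath_def)
  moreover have "pathfinish (reversepath p) = pathstart (\<lambda>_. a)"
    using assms by (simp add: path_between_def pathstart_def)
  ultimately show ?thesis by (simp add: reversepath_joinpaths)
qed

lemma homotopic_paths_reverse_right:
  fixes S :: "'a::topological_space set"
  assumes p: "path_between S p a b"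
  shows "homotopic_paths S (p +++ reversepath p) (\<lambda>_. a)"
proof (rule homotopic_paths_sym)
  let ?A = "{0..1} \<times> {0..1::real}"
  \<comment> \<open>At time \<open>s\<close> the homotopy runs out and back along the part of \<open>p\<close> over \<open>[0, s]\<close>.\<close>
  let ?h = "\<lambda>y. ((\<lambda>t. p (fst y * t)) +++ reversepath (\<lambda>t. p (fst y * t))) (snd y)"
  have c: "continuous_on {0..1} p" using p by (auto simp: path_between_def path_def)
  have "continuous_on ?A ?h"
    unfolding joinpaths_def reversepath_def
  proof (rule continuous_on_cases_le)
    show "continuous_on {x \<in> ?A. snd x \<le> 1/2} (\<lambda>t. p (fst t * (2 * snd t)))"
         "continuous_on {x \<in> ?A. 1/2 \<le> snd x} (\<lambda>t. p (fst t * (1 - (2 * snd t - 1))))"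
         "continuous_on ?A snd"
      by (intro continuous_on_compose2 [OF c] continuous_intros; auto simp: mult_le_one)+
  qed (auto simp: algebra_simps)
  moreover have "?h z \<in> S" if "z \<in> ?A" for z
    using that path_between_in[OF p]
    by (auto simp: joinpaths_def reversepath_def mult_le_one)
  ultimately show "homotopic_paths S (\<lambda>_. a) (p +++ reversepath p)"
    using path_between_ends[OF p] unfolding homotopic_paths
    by (intro exI[of _ ?h])
      (auto simp: joinpaths_def reversepath_def pathstart_def pathfinish_def)
qed

lemma homotopic_paths_reverse_left:
  assumes "path_between S p a b"
  shows "homotopic_paths S (reversepath p +++ p) (\<lambda>_. b)"
  using homotopic_paths_reverse_right[OF path_between_reverse[OF assms]] by simp

lemma homotopic_paths_assoc_between:
  assumes "path_between S p a b" "path_between S q b c" "path_between S r c d"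
  shows "homotopic_paths S (p +++ (q +++ r)) ((p +++ q) +++ r)"
  using assms by (intro homotopic_paths_assoc) (auto simp: path_between_def)

lemma homotopic_paths_join_between:
  assumes "homotopic_paths S p p'" "homotopic_paths S q q'" "path_between S p a b" "path_between S q b c"
  shows "homotopic_paths S (p +++ q) (p' +++ q')"
  using assms by (intro homotopic_paths_join) (auto simp: path_between_def)

lemma homotopic_paths_refl_between: "path_between S p a b \<Longrightarrow> homotopic_paths S p p"
  by (simp add: path_between_def)

lemma path_between_homotopic:
  "homotopic_paths S p p' \<Longrightarrow> path_between S p a b \<Longrightarrow> path_between S p' a b"
  using homotopic_paths_imp_path homotopic_paths_imp_subset homotopic_paths_imp_pathstart
    homotopic_paths_imp_pathfinish unfolding path_between_def by metis

lemma homotopic_paths_cancel_right: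
  assumes p: "path_between S p a b" and r: "path_between S r b c"
  shows "homotopic_paths S ((p +++ r) +++ reversepath r) p"
proof -
  note r' = path_between_reverse[OF r]
  have "homotopic_paths S ((p +++ r) +++ reversepath r) (p +++ (r +++ reversepath r))"
    using homotopic_paths_assoc_between[OF p r r'] by (rule homotopic_paths_sym)
  also have "homotopic_paths S \<dots> (p +++ (\<lambda>_. b))"
    by (rule homotopic_paths_join_between[OF homotopic_paths_refl_between[OF p]
          homotopic_paths_reverse_right[OF r] p path_between_join[OF r r']])
  also have "homotopic_paths S \<dots> p" using p by (rule homotopic_paths_const_right)
  finally show ?thesis .
qed

definition conjugate_path :: "(real \<Rightarrow> 'a::topological_space) \<Rightarrow> (real \<Rightarrow> 'a) \<Rightarrow> real \<Rightarrow> 'a" where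
  "conjugate_path g r = g +++ (r +++ reversepath g)"

lemma path_between_conjugate:
  "path_between S g a b \<Longrightarrow> path_between S r b b \<Longrightarrow> path_between S (conjugate_path g r) a a"
  unfolding conjugate_path_def by (blast intro: path_between_join path_between_reverse)

lemma conjugate_path_compose: "f \<circ> conjugate_path g r = conjugate_path (f \<circ> g) (f \<circ> r)"
  by (simp add: conjugate_path_def path_compose_join path_compose_reversepath)

lemma conjugate_path_reverse: "conjugate_path (reversepath g) r = reversepath g +++ (r +++ g)"
  by (simp add: conjugate_path_def)

lemma conjugate_path_cong:
  assumes g: "path_between S g a b" and r: "path_between S r b b" and h: "homotopic_paths S r r'"
  shows "homotopic_paths S (conjugate_path g r) (conjugate_path g r')"
proof -
  note g' = path_between_reverse[OF g]
  show ?thesis unfolding conjugate_path_def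
    by (rule homotopic_paths_join_between[OF homotopic_paths_refl_between[OF g]
          homotopic_paths_join_between[OF h homotopic_paths_refl_between[OF g'] r g']
          g path_between_join[OF r g']])
qed

lemma conjugate_path_const:
  assumes g: "path_between S g a b"
  shows "homotopic_paths S (conjugate_path g (\<lambda>_. b)) (\<lambda>_. a)"
proof -
  note g' = path_between_reverse[OF g]
  have b: "path_between S (\<lambda>_. b) b b" using path_between_ends[OF g] by (intro path_between_const)
  have "homotopic_paths S (g +++ ((\<lambda>_. b) +++ reversepath g)) (g +++ reversepath g)"
    by (rule homotopic_paths_join_between[OF homotopic_paths_refl_between[OF g]
          homotopic_paths_const_left[OF g'] g path_between_join[OF b g']])
  also have "homotopic_paths S \<dots> (\<lambda>_. a)" using g by (rule homotopic_paths_reverse_right)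
  finally show ?thesis by (simp add: conjugate_path_def)
qed

lemma conjugate_path_cancel:
  assumes g: "path_between S g a b" and r: "path_between S r b b"
  shows "homotopic_paths S (conjugate_path (reversepath g) (conjugate_path g r)) r"
proof -
  note g' = path_between_reverse[OF g]
  note rg' = path_between_join[OF r g']
  note rg'g = path_between_join[OF rg' g]
  have "homotopic_paths S ((g +++ (r +++ reversepath g)) +++ g) (g +++ ((r +++ reversepath g) +++ g))"
    using homotopic_paths_assoc_between[OF g rg' g] by (rule homotopic_paths_sym)
  also have "homotopic_paths S \<dots> (g +++ r)"
  proof (rule homotopic_paths_join_between[OF homotopic_paths_refl_between[OF g] _ g rg'g])
    show "homotopic_paths S ((r +++ reversepath g) +++ g) r"
      using homotopic_paths_cancel_right[OF r g'] by simp
  qed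
  finally have "homotopic_paths S (reversepath g +++ ((g +++ (r +++ reversepath g)) +++ g)) (reversepath g +++ (g +++ r))"
    by (intro homotopic_paths_join_between[OF homotopic_paths_refl_between[OF g'] _ g'
          path_between_join[OF path_between_join[OF g rg'] g]])
  also have "homotopic_paths S \<dots> ((reversepath g +++ g) +++ r)"
    by (rule homotopic_paths_assoc_between[OF g' g r])
  also have "homotopic_paths S \<dots> ((\<lambda>_. b) +++ r)"
    by (rule homotopic_paths_join_between[OF homotopic_paths_reverse_left[OF g]
          homotopic_paths_refl_between[OF r] path_between_join[OF g' g] r])
  also have "homotopic_paths S \<dots> r" using r by (rule homotopic_paths_const_left)
  finally show ?thesis by (simp add: conjugate_path_def)
qed

lemma conjugate_path_cancel':
  assumes "path_between S g a b" "path_between S r a a"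
  shows "homotopic_paths S (conjugate_path g (conjugate_path (reversepath g) r)) r"
  using conjugate_path_cancel[OF path_between_reverse[OF assms(1)] assms(2)] by simp

section \<open>Fundamental groups acting on fibres\<close>

lemma continuous_on_proj: "continuous_on S (proj i)"
  unfolding proj_def[abs_def]
  using continuous_on_product_coordinates subset_UNIV by (rule continuous_on_subset)

lemma proj_in: "i < m \<Longrightarrow> proj i ` power_space m S \<subseteq> S"
  by (auto simp: proj_def power_space_def)

lemma path_class_eq_iff:
  assumes "path_between S p a b"
  shows "path_class S p = path_class S r \<longleftrightarrow> homotopic_paths S p r"
proof
  assume "path_class S p = path_class S r"
  then have "p \<in> path_class S r" using assms by (auto simp: path_class_def path_between_def)
  then show "homotopic_paths S p r" by (simp add: path_class_def homotopic_paths_sym)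
next
  assume "homotopic_paths S p r"
  then show "path_class S p = path_class S r"
    unfolding path_class_def by (blast intro: homotopic_paths_trans homotopic_paths_sym)
qed

lemma carrier_fund_group: "carrier (fund_group S x) = path_class S ` {p. path_between S p x x}"
  by (simp add: fund_group_def path_between_def)

text \<open>The induced map and the change of basepoint are defined as unions over all representatives of a
  class. Since all representatives give the same class, the union is that class.\<close>

lemma union_over_path_class:
  assumes p: "path_between S p a b"
    and f: "\<And>r. homotopic_paths S p r \<Longrightarrow> homotopic_paths T (f p) (f r)"
  shows "(\<Union>r\<in>path_class S p. path_class T (f r)) = path_class T (f p)"
proof -
  have "path_class T (f r) = path_class T (f p)" if "r \<in> path_class S p" for r
    using f[of r] that unfolding path_class_def by (blast intro: homotopic_paths_trans homotopic_paths_sym)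
  moreover have "p \<in> path_class S p" using p by (auto simp: path_class_def path_between_def)
  ultimately show ?thesis by blast
qed

lemma fund_map_path_class:
  assumes "path_between S p a b" "continuous_on S f" "f ` S \<subseteq> T"
  shows "fund_map T f (path_class S p) = path_class T (f \<circ> p)"
  unfolding fund_map_def using assms
  by (intro union_over_path_class[where f = "\<lambda>p. f \<circ> p"] homotopic_paths_continuous_image) auto

lemma fund_transport_path_class:
  assumes g: "path_between S g a b" and p: "path_between S p a a"
  shows "fund_transport S g (path_class S p) = path_class S (conjugate_path (reversepath g) p)"
  unfolding fund_transport_def conjugate_path_reverse
  by (rule union_over_path_class[where f = "\<lambda>p. reversepath g +++ (p +++ g)", OF p])
    (use conjugate_path_cong[OF path_between_reverse[OF g] p] in \<open>simp add: conjugate_path_reverse\<close>)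

lemma lift_ends_conjugate:
  "lift_ends E q g a b \<Longrightarrow> lift_ends E q r b b \<Longrightarrow> lift_ends E q (conjugate_path g r) a a"
  unfolding conjugate_path_def by (blast intro: lift_ends_join lift_ends_reverse)

lemma lift_ends_conjugate_iff:
  assumes cov: "covering_space E q B" and g: "path_between B g a b" and r: "path_between B r b b"
    and l: "lift_ends E q g e0 e"
  shows "lift_ends E q (conjugate_path g r) e0 e0 \<longleftrightarrow> lift_ends E q r e e"
proof
  assume "lift_ends E q (conjugate_path g r) e0 e0"
  with lift_ends_reverse[OF l]
  have "lift_ends E q (conjugate_path (reversepath g) (conjugate_path g r)) e e"
    by (rule lift_ends_conjugate)
  then show "lift_ends E q r e e" by (rule lift_ends_homotopic[OF cov conjugate_path_cancel[OF g r]])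
qed (rule lift_ends_conjugate[OF l])

lemma lift_ends_loop_iff_in_subgroup:
  assumes cov: "covering_space E q B" and e: "e \<in> E" and r: "path_between B r (q e) (q e)"
  shows "lift_ends E q r e e \<longleftrightarrow> path_class B r \<in> fund_map B q ` carrier (fund_group E e)"
proof -
  have q: "continuous_on E q" "q ` E \<subseteq> B" using cov by (auto simp: covering_space_def)
  have "path_class B r \<in> fund_map B q ` carrier (fund_group E e) \<longleftrightarrow>
      (\<exists>d. path_between E d e e \<and> path_class B r = path_class B (q \<circ> d))"
    unfolding carrier_fund_group image_image image_iff
  proof (intro iffI; elim bexE exE conjE)
    fix d assume "d \<in> {d. path_between E d e e}" "path_class B r = fund_map B q (path_class E d)"
    then show "\<exists>d. path_between E d e e \<and> path_class B r = path_class B (q \<circ> d)"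
      using fund_map_path_class[OF _ q, of d e e] by auto
  next
    fix d assume "path_between E d e e" "path_class B r = path_class B (q \<circ> d)"
    then show "\<exists>d\<in>{d. path_between E d e e}. path_class B r = fund_map B q (path_class E d)"
      using fund_map_path_class[OF _ q, of d e e] by auto
  qed
  also have "\<dots> \<longleftrightarrow> (\<exists>d. path_between E d e e \<and> homotopic_paths B r (q \<circ> d))"
    using path_class_eq_iff[OF r] by simp
  also have "\<dots> \<longleftrightarrow> lift_ends E q r e e"
  proof
    assume "\<exists>d. path_between E d e e \<and> homotopic_paths B r (q \<circ> d)"
    then obtain d where "path_between E d e e" "homotopic_paths B r (q \<circ> d)" by blast
    then show "lift_ends E q r e e"
      using lift_ends_homotopic[OF cov homotopic_paths_sym lift_ends_compose] by blast
  next
    assume "lift_ends E q r e e"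
    then obtain d where d: "path_between E d e e" "\<And>t. t \<in> {0..1} \<Longrightarrow> q (d t) = r t"
      by (auto simp: lift_ends_def)
    have "homotopic_paths B r (q \<circ> d)"
      using r d(2) by (intro homotopic_paths_eq) (auto simp: path_between_def)
    with d show "\<exists>d. path_between E d e e \<and> homotopic_paths B r (q \<circ> d)" by blast
  qed
  finally show ?thesis ..
qed

text \<open>If a path \<open>g\<close> from \<open>b\<close> to \<open>G u\<close> lifts to a path from the distinguished point \<open>e0\<close> to \<open>e\<close>, then the classes of
  loops at \<open>G u\<close> that lift to loops at \<open>e\<close> are exactly the transport of \<open>H\<close> along \<open>g\<close>. Every \<open>g\<close> arises with
  some \<open>e\<close> by lifting it, and every \<open>e\<close> with some \<open>g\<close> because \<open>E\<close> is path-connected.\<close>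

lemma conjugate_subgroup_iff_loops_lift:
  fixes E :: "'e::topological_space set" and B :: "'b::topological_space set" and U :: "'w::topological_space set"
  assumes E: "connected_covering E q B b H" and B: "locally path_connected B"
    and G: "continuous_on U G" "G ` U \<subseteq> B" and u: "u \<in> U"
  shows "(\<exists>K. conjugate_at B b H (G u) K \<and> fund_map B G ` carrier (fund_group U u) \<subseteq> K) \<longleftrightarrow>
    (\<exists>e\<in>E. q e = G u \<and> (\<forall>r. path_between U r u u \<longrightarrow> lift_ends E q (G \<circ> r) e e))"
proof -
  from E obtain e0 where cov: "covering_space E q B" and e0: "e0 \<in> E" "q e0 = b"
    and H: "fund_map B q ` carrier (fund_group E e0) = H" and conE: "connected E"
    by (auto simp: connected_covering_def)
  have q: "continuous_on E q" "q ` E \<subseteq> B" using cov by (auto simp: covering_space_def)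
  have pcE: "path_connected E"
    using conE covering_locally_path_connected[OF cov B] by (rule connected_locally_path_connected_imp_path_connected)
  have H': "A \<in> H \<longleftrightarrow> (\<exists>p. path_between B p b b \<and> A = path_class B p \<and> lift_ends E q p e0 e0)" for A
  proof
    assume "A \<in> H"
    then obtain d where d: "path_between E d e0 e0" "A = path_class B (q \<circ> d)"
      using fund_map_path_class[OF _ q] by (auto simp: carrier_fund_group H[symmetric])
    then show "\<exists>p. path_between B p b b \<and> A = path_class B p \<and> lift_ends E q p e0 e0"
      using path_between_image[OF d(1) q] lift_ends_compose[OF d(1), of q] e0 by auto
  next
    assume "\<exists>p. path_between B p b b \<and> A = path_class B p \<and> lift_ends E q p e0 e0"
    then show "A \<in> H"
      using lift_ends_loop_iff_in_subgroup[OF cov e0(1)] e0(2) H by auto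
  qed
  show ?thesis
  proof
    assume "\<exists>K. conjugate_at B b H (G u) K \<and> fund_map B G ` carrier (fund_group U u) \<subseteq> K"
    then obtain g where g: "path_between B g b (G u)"
      and K: "fund_map B G ` carrier (fund_group U u) \<subseteq> fund_transport B g ` H"
      unfolding conjugate_at_def path_between_def by blast
    obtain e where e: "lift_ends E q g e0 e"
      using lift_ends_exists[OF cov, of g e0] g e0 unfolding path_between_def by auto
    have "e \<in> E" "q e = G u" using lift_ends_endpoints[OF e] g by (auto simp: path_between_def)
    moreover have "lift_ends E q (G \<circ> r) e e" if r: "path_between U r u u" for r
    proof -
      have Gr: "path_between B (G \<circ> r) (G u) (G u)" by (rule path_between_image[OF r G])
      have "path_class B (G \<circ> r) \<in> fund_transport B g ` H"
        using K fund_map_path_class[OF r G] r by (auto simp: carrier_fund_group)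
      then obtain p where p: "path_between B p b b" "lift_ends E q p e0 e0"
        and eq: "path_class B (G \<circ> r) = path_class B (conjugate_path (reversepath g) p)"
        using H' fund_transport_path_class[OF g] by auto
      have "lift_ends E q (conjugate_path (reversepath g) p) e e"
        using p(2) lift_ends_reverse[OF e] by (rule lift_ends_conjugate[rotated])
      moreover have "homotopic_paths B (conjugate_path (reversepath g) p) (G \<circ> r)"
        using eq path_class_eq_iff[OF Gr] by (blast intro: homotopic_paths_sym)
      ultimately show ?thesis by (rule lift_ends_homotopic[OF cov, rotated])
    qed
    ultimately show "\<exists>e\<in>E. q e = G u \<and> (\<forall>r. path_between U r u u \<longrightarrow> lift_ends E q (G \<circ> r) e e)" by blast
  next
    assume "\<exists>e\<in>E. q e = G u \<and> (\<forall>r. path_between U r u u \<longrightarrow> lift_ends E q (G \<circ> r) e e)"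
    then obtain e where e: "e \<in> E" "q e = G u"
      and l: "\<And>r. path_between U r u u \<Longrightarrow> lift_ends E q (G \<circ> r) e e" by blast
    obtain d where d: "path_between E d e0 e"
      using pcE e0 e unfolding path_connected_component path_component_iff_path_between by blast
    define g where "g = q \<circ> d"
    have g: "path_between B g b (G u)" using path_between_image[OF d q] e0 e by (simp add: g_def)
    have lg: "lift_ends E q g e0 e" unfolding g_def using d by (rule lift_ends_compose)
    have "fund_map B G A \<in> fund_transport B g ` H" if A: "A \<in> carrier (fund_group U u)" for A
    proof -
      obtain r where r: "path_between U r u u" "A = path_class U r"
        using A by (auto simp: carrier_fund_group)
      have Gr: "path_between B (G \<circ> r) (G u) (G u)" by (rule path_between_image[OF r(1) G])
      let ?c = "conjugate_path g (G \<circ> r)"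
      have c: "path_between B ?c b b" using g Gr by (rule path_between_conjugate)
      have "path_class B ?c \<in> H"
        using H' c lift_ends_conjugate[OF lg l[OF r(1)]] by blast
      moreover have "fund_map B G A = fund_transport B g (path_class B ?c)"
        using fund_map_path_class[OF r(1) G] r(2) fund_transport_path_class[OF g c]
          path_class_eq_iff[OF Gr] homotopic_paths_sym[OF conjugate_path_cancel[OF g Gr]] by simp
      ultimately show ?thesis by blast
    qed
    then show "\<exists>K. conjugate_at B b H (G u) K \<and> fund_map B G ` carrier (fund_group U u) \<subseteq> K"
      using g unfolding conjugate_at_def path_between_def by blast
  qed
qed

section \<open>Sections of a pulled back covering\<close>

definition has_section :: "'e::topological_space set \<Rightarrow> ('e \<Rightarrow> 'b::topological_space) \<Rightarrow> 'b set \<Rightarrow> bool" where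
  "has_section E p U \<longleftrightarrow> (\<exists>s. continuous_on U s \<and> s ` U \<subseteq> E \<and> (\<forall>b\<in>U. p (s b) = b))"

lemma ex_family_choice:
  "(\<exists>U s. P U \<and> (\<forall>j\<le>n::nat. Q (U j) \<and> R (U j) (s j))) \<longleftrightarrow> (\<exists>U. P U \<and> (\<forall>j\<le>n. Q (U j) \<and> (\<exists>s. R (U j) s)))"
proof
  assume "\<exists>U. P U \<and> (\<forall>j\<le>n. Q (U j) \<and> (\<exists>s. R (U j) s))"
  then obtain U where U: "P U" "\<forall>j\<le>n. Q (U j) \<and> (\<exists>s. R (U j) s)" by (elim exE conjE)
  have "\<forall>j. \<exists>s. j \<le> n \<longrightarrow> R (U j) s"
  proof
    fix j show "\<exists>s. j \<le> n \<longrightarrow> R (U j) s" using U(2) by (cases "j \<le> n") auto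
  qed
  from choice[OF this] obtain s where s: "\<forall>j. j \<le> n \<longrightarrow> R (U j) (s j)" ..
  show "\<exists>U s. P U \<and> (\<forall>j\<le>n. Q (U j) \<and> R (U j) (s j))"
    by (rule exI[of _ U], rule exI[of _ s]) (use U s in simp)
next
  assume "\<exists>U s. P U \<and> (\<forall>j\<le>n. Q (U j) \<and> R (U j) (s j))"
  then obtain U s where "P U" "\<forall>j\<le>n. Q (U j) \<and> R (U j) (s j)" by (elim exE conjE)
  then show "\<exists>U. P U \<and> (\<forall>j\<le>n. Q (U j) \<and> (\<exists>s. R (U j) s))"
    by (intro exI[of _ U]) auto
qed

lemma secat_eq:
  fixes E :: "'e::topological_space set" and B :: "'b::topological_space set"
  shows "secat E p B = Inf {enat n | n. \<exists>U. B = (\<Union>j\<le>n. U j) \<and>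
     (\<forall>j\<le>n. openin (top_of_set B) (U j) \<and> has_section E p (U j))}"
proof -
  have "(\<exists>(U :: nat \<Rightarrow> 'b set) s. B = (\<Union>j\<le>n. U j) \<and> (\<forall>j\<le>n. openin (top_of_set B) (U j) \<and>
        (continuous_on (U j) (s j) \<and> s j ` U j \<subseteq> E \<and> (\<forall>b\<in>U j. p (s j b) = b)))) \<longleftrightarrow>
      (\<exists>U. B = (\<Union>j\<le>n. U j) \<and> (\<forall>j\<le>n. openin (top_of_set B) (U j) \<and> has_section E p (U j)))" for n
    unfolding has_section_def
    by (rule ex_family_choice[where P = "\<lambda>U. B = (\<Union>j\<le>n. U j)" and n = n and Q = "openin (top_of_set B)" and
        R = "\<lambda>U s. continuous_on U s \<and> s ` U \<subseteq> E \<and> (\<forall>b\<in>U. p (s b) = b)"])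
  then show ?thesis unfolding secat_def by (simp only:)
qed

lemma has_section_pullback:
  fixes W :: "'w::topological_space set" and E :: "'e::topological_space set"
  assumes U: "U \<subseteq> W"
  shows "has_section (pullback W G E q) fst U \<longleftrightarrow> (\<exists>F. lift_on E q U G F)"
proof
  assume "has_section (pullback W G E q) fst U"
  then obtain s where s: "continuous_on U s" "s ` U \<subseteq> pullback W G E q" "\<And>b. b \<in> U \<Longrightarrow> fst (s b) = b"
    unfolding has_section_def by blast
  have "continuous_on U (\<lambda>x. snd (s x))" using s(1) by (rule continuous_on_snd)
  moreover have "snd (s x) \<in> E \<and> q (snd (s x)) = G x" if "x \<in> U" for x
  proof -
    have "s x \<in> pullback W G E q" "fst (s x) = x" using s(2,3) that by blast+
    then show ?thesis by (cases "s x") (simp add: pullback_def)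
  qed
  ultimately show "\<exists>F. lift_on E q U G F"
    by (intro exI[of _ "\<lambda>x. snd (s x)"]) (simp add: lift_on_def image_subset_iff)
next
  assume "\<exists>F. lift_on E q U G F"
  then obtain F where F: "continuous_on U F" "F ` U \<subseteq> E" "\<forall>x\<in>U. q (F x) = G x"
    unfolding lift_on_def by blast
  have "continuous_on U (\<lambda>x. (x, F x))" using F(1) by (intro continuous_on_Pair continuous_on_id)
  moreover have "(\<lambda>x. (x, F x)) ` U \<subseteq> pullback W G E q"
    using U F by (auto simp: pullback_def)
  ultimately show "has_section (pullback W G E q) fst U"
    unfolding has_section_def by (intro exI[of _ "\<lambda>x. (x, F x)"]) simp
qed

lemma secat_pullback:
  fixes W :: "'w::topological_space set" and E :: "'e::topological_space set"
  shows "secat (pullback W G E q) fst W = Inf {enat n | n. \<exists>U. W = (\<Union>j\<le>n. U j) \<and>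
     (\<forall>j\<le>n. openin (top_of_set W) (U j) \<and> (\<exists>F. lift_on E q (U j) G F))}"
proof -
  have "openin (top_of_set W) U \<and> has_section (pullback W G E q) fst U \<longleftrightarrow>
      openin (top_of_set W) U \<and> (\<exists>F. lift_on E q U G F)" for U
    using has_section_pullback[OF openin_imp_subset] by blast
  then show ?thesis unfolding secat_eq by (simp only:)
qed

lemma continuous_on_tuple_map:
  assumes "\<And>i. i < length gs \<Longrightarrow> continuous_on W (gs ! i)"
  shows "continuous_on W (tuple_map gs)"
proof (rule continuous_on_coordinatewise_then_product)
  fix i show "continuous_on W (\<lambda>x. tuple_map gs x i)"
    using assms[of i] by (cases "i < length gs") (auto simp: tuple_map_def)
qed

lemma tuple_map_in: "(\<And>i. i < length gs \<Longrightarrow> (gs ! i) ` W \<subseteq> Y) \<Longrightarrow> tuple_map gs ` W \<subseteq> power_space (length gs) Y"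
  by (auto simp: tuple_map_def power_space_def image_subset_iff)

text \<open>An open subset of \<open>W\<close> is again locally path-connected, so the lifting criterion decides by loops
  whether the pulled back covering has a section over it.\<close>

lemma DD_eq_DD_pi1:
  fixes W :: "'w::topological_space set" and Y :: "'y::topological_space set" and E :: "'e::topological_space set"
  assumes W: "locally path_connected W" and Y: "locally path_connected Y"
    and E: "diagonal_covering (length gs) Y y E q"
    and gs: "\<And>i. i < length gs \<Longrightarrow> continuous_on W (gs ! i) \<and> (gs ! i) ` W \<subseteq> Y"
  shows "DD W gs E q = DD_pi1 Y y W gs"
proof -
  let ?P = "power_space (length gs) Y"
  have G: "continuous_on W (tuple_map gs)"
    by (rule continuous_on_tuple_map) (use gs in blast)
  have G': "tuple_map gs ` W \<subseteq> ?P"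
    by (rule tuple_map_in) (use gs in blast)
  have cov: "covering_space E q ?P" using E by (simp add: diagonal_covering_def connected_covering_def)
  have "(\<exists>F. lift_on E q U (tuple_map gs) F) \<longleftrightarrow> (\<forall>u\<in>U. \<exists>K.
           conjugate_at ?P (diagonal_point (length gs) y) (diagonal_subgroup (length gs) Y y) (tuple_map gs u) K \<and>
           fund_map ?P (tuple_map gs) ` carrier (fund_group U u) \<subseteq> K)"
    if U: "openin (top_of_set W) U" for U
  proof -
    have "U \<subseteq> W" using U by (rule openin_imp_subset)
    then have GU: "continuous_on U (tuple_map gs)" "tuple_map gs ` U \<subseteq> ?P"
      using G G' by (blast intro: continuous_on_subset)+
    have "locally path_connected U" using W U by (rule locally_open_subset)
    from lifting_criterion[OF cov this GU]
      conjugate_subgroup_iff_loops_lift[OF E[unfolded diagonal_covering_def] locally_path_connected_power_space[OF Y] GU]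
    show ?thesis by simp
  qed
  then have "openin (top_of_set W) U \<and> (\<exists>F. lift_on E q U (tuple_map gs) F) \<longleftrightarrow>
      openin (top_of_set W) U \<and> (\<forall>u\<in>U. \<exists>K.
           conjugate_at ?P (diagonal_point (length gs) y) (diagonal_subgroup (length gs) Y y) (tuple_map gs u) K \<and>
           fund_map ?P (tuple_map gs) ` carrier (fund_group U u) \<subseteq> K)" for U
    by blast
  then show ?thesis unfolding DD_def secat_pullback DD_pi1_def by (simp only:)
qed

section \<open>Loops that lift to the diagonal covering\<close>

lemma path_class_in_diagonal_subgroup:
  fixes Y :: "'y::topological_space set"
  assumes m: "0 < m" and r: "path_between (power_space m Y) r (diagonal_point m y) (diagonal_point m y)"
  shows "path_class (power_space m Y) r \<in> diagonal_subgroup m Y y \<longleftrightarrow>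
    (\<forall>i<m. \<forall>j<m. homotopic_paths Y (proj i \<circ> r) (proj j \<circ> r))"
proof -
  have pb: "path_between Y (proj i \<circ> r) y y" if "i < m" for i
    using path_between_image[OF r continuous_on_proj proj_in[OF that]] that by (simp add: proj_def diagonal_point_def)
  have fm: "fund_map Y (proj i) (path_class (power_space m Y) r) = path_class Y (proj i \<circ> r)" if "i < m" for i
    using fund_map_path_class[OF r continuous_on_proj proj_in[OF that]] .
  have "path_class (power_space m Y) r \<in> diagonal_subgroup m Y y \<longleftrightarrow>
    (\<exists>p. path_between Y p y y \<and> (\<forall>i<m. path_class Y (proj i \<circ> r) = path_class Y p))"
    using r fm by (auto simp: diagonal_subgroup_def carrier_fund_group)
  also have "\<dots> \<longleftrightarrow> (\<exists>p. path_between Y p y y \<and> (\<forall>i<m. homotopic_paths Y (proj i \<circ> r) p))"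
    using path_class_eq_iff[OF pb] by auto
  also have "\<dots> \<longleftrightarrow> (\<forall>i<m. \<forall>j<m. homotopic_paths Y (proj i \<circ> r) (proj j \<circ> r))"
    using m pb by (blast intro: homotopic_paths_trans homotopic_paths_sym)
  finally show ?thesis .
qed

text \<open>Take for \<open>g\<close> the projection of a path to \<open>e\<close> from the point over the diagonal point that realizes the
  diagonal subgroup. Conjugation with \<open>g\<close> moves the question whether \<open>r\<close> lifts to a loop to that point,
  where it is membership in the diagonal subgroup, that is, equality of all coordinates up to homotopy.\<close>

lemma diagonal_covering_loop_lifts:
  fixes Y :: "'y::topological_space set" and E :: "'e::topological_space set"
  assumes E: "diagonal_covering m Y y E q" and Y: "locally path_connected Y" and m: "0 < m" and e: "e \<in> E"
  obtains g where "path_between (power_space m Y) g (diagonal_point m y) (q e)"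
    "\<And>r. path_between (power_space m Y) r (q e) (q e) \<Longrightarrow> lift_ends E q r e e \<longleftrightarrow>
      (\<forall>i<m. \<forall>j<m. homotopic_paths Y (conjugate_path (proj i \<circ> g) (proj i \<circ> r)) (conjugate_path (proj j \<circ> g) (proj j \<circ> r)))"
proof -
  let ?P = "power_space m Y"
  from E obtain e0 where cov: "covering_space E q ?P" and e0: "e0 \<in> E" "q e0 = diagonal_point m y"
    and H: "fund_map ?P q ` carrier (fund_group E e0) = diagonal_subgroup m Y y" and conE: "connected E"
    by (auto simp: diagonal_covering_def connected_covering_def)
  have q: "continuous_on E q" "q ` E \<subseteq> ?P" using cov by (auto simp: covering_space_def)
  have "path_connected E"
    using conE covering_locally_path_connected[OF cov locally_path_connected_power_space[OF Y]]
    by (rule connected_locally_path_connected_imp_path_connected)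
  then obtain d where d: "path_between E d e0 e"
    using e0 e unfolding path_connected_component path_component_iff_path_between by blast
  define g where "g = q \<circ> d"
  have g: "path_between ?P g (diagonal_point m y) (q e)" using path_between_image[OF d q] e0 by (simp add: g_def)
  have lg: "lift_ends E q g e0 e" unfolding g_def using d by (rule lift_ends_compose)
  show thesis
  proof (rule that[OF g])
    fix r assume r: "path_between ?P r (q e) (q e)"
    note c = path_between_conjugate[OF g r]
    have "lift_ends E q r e e \<longleftrightarrow> lift_ends E q (conjugate_path g r) e0 e0"
      using lift_ends_conjugate_iff[OF cov g r lg] by simp
    also have "\<dots> \<longleftrightarrow> path_class ?P (conjugate_path g r) \<in> diagonal_subgroup m Y y"
      using lift_ends_loop_iff_in_subgroup[OF cov e0(1)] c e0(2) H by simp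
    finally show "lift_ends E q r e e \<longleftrightarrow>
      (\<forall>i<m. \<forall>j<m. homotopic_paths Y (conjugate_path (proj i \<circ> g) (proj i \<circ> r)) (conjugate_path (proj j \<circ> g) (proj j \<circ> r)))"
      using path_class_in_diagonal_subgroup[OF m c] by (simp add: conjugate_path_compose)
  qed
qed

section \<open>The universal covering as a pullback of the diagonal covering\<close>

lemma simply_connected_lift:
  fixes E :: "'e::topological_space set" and B :: "'b::topological_space set" and W :: "'w::topological_space set"
  assumes cov: "covering_space E q B" and W: "simply_connected W" "locally path_connected W"
    and G: "continuous_on W G" "G ` W \<subseteq> B"
  shows "\<exists>F. lift_on E q W G F"
  unfolding lifting_criterion[OF cov W(2) G]
proof
  fix w assume w: "w \<in> W"
  then have "G w \<in> q ` E" using G covering_space_imp_surjective[OF cov] by auto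
  then obtain e where e: "e \<in> E" "q e = G w" by (metis imageE)
  have "lift_ends E q (G \<circ> r) e e" if r: "path_between W r w w" for r
  proof -
    have "homotopic_loops W r (\<lambda>_. w)"
      by (rule W(1)[unfolded simply_connected_def, rule_format])
        (use r path_between_const[OF w] in \<open>simp add: path_between_def\<close>)
    then have "homotopic_loops B (G \<circ> r) (G \<circ> (\<lambda>_. w))"
      using G by (intro homotopic_loops_continuous_image) auto
    then have n: "homotopic_loops B (G \<circ> r) (\<lambda>_. G w)" by (simp add: comp_def)
    have Gr: "path_between B (G \<circ> r) (G w) (G w)" using r G by (rule path_between_image)
    then obtain b where "lift_ends E q (G \<circ> r) e b"
      using lift_ends_exists[OF cov, of "G \<circ> r" e] e by (auto simp: path_between_def)
    with lift_ends_null_loop[OF cov n] show ?thesis by metis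
  qed
  with e show "\<exists>e\<in>E. q e = G w \<and> (\<forall>r. path_between W r w w \<longrightarrow> lift_ends E q (G \<circ> r) e e)"
    by (intro bexI[of _ e]) auto
qed

lemma lift_ends_image:
  assumes F: "lift_on E' q' E (G \<circ> q) F" and l: "lift_ends E q r a b"
  shows "lift_ends E' q' (G \<circ> r) (F a) (F b)"
proof -
  from l obtain d where d: "path_between E d a b" "\<And>t. t \<in> {0..1} \<Longrightarrow> q (d t) = r t" by (auto simp: lift_ends_def)
  have "path_between E' (F \<circ> d) (F a) (F b)" using F d(1) by (intro path_between_image) (auto simp: lift_on_def)
  moreover have "q' ((F \<circ> d) t) = (G \<circ> r) t" if "t \<in> {0..1}" for t
    using F d(2)[OF that] path_between_in[OF d(1) that] by (auto simp: lift_on_def)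
  ultimately show ?thesis by (auto simp: lift_ends_def)
qed

text \<open>Conjugation with a path from \<open>y0\<close> to \<open>y\<close> carries the injectivity of the induced map from \<open>y0\<close> to \<open>y\<close>; the
  next lemma does the same for surjectivity.\<close>

lemma null_loop_reflected:
  fixes Y :: "'y::topological_space set" and Z :: "'z::topological_space set"
  assumes Y: "path_connected Y" "y0 \<in> Y" and h: "continuous_on Y h" "h ` Y \<subseteq> Z"
    and inj: "inj_on (fund_map Z h) (carrier (fund_group Y y0))"
    and r: "path_between Y r y y" and n: "homotopic_paths Z (h \<circ> r) (\<lambda>_. h y)"
  shows "homotopic_paths Y r (\<lambda>_. y)"
proof -
  have y: "y \<in> Y" using path_between_ends[OF r] by blast
  obtain g where g: "path_between Y g y0 y"
    using Y y unfolding path_connected_component path_component_iff_path_between by blast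
  let ?c = "conjugate_path g r"
  have c: "path_between Y ?c y0 y0" using g r by (rule path_between_conjugate)
  have k: "path_between Y (\<lambda>_. y0) y0 y0" using Y by (intro path_between_const)
  note hg = path_between_image[OF g h]
  have "homotopic_paths Z (h \<circ> ?c) (conjugate_path (h \<circ> g) (\<lambda>_. h y))"
    unfolding conjugate_path_compose by (rule conjugate_path_cong[OF hg path_between_image[OF r h] n])
  also have "homotopic_paths Z \<dots> (\<lambda>_. h y0)" using hg by (rule conjugate_path_const)
  finally have "path_class Z (h \<circ> ?c) = path_class Z (h \<circ> (\<lambda>_. y0))"
    using path_class_eq_iff[OF path_between_image[OF c h]] by (simp add: comp_def)
  then have "fund_map Z h (path_class Y ?c) = fund_map Z h (path_class Y (\<lambda>_. y0))"
    by (simp only: fund_map_path_class[OF c h] fund_map_path_class[OF k h])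
  then have "path_class Y ?c = path_class Y (\<lambda>_. y0)"
    by (rule inj_onD[OF inj]) (use c k in \<open>auto simp only: carrier_fund_group mem_Collect_eq intro: imageI\<close>)
  then have cn: "homotopic_paths Y ?c (\<lambda>_. y0)" using path_class_eq_iff[OF c] by blast
  have "homotopic_paths Y r (conjugate_path (reversepath g) ?c)"
    by (rule homotopic_paths_sym[OF conjugate_path_cancel[OF g r]])
  also have "homotopic_paths Y \<dots> (conjugate_path (reversepath g) (\<lambda>_. y0))"
    by (rule conjugate_path_cong[OF path_between_reverse[OF g] c cn])
  also have "homotopic_paths Y \<dots> (\<lambda>_. y)" using path_between_reverse[OF g] by (rule conjugate_path_const)
  finally show ?thesis .
qed

lemma loop_realized:
  fixes Y :: "'y::topological_space set" and Z :: "'z::topological_space set"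
  assumes Y: "path_connected Y" "y0 \<in> Y" and h: "continuous_on Y h" "h ` Y \<subseteq> Z"
    and surj: "carrier (fund_group Z (h y0)) \<subseteq> fund_map Z h ` carrier (fund_group Y y0)"
    and y: "y \<in> Y" and s: "path_between Z s (h y) (h y)"
  obtains r where "path_between Y r y y" "homotopic_paths Z (h \<circ> r) s"
proof -
  obtain g where g: "path_between Y g y0 y"
    using Y y unfolding path_connected_component path_component_iff_path_between by blast
  note hg = path_between_image[OF g h]
  have cs: "path_between Z (conjugate_path (h \<circ> g) s) (h y0) (h y0)" using hg s by (rule path_between_conjugate)
  then have "path_class Z (conjugate_path (h \<circ> g) s) \<in> fund_map Z h ` carrier (fund_group Y y0)"
    using surj by (auto simp: carrier_fund_group)
  then obtain c where c: "path_between Y c y0 y0" "path_class Z (conjugate_path (h \<circ> g) s) = path_class Z (h \<circ> c)"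
    using fund_map_path_class[OF _ h] by (auto simp: carrier_fund_group)
  then have hc: "homotopic_paths Z (conjugate_path (h \<circ> g) s) (h \<circ> c)" using path_class_eq_iff[OF cs] by blast
  show thesis
  proof (rule that)
    show "path_between Y (conjugate_path (reversepath g) c) y y"
      using path_between_reverse[OF g] c(1) by (rule path_between_conjugate)
    have "homotopic_paths Z (conjugate_path (reversepath (h \<circ> g)) (conjugate_path (h \<circ> g) s))
        (conjugate_path (reversepath (h \<circ> g)) (h \<circ> c))"
      by (rule conjugate_path_cong[OF path_between_reverse[OF hg] cs hc])
    then have "homotopic_paths Z (conjugate_path (reversepath (h \<circ> g)) (h \<circ> c)) s"
      using conjugate_path_cancel[OF hg s] by (blast intro: homotopic_paths_trans homotopic_paths_sym)
    then show "homotopic_paths Z (h \<circ> conjugate_path (reversepath g) c) s"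
      by (simp add: conjugate_path_compose path_compose_reversepath)
  qed
qed

text \<open>Near \<open>z\<close> the inverse is \<open>s\<close> after \<^const>\<open>fst\<close>, for a local section \<open>s\<close> of \<open>p\<close>: where \<open>F (s (fst x))\<close> and
  \<open>snd x\<close> lie in the same sheet of \<open>q\<close>, they coincide, because \<open>q\<close> maps them to the same point.\<close>

lemma fibrewise_bijection_inverse_continuous:
  fixes E :: "'e::topological_space set" and B :: "'b::topological_space set"
    and E' :: "'f::topological_space set" and B' :: "'c::topological_space set"
  assumes cov: "covering_space E p B" and cov': "covering_space E' q B'"
    and G: "continuous_on B G" "G ` B \<subseteq> B'" and F: "lift_on E' q E (G \<circ> p) F"
    and bij: "bij_betw (\<lambda>t. (p t, F t)) E (pullback B G E' q)"
  obtains K where "continuous_on (pullback B G E' q) K" "K ` pullback B G E' q \<subseteq> E"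
    "\<And>z. z \<in> pullback B G E' q \<Longrightarrow> p (K z) = fst z \<and> F (K z) = snd z"
    "\<And>t. t \<in> E \<Longrightarrow> K (p t, F t) = t"
proof -
  define K where "K = the_inv_into E (\<lambda>t. (p t, F t))"
  let ?P = "pullback B G E' q"
  have K: "K z \<in> E" "p (K z) = fst z \<and> F (K z) = snd z" if "z \<in> ?P" for z
  proof -
    show "K z \<in> E" unfolding K_def using bij that by (metis bij_betw_def the_inv_into_into subset_refl)
    have "(p (K z), F (K z)) = z" unfolding K_def using f_the_inv_into_f_bij_betw[OF bij] that by metis
    then show "p (K z) = fst z \<and> F (K z) = snd z" by (metis fst_conv snd_conv)
  qed
  have K': "K (p t, F t) = t" if "t \<in> E" for t
    unfolding K_def using the_inv_into_f_f[OF bij_betw_imp_inj_on[OF bij] that] .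
  have "continuous_on ?P K"
  proof (rule continuous_on_if_locally)
    fix z assume z: "z \<in> ?P"
    define t where "t = K z"
    have t: "t \<in> E" "p t = fst z" "F t = snd z" using K[OF z] by (auto simp: t_def)
    have zP: "fst z \<in> B" "snd z \<in> E'" "G (fst z) = q (snd z)" using z by (auto simp: pullback_def)
    obtain u V s where u: "t \<in> u" "openin (top_of_set E) u" "p t \<in> V" "openin (top_of_set B) V"
      "homeomorphism u V p s"
      using covering_space_local_homeomorphism[OF cov t(1)] by metis
    obtain u' V' s' where u': "snd z \<in> u'" "openin (top_of_set E') u'" "homeomorphism u' V' q s'"
      using covering_space_local_homeomorphism[OF cov' zP(2)] by metis
    have s: "continuous_on V s" "s ` V = u" "\<And>y. y \<in> V \<Longrightarrow> p (s y) = y" "s (p t) = t"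
      using u by (auto simp: homeomorphism_def)
    have uE: "u \<subseteq> E" using u(2) by (rule openin_imp_subset)
    have inj: "inj_on q u'" using u'(3) by (auto simp: homeomorphism_def intro: inj_on_inverseI)
    define N1 where "N1 = ?P \<inter> fst -` V"
    define N2 where "N2 = N1 \<inter> (\<lambda>x. F (s (fst x))) -` u'"
    define N3 where "N3 = ?P \<inter> snd -` u'"
    have N1: "openin (top_of_set ?P) N1" unfolding N1_def
      by (rule continuous_openin_preimage[OF _ _ u(4)]) (auto simp: pullback_def intro!: continuous_intros)
    have N3: "openin (top_of_set ?P) N3" unfolding N3_def
      by (rule continuous_openin_preimage[OF _ _ u'(2)]) (auto simp: pullback_def intro!: continuous_intros)
    have csf: "continuous_on N1 (\<lambda>x. s (fst x))"
      by (rule continuous_on_compose2[OF s(1)]) (auto simp: N1_def intro!: continuous_intros)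
    have "openin (top_of_set N1) N2" unfolding N2_def
    proof (rule continuous_openin_preimage[OF _ _ u'(2)])
      show "continuous_on N1 (\<lambda>x. F (s (fst x)))"
        using F s(2) uE by (intro continuous_on_compose2[OF _ csf]) (auto simp: lift_on_def N1_def)
      show "(\<lambda>x. F (s (fst x))) \<in> N1 \<rightarrow> E'" using F s(2) uE by (auto simp: lift_on_def N1_def)
    qed
    with N1 have N2: "openin (top_of_set ?P) N2" using openin_trans by blast
    have "openin (top_of_set ?P) (N2 \<inter> N3)" using N2 N3 by (rule openin_Int)
    moreover have "z \<in> N2 \<inter> N3"
      using z t u(3) u'(1) s(4) by (simp add: N1_def N2_def N3_def)
    moreover have "continuous_on (N2 \<inter> N3) K"
    proof -
      have "K x = s (fst x)" if x: "x \<in> N2 \<inter> N3" for x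
      proof -
        have xP: "x \<in> ?P" "fst x \<in> V" "F (s (fst x)) \<in> u'" "snd x \<in> u'"
          using x by (auto simp: N1_def N2_def N3_def)
        have sx: "s (fst x) \<in> E" "p (s (fst x)) = fst x" using xP s uE by auto
        have "q (F (s (fst x))) = G (fst x)" using F sx by (auto simp: lift_on_def)
        also have "\<dots> = q (snd x)" using xP(1) by (auto simp: pullback_def)
        finally have "F (s (fst x)) = snd x" using inj xP by (auto dest: inj_onD)
        then have "(p (s (fst x)), F (s (fst x))) = x" using sx by simp
        then show ?thesis using K'[OF sx(1)] by simp
      qed
      moreover have "continuous_on (N2 \<inter> N3) (\<lambda>x. s (fst x))"
        by (rule continuous_on_subset[OF csf]) (auto simp: N2_def)
      ultimately show ?thesis using continuous_on_eq by metis
    qed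
    ultimately show "\<exists>V. openin (top_of_set ?P) V \<and> z \<in> V \<and> continuous_on V K" by blast
  qed
  with that[of K] K K' show thesis by blast
qed

text \<open>The two coordinates are called \<open>i\<close> and \<open>k\<close> in either order, so that \<open>(h, z0)\<close> and \<open>(z0, h)\<close> can be treated
  at once.\<close>

lemma pair_covering_loop_lifts:
  fixes Z :: "'z::topological_space set" and E :: "'e::topological_space set"
  assumes E: "diagonal_covering 2 Z z E q" and Z: "locally path_connected Z" and e: "e \<in> E"
    and ik: "{i, k} = {0, 1::nat}" "i \<noteq> k"
  obtains gi gk where "path_between Z gi z (q e i)" "path_between Z gk z (q e k)"
    "\<And>r. path_between (power_space 2 Z) r (q e) (q e) \<Longrightarrow> lift_ends E q r e e \<longleftrightarrow>
      homotopic_paths Z (conjugate_path gi (proj i \<circ> r)) (conjugate_path gk (proj k \<circ> r))"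
proof -
  have lt: "i < 2" "k < 2" using ik by (auto simp: doubleton_eq_iff)
  obtain g where g: "path_between (power_space 2 Z) g (diagonal_point 2 z) (q e)"
    and l: "\<And>r. path_between (power_space 2 Z) r (q e) (q e) \<Longrightarrow> lift_ends E q r e e \<longleftrightarrow>
      (\<forall>i<2. \<forall>j<2. homotopic_paths Z (conjugate_path (proj i \<circ> g) (proj i \<circ> r)) (conjugate_path (proj j \<circ> g) (proj j \<circ> r)))"
    by (rule diagonal_covering_loop_lifts[OF E Z _ e]) auto
  have gj: "path_between Z (proj j \<circ> g) z (q e j)" if "j < 2" for j
    using path_between_image[OF g continuous_on_proj proj_in[OF that]] that by (simp add: proj_def diagonal_point_def)
  show thesis
  proof (rule that[OF gj[OF lt(1)] gj[OF lt(2)]])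
    fix r assume r: "path_between (power_space 2 Z) r (q e) (q e)"
    let ?c = "\<lambda>j. conjugate_path (proj j \<circ> g) (proj j \<circ> r)"
    have c: "homotopic_paths Z (?c j) (?c j)" if "j < 2" for j
    proof -
      have "path_between Z (proj j \<circ> r) (q e j) (q e j)"
        using path_between_image[OF r continuous_on_proj proj_in[OF that]] by (simp add: proj_def)
      from path_between_conjugate[OF gj[OF that] this] show ?thesis by (rule homotopic_paths_refl_between)
    qed
    have two: "(\<forall>j<2. Q j) \<longleftrightarrow> Q i \<and> Q k" for Q :: "nat \<Rightarrow> bool"
      using ik by (auto simp: doubleton_eq_iff less_2_cases_iff)
    show "lift_ends E q r e e \<longleftrightarrow> homotopic_paths Z (?c i) (?c k)"
      unfolding l[OF r] two using c[OF lt(1)] c[OF lt(2)] homotopic_paths_sym by blast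
  qed
qed

text \<open>The map \<open>F\<close> lifts \<open>G \<circ> pY\<close>, which is possible because \<open>Yt\<close> is simply connected. The homeomorphism is
  \<open>t \<mapsto> (pY t, F t)\<close>. It is injective because the map induced by \<open>h\<close> on fundamental groups is injective,
  and surjective because the induced map is surjective.\<close>

lemma universal_covering_pullback_diagonal:
  fixes Y :: "'y::topological_space set" and Z :: "'z::topological_space set"
    and Yt :: "'b::topological_space set" and Zh :: "'c::topological_space set"
  assumes Y: "connected Y" "locally path_connected Y" "y0 \<in> Y" and Z: "locally path_connected Z" "z0 \<in> Z"
    and h: "continuous_on Y h" "h ` Y \<subseteq> Z"
    and iso: "fund_map Z h \<in> iso (fund_group Y y0) (fund_group Z (h y0))"
    and Yt: "universal_covering Yt pY Y" and Zh: "diagonal_covering 2 Z z0 Zh qZ"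
    and ik: "{i, k} = {0, 1::nat}" "i \<noteq> k"
    and G: "\<And>y. y \<in> Y \<Longrightarrow> G y = (\<lambda>j\<in>{..<2}. if j = i then h y else z0)"
  obtains F K where "lift_on Zh qZ Yt (G \<circ> pY) F"
    "continuous_on (pullback Y G Zh qZ) K" "K ` pullback Y G Zh qZ \<subseteq> Yt"
    "\<And>z. z \<in> pullback Y G Zh qZ \<Longrightarrow> pY (K z) = fst z \<and> F (K z) = snd z"
    "\<And>t. t \<in> Yt \<Longrightarrow> K (pY t, F t) = t"
proof -
  have covY: "covering_space Yt pY Y" and sc: "simply_connected Yt"
    using Yt by (auto simp: universal_covering_def)
  have covZ: "covering_space Zh qZ (power_space 2 Z)" and conZ: "connected Zh"
    using Zh by (auto simp: diagonal_covering_def connected_covering_def)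
  have pcY: "path_connected Y" using Y(1,2) by (rule connected_locally_path_connected_imp_path_connected)
  have lpYt: "locally path_connected Yt" using covY Y(2) by (rule covering_locally_path_connected)
  have pcZh: "path_connected Zh"
    using conZ covering_locally_path_connected[OF covZ locally_path_connected_power_space[OF Z(1)]]
    by (rule connected_locally_path_connected_imp_path_connected)
  have pcYt: "path_connected Yt" using sc by (rule simply_connected_path_connected)
  have pY: "continuous_on Yt pY" "pY ` Yt = Y" using covY by (auto simp: covering_space_def)
  have qZ: "continuous_on Zh qZ" "qZ ` Zh \<subseteq> power_space 2 Z" using covZ by (auto simp: covering_space_def)
  have lt: "i < 2" "k < 2" using ik by (auto simp: doubleton_eq_iff)
  have cG: "continuous_on Y G"
  proof (rule continuous_on_coordinatewise_then_product)
    fix j show "continuous_on Y (\<lambda>y. G y j)"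
      using h by (cases "j = i"; cases "j < 2") (auto simp: G cong: continuous_on_cong)
  qed
  have GP: "G ` Y \<subseteq> power_space 2 Z" using h(2) Z(2) by (auto simp: G power_space_def split: if_splits)
  have Gi: "G y i = h y" "G y k = z0" if "y \<in> Y" for y using that lt ik by (auto simp: G)
  have Gr: "homotopic_paths Z (proj i \<circ> (G \<circ> r)) (h \<circ> r)" "homotopic_paths Z (proj k \<circ> (G \<circ> r)) (\<lambda>_. z0)"
    if r: "path_between Y r y y'" for r y y'
  proof -
    have G1: "path_between (power_space 2 Z) (G \<circ> r) (G y) (G y')" using r cG GP by (rule path_between_image)
    show "homotopic_paths Z (proj i \<circ> (G \<circ> r)) (h \<circ> r)"
      using path_between_image[OF G1 continuous_on_proj proj_in[OF lt(1)]] path_between_in[OF r]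
      by (intro homotopic_paths_eq) (auto simp: path_between_def proj_def Gi)
    show "homotopic_paths Z (proj k \<circ> (G \<circ> r)) (\<lambda>_. z0)"
      using path_between_image[OF G1 continuous_on_proj proj_in[OF lt(2)]] path_between_in[OF r]
      by (intro homotopic_paths_eq) (auto simp: path_between_def proj_def Gi)
  qed
  have "continuous_on Yt (G \<circ> pY)" using pY cG by (intro continuous_on_compose) auto
  moreover have "(G \<circ> pY) ` Yt \<subseteq> power_space 2 Z" 
    unfolding image_comp[symmetric] using pY(2) GP by simp
  ultimately obtain F where F: "lift_on Zh qZ Yt (G \<circ> pY) F"
    using simply_connected_lift[OF covZ sc lpYt] by blast
  have F': "F t \<in> Zh" "qZ (F t) = G (pY t)" if "t \<in> Yt" for t using F that by (auto simp: lift_on_def)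
  have inj: "inj_on (\<lambda>t. (pY t, F t)) Yt"
  proof (rule inj_onI)
    fix t t' assume t: "t \<in> Yt" "t' \<in> Yt" and eq: "(pY t, F t) = (pY t', F t')"
    obtain d where d: "path_between Yt d t t'"
      using pcYt t unfolding path_connected_component path_component_iff_path_between by blast
    define y where "y = pY t"
    define r where "r = pY \<circ> d"
    have y: "y \<in> Y" using t pY by (auto simp: y_def)
    have r: "path_between Y r y y"
      unfolding r_def using path_between_image[OF d pY(1)] pY(2) eq by (simp add: y_def)
    have lr: "lift_ends Yt pY r t t'" unfolding r_def using d by (rule lift_ends_compose)
    have qF: "qZ (F t) = G y" using F'(2)[OF t(1)] by (simp add: y_def)
    obtain gi gk where g: "path_between Z gi z0 (qZ (F t) i)" "path_between Z gk z0 (qZ (F t) k)"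
      and l: "\<And>r. path_between (power_space 2 Z) r (qZ (F t)) (qZ (F t)) \<Longrightarrow> lift_ends Zh qZ r (F t) (F t) \<longleftrightarrow>
        homotopic_paths Z (conjugate_path gi (proj i \<circ> r)) (conjugate_path gk (proj k \<circ> r))"
      using pair_covering_loop_lifts[OF Zh Z(1) F'(1)[OF t(1)] ik] by metis
    have gi: "path_between Z gi z0 (h y)" and gk: "path_between Z gk z0 z0"
      using g Gi[OF y] by (auto simp: qF)
    have hr: "path_between Z (h \<circ> r) (h y) (h y)" using r h by (rule path_between_image)
    have pb: "path_between (power_space 2 Z) (G \<circ> r) (G y) (G y)" using r cG GP by (rule path_between_image)
    \<comment> \<open>A path from \<open>t\<close> to \<open>t'\<close> projects to a loop \<open>r\<close> whose image \<open>(h \<circ> r, z0)\<close> lifts to a loop. So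
      \<open>h \<circ> r\<close> and hence \<open>r\<close> is null-homotopic.\<close>
    have "lift_ends Zh qZ (G \<circ> r) (F t) (F t)" using lift_ends_image[OF F lr] eq by simp
    then have hp: "homotopic_paths Z (conjugate_path gi (proj i \<circ> (G \<circ> r))) (conjugate_path gk (proj k \<circ> (G \<circ> r)))"
      using l pb by (simp add: qF)
    have "homotopic_paths Z (conjugate_path gi (h \<circ> r)) (conjugate_path gi (proj i \<circ> (G \<circ> r)))"
      by (rule conjugate_path_cong[OF gi hr homotopic_paths_sym[OF Gr(1)[OF r]]])
    also note hp
    also have "homotopic_paths Z (conjugate_path gk (proj k \<circ> (G \<circ> r))) (conjugate_path gk (\<lambda>_. z0))"
      using path_between_homotopic[OF homotopic_paths_sym[OF Gr(2)[OF r]] path_between_const[OF Z(2)]]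
      by (rule conjugate_path_cong[OF gk _ Gr(2)[OF r]])
    also have "homotopic_paths Z \<dots> (\<lambda>_. z0)" using gk by (rule conjugate_path_const)
    finally have null: "homotopic_paths Z (conjugate_path gi (h \<circ> r)) (\<lambda>_. z0)" .
    have "homotopic_paths Z (h \<circ> r) (conjugate_path (reversepath gi) (conjugate_path gi (h \<circ> r)))"
      by (rule homotopic_paths_sym[OF conjugate_path_cancel[OF gi hr]])
    also have "homotopic_paths Z \<dots> (conjugate_path (reversepath gi) (\<lambda>_. z0))"
      by (rule conjugate_path_cong[OF path_between_reverse[OF gi] path_between_conjugate[OF gi hr] null])
    also have "homotopic_paths Z \<dots> (\<lambda>_. h y)" using path_between_reverse[OF gi] by (rule conjugate_path_const)
    finally have "homotopic_paths Y r (\<lambda>_. y)"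
      using iso r by (intro null_loop_reflected[OF pcY Y(3) h]) (auto simp: iso_def bij_betw_def)
    from lift_ends_const_unique[OF covY lift_ends_homotopic[OF covY this lr]] show "t = t'" by simp
  qed
  have surj: "pullback Y G Zh qZ \<subseteq> (\<lambda>t. (pY t, F t)) ` Yt"
  proof
    fix z assume "z \<in> pullback Y G Zh qZ"
    then obtain y e where z: "z = (y, e)" and y: "y \<in> Y" and e: "e \<in> Zh" "qZ e = G y"
      by (auto simp: pullback_def)
    obtain t where t: "t \<in> Yt" "pY t = y" using pY y by blast
    have qF: "qZ (F t) = G y" using F'(2)[OF t(1)] t by simp
    obtain gi gk where g: "path_between Z gi z0 (qZ (F t) i)" "path_between Z gk z0 (qZ (F t) k)"
      and l: "\<And>r. path_between (power_space 2 Z) r (qZ (F t)) (qZ (F t)) \<Longrightarrow> lift_ends Zh qZ r (F t) (F t) \<longleftrightarrow>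
        homotopic_paths Z (conjugate_path gi (proj i \<circ> r)) (conjugate_path gk (proj k \<circ> r))"
      using pair_covering_loop_lifts[OF Zh Z(1) F'(1)[OF t(1)] ik] by metis
    have gi: "path_between Z gi z0 (h y)" and gk: "path_between Z gk z0 z0"
      using g Gi[OF y] by (auto simp: qF)
    obtain d where d: "path_between Zh d (F t) e"
      using pcZh F'(1)[OF t(1)] e unfolding path_connected_component path_component_iff_path_between by blast
    define w where "w = qZ \<circ> d"
    have w: "path_between (power_space 2 Z) w (G y) (G y)"
      using path_between_image[OF d qZ] e qF by (simp add: w_def)
    have lw: "lift_ends Zh qZ w (F t) e" unfolding w_def using d by (rule lift_ends_compose)
    define a where "a = proj i \<circ> w"
    define b where "b = proj k \<circ> w"
    have a: "path_between Z a (h y) (h y)"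
      using path_between_image[OF w continuous_on_proj proj_in[OF lt(1)]] Gi[OF y] by (simp add: a_def proj_def)
    have b: "path_between Z b z0 z0"
      using path_between_image[OF w continuous_on_proj proj_in[OF lt(2)]] Gi[OF y] by (simp add: b_def proj_def)
    note a' = path_between_reverse[OF a] and b' = path_between_reverse[OF b]
    note gi' = path_between_reverse[OF gi]
    \<comment> \<open>A path from \<open>F t\<close> to \<open>e\<close> projects to the pair of loops \<open>(a, b)\<close>. The loop \<open>r\<close> is chosen such that
      \<open>(h \<circ> r, z0)\<close> followed by the reverse of \<open>(a, b)\<close> is conjugate to \<open>(c, c)\<close>. Then this composition
      lifts to a loop at \<open>F t\<close>, so the lift of \<open>(h \<circ> r, z0)\<close> from \<open>F t\<close> ends at \<open>e\<close>.\<close>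
    define c where "c = conjugate_path gk (reversepath b)"
    have c: "path_between Z c z0 z0" unfolding c_def using gk b' by (rule path_between_conjugate)
    define s where "s = conjugate_path (reversepath gi) c"
    have s: "path_between Z s (h y) (h y)" unfolding s_def using gi' c by (rule path_between_conjugate)
    obtain r where r: "path_between Y r y y" and hr: "homotopic_paths Z (h \<circ> r) (s +++ a)"
      using loop_realized[OF pcY Y(3) h _ y path_between_join[OF s a]] iso
      by (auto simp: iso_def bij_betw_def)
    have pb: "path_between (power_space 2 Z) (G \<circ> r) (G y) (G y)" using r cG GP by (rule path_between_image)
    have pbi: "path_between Z (proj i \<circ> (G \<circ> r)) (h y) (h y)"
      using path_between_image[OF pb continuous_on_proj proj_in[OF lt(1)]] Gi[OF y] by (simp add: proj_def)
    have pbk: "path_between Z (proj k \<circ> (G \<circ> r)) z0 z0"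
      using path_between_image[OF pb continuous_on_proj proj_in[OF lt(2)]] Gi[OF y] by (simp add: proj_def)
    let ?v = "(G \<circ> r) +++ reversepath w"
    have v: "path_between (power_space 2 Z) ?v (G y) (G y)"
      using pb path_between_reverse[OF w] by (rule path_between_join)
    have vi: "proj i \<circ> ?v = (proj i \<circ> (G \<circ> r)) +++ reversepath a"
      "proj k \<circ> ?v = (proj k \<circ> (G \<circ> r)) +++ reversepath b"
      by (simp_all add: path_compose_join path_compose_reversepath a_def b_def)
    have "homotopic_paths Z (proj i \<circ> ?v) ((s +++ a) +++ reversepath a)"
      unfolding vi using homotopic_paths_trans[OF Gr(1)[OF r] hr]
      by (rule homotopic_paths_join_between[OF _ homotopic_paths_refl_between[OF a'] pbi a'])
    also have "homotopic_paths Z \<dots> s" using s a by (rule homotopic_paths_cancel_right)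
    finally have 1: "homotopic_paths Z (proj i \<circ> ?v) s" .
    have vib: "path_between Z (proj i \<circ> ?v) (h y) (h y)" unfolding vi using pbi a' by (rule path_between_join)
    have vkb: "path_between Z (proj k \<circ> ?v) z0 z0" unfolding vi using pbk b' by (rule path_between_join)
    have "homotopic_paths Z (conjugate_path gi (proj i \<circ> ?v)) (conjugate_path gi s)"
      by (rule conjugate_path_cong[OF gi vib 1])
    also have "homotopic_paths Z \<dots> c" unfolding s_def using gi c by (rule conjugate_path_cancel')
    finally have i: "homotopic_paths Z (conjugate_path gi (proj i \<circ> ?v)) c" .
    have "homotopic_paths Z (proj k \<circ> ?v) ((\<lambda>_. z0) +++ reversepath b)"
      unfolding vi by (rule homotopic_paths_join_between[OF Gr(2)[OF r] homotopic_paths_refl_between[OF b'] pbk b'])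
    also have "homotopic_paths Z \<dots> (reversepath b)" using b' by (rule homotopic_paths_const_left)
    finally have "homotopic_paths Z (conjugate_path gk (proj k \<circ> ?v)) c"
      unfolding c_def by (rule conjugate_path_cong[OF gk vkb])
    with i have "homotopic_paths Z (conjugate_path gi (proj i \<circ> ?v)) (conjugate_path gk (proj k \<circ> ?v))"
      by (blast intro: homotopic_paths_trans homotopic_paths_sym)
    then have lv: "lift_ends Zh qZ ?v (F t) (F t)" using l v by (simp add: qF)
    obtain e' where e': "lift_ends Zh qZ (G \<circ> r) (F t) e'" "lift_ends Zh qZ (reversepath w) e' (F t)"
      by (rule lift_ends_joinE[OF covZ _ _ _ _ _ lv]) (use pb path_between_reverse[OF w] in \<open>auto simp: path_between_def\<close>)
    have "e' = e" using lift_ends_unique[OF covZ _ lw] e'(2) by (simp add: lift_ends_reverse_iff)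
    obtain t' where t': "lift_ends Yt pY r t t'"
      using lift_ends_exists[OF covY, of r t] r t by (auto simp: path_between_def)
    have "F t' = e" using lift_ends_unique[OF covZ lift_ends_image[OF F t'] e'(1)] \<open>e' = e\<close> by simp
    moreover have "t' \<in> Yt" "pY t' = y" using lift_ends_endpoints[OF t'] r by (auto simp: path_between_def)
    ultimately show "z \<in> (\<lambda>t. (pY t, F t)) ` Yt" using z by auto
  qed
  have "(\<lambda>t. (pY t, F t)) ` Yt \<subseteq> pullback Y G Zh qZ" using F' pY by (auto simp: pullback_def)
  with inj surj have "bij_betw (\<lambda>t. (pY t, F t)) Yt (pullback Y G Zh qZ)" by (auto simp: bij_betw_def)
  from fibrewise_bijection_inverse_continuous[OF covY covZ cG GP F this] that[OF F] show thesis by metis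
qed

section \<open>Invariance of sectional categories under fibrewise maps\<close>

lemma secat_le_if_fibrewise_map:
  fixes E :: "'e::topological_space set" and E' :: "'f::topological_space set" and B :: "'b::topological_space set"
  assumes f: "continuous_on E f" "f ` E \<subseteq> E'" "\<And>x. x \<in> E \<Longrightarrow> p' (f x) = p x"
  shows "secat E' p' B \<le> secat E p B"
proof -
  have sec: "has_section E' p' U" if s: "has_section E p U" for U
  proof -
    from s obtain s where s: "continuous_on U s" "s ` U \<subseteq> E" "\<And>b. b \<in> U \<Longrightarrow> p (s b) = b"
      unfolding has_section_def by blast
    have "continuous_on U (f \<circ> s)"
      using s f by (intro continuous_on_compose) (auto intro: continuous_on_subset)
    moreover have "f (s b) \<in> E' \<and> p' (f (s b)) = b" if "b \<in> U" for b
      using s(2) s(3)[OF that] f(2) f(3)[of "s b"] that by auto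
    ultimately show ?thesis unfolding has_section_def
      by (intro exI[of _ "f \<circ> s"]) auto
  qed
  show ?thesis unfolding secat_eq
  proof (rule Inf_superset_mono, rule subsetI, elim CollectE exE conjE)
    fix x n and U :: "nat \<Rightarrow> 'b set"
    assume x: "x = enat n" and B: "B = (\<Union>j\<le>n. U j)"
      and U: "\<forall>j\<le>n. openin (top_of_set B) (U j) \<and> has_section E p (U j)"
    have "\<forall>j\<le>n. openin (top_of_set B) (U j) \<and> has_section E' p' (U j)"
      using U sec by blast
    with x B show "x \<in> {enat n | n. \<exists>U. B = (\<Union>j\<le>n. U j) \<and>
        (\<forall>j\<le>n. openin (top_of_set B) (U j) \<and> has_section E' p' (U j))}"
      by blast
  qed
qed

lemma dsecat_le_if_fibrewise_map:
  fixes E :: "'e::topological_space set" and E' :: "'f::topological_space set" and B :: "'b::topological_space set"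
  assumes f: "f ` E \<subseteq> E'" "\<And>x. x \<in> E \<Longrightarrow> p' (f x) = p x"
    and T: "\<And>k. continuous_map (T k E) (T' k E') (map_pmf f)"
  shows "dsecat T' E' p' B \<le> dsecat T E p B"
  unfolding dsecat_def
proof (rule Inf_superset_mono, rule subsetI, elim CollectE exE conjE)
  fix x n s
  assume x: "x = enat n"
    and s: "continuous_map (top_of_set B) (subtopology (T (n + 1) E) (fibre_prob (n + 1) E p B)) s"
    and sb: "\<forall>b\<in>B. fibre_proj p (s b) = b"
  have sE: "s b \<in> fibre_prob (n + 1) E p B" if "b \<in> B" for b
    using s that by (auto simp: continuous_map_in_subtopology)
  have im: "p' ` set_pmf (map_pmf f (s b)) = p ` set_pmf (s b)" if "b \<in> B" for b
  proof -
    have "set_pmf (s b) \<subseteq> E" using sE[OF that] by (simp add: fibre_prob_def fin_prob_def)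
    then show ?thesis using f(2) by (force simp: image_image)
  qed
  have "map_pmf f (s b) \<in> fibre_prob (n + 1) E' p' B" if b: "b \<in> B" for b
  proof -
    have sub: "set_pmf (s b) \<subseteq> E" and fin: "finite (set_pmf (s b))" and c: "card (set_pmf (s b)) \<le> n + 1"
      using sE[OF b] by (auto simp: fibre_prob_def fin_prob_def)
    have "card (f ` set_pmf (s b)) \<le> n + 1" using card_image_le[OF fin, of f] c by simp
    then show ?thesis
      using sE[OF b] im[OF b] sub fin f(1) by (auto simp: fibre_prob_def fin_prob_def)
  qed
  moreover have "continuous_map (top_of_set B) (T' (n + 1) E') (map_pmf f \<circ> s)"
    using s T by (intro continuous_map_compose[of _ "T (n + 1) E"]) (auto simp: continuous_map_in_subtopology)
  ultimately have "continuous_map (top_of_set B) (subtopology (T' (n + 1) E') (fibre_prob (n + 1) E' p' B)) (map_pmf f \<circ> s)"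
    by (auto simp: continuous_map_in_subtopology)
  moreover have "fibre_proj p' ((map_pmf f \<circ> s) b) = b" if "b \<in> B" for b
    using im[OF that] sb that by (simp add: fibre_proj_def)
  ultimately show "x \<in> {enat n | n. \<exists>s. continuous_map (top_of_set B)
      (subtopology (T' (n + 1) E') (fibre_prob (n + 1) E' p' B)) s \<and> (\<forall>b\<in>B. fibre_proj p' (s b) = b)}"
    using x by blast
qed

section \<open>Continuity of push-forward for the quotient topology\<close>

lemma openin_quotient_topology:
  "openin (quotient_topology T h) U \<longleftrightarrow> U \<subseteq> h ` topspace T \<and> openin T {x \<in> topspace T. h x \<in> U}"
proof -
  have "istopology (\<lambda>U. U \<subseteq> h ` topspace T \<and> openin T {x \<in> topspace T. h x \<in> U})"
    unfolding istopology_def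
  proof (intro conjI allI impI)
    fix U V assume "U \<subseteq> h ` topspace T \<and> openin T {x \<in> topspace T. h x \<in> U}"
      and "V \<subseteq> h ` topspace T \<and> openin T {x \<in> topspace T. h x \<in> V}"
    moreover have "{x \<in> topspace T. h x \<in> U \<inter> V} = {x \<in> topspace T. h x \<in> U} \<inter> {x \<in> topspace T. h x \<in> V}" by auto
    ultimately show "U \<inter> V \<subseteq> h ` topspace T" "openin T {x \<in> topspace T. h x \<in> U \<inter> V}" by auto
  next
    fix \<U> assume U: "\<forall>U\<in>\<U>. U \<subseteq> h ` topspace T \<and> openin T {x \<in> topspace T. h x \<in> U}"
    then show "\<Union>\<U> \<subseteq> h ` topspace T" by blast
    have "{x \<in> topspace T. h x \<in> \<Union>\<U>} = (\<Union>U\<in>\<U>. {x \<in> topspace T. h x \<in> U})" by auto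
    with U show "openin T {x \<in> topspace T. h x \<in> \<Union>\<U>}" by auto
  qed
  then show ?thesis unfolding quotient_topology_def by (simp add: topology_inverse')
qed

lemma topspace_quotient_topology: "topspace (quotient_topology T h) = h ` topspace T"
proof (rule subset_antisym)
  show "topspace (quotient_topology T h) \<subseteq> h ` topspace T"
    using openin_topspace[of "quotient_topology T h"] unfolding openin_quotient_topology by blast
  have "{x \<in> topspace T. h x \<in> h ` topspace T} = topspace T" by auto
  then have "openin (quotient_topology T h) (h ` topspace T)" unfolding openin_quotient_topology by simp
  then show "h ` topspace T \<subseteq> topspace (quotient_topology T h)" by (rule openin_subset)
qed

lemma continuous_map_quotient_topology:
  assumes F: "continuous_map T T' F" and comm: "\<And>x. x \<in> topspace T \<Longrightarrow> g (h x) = h' (F x)"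
  shows "continuous_map (quotient_topology T h) (quotient_topology T' h') g"
  unfolding continuous_map_def
proof (intro conjI allI impI)
  have FT: "F x \<in> topspace T'" if "x \<in> topspace T" for x
    using F that by (auto simp: continuous_map_def)
  show "g \<in> topspace (quotient_topology T h) \<rightarrow> topspace (quotient_topology T' h')"
    using comm FT by (auto simp: topspace_quotient_topology)
  fix U assume "openin (quotient_topology T' h') U"
  then have "openin T' {x \<in> topspace T'. h' x \<in> U}" by (simp add: openin_quotient_topology)
  then have "openin T {x \<in> topspace T. F x \<in> {x \<in> topspace T'. h' x \<in> U}}"
    using F unfolding continuous_map_def by blast
  also have "{x \<in> topspace T. F x \<in> {x \<in> topspace T'. h' x \<in> U}} =
      {x \<in> topspace T. h x \<in> {y \<in> topspace (quotient_topology T h). g y \<in> U}}"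
    using FT by (auto simp: topspace_quotient_topology simp flip: comm)
  finally show "openin (quotient_topology T h) {y \<in> topspace (quotient_topology T h). g y \<in> U}"
    by (auto simp: openin_quotient_topology topspace_quotient_topology)
qed

text \<open>A convex combination is the image under \<open>e\<close> of the distribution \<open>t\<close> on the indices. Hence its
  push-forward only changes the points \<open>e\<close>, not the weights.\<close>

lemma convex_comb_eq_map_pmf:
  assumes t: "t \<in> prob_simplex k"
  shows "convex_comb k (t, e) = map_pmf e (embed_pmf (\<lambda>i. if i < k then t i else 0))"
    and "set_pmf (embed_pmf (\<lambda>i. if i < k then t i else 0)) \<subseteq> {..<k}"
proof -
  let ?w = "\<lambda>i. if i < k then t i else 0"
  have nn: "0 \<le> ?w i" for i using t by (auto simp: prob_simplex_def PiE_iff)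
  have "(\<integral>\<^sup>+ i. ennreal (?w i) \<partial>count_space UNIV) = (\<Sum>i<k. ennreal (?w i))"
    by (rule nn_integral_count_space') auto
  also have "\<dots> = ennreal (\<Sum>i<k. ?w i)" 
  proof -
    have "(\<Sum>i<k. ennreal (?w i)) = ennreal (\<Sum>i<k. ?w i)" by (rule sum_ennreal) (rule nn)
    then show ?thesis .
  qed
  also have "(\<Sum>i<k. ?w i) = 1" using t by (simp add: prob_simplex_def)
  finally have one: "(\<integral>\<^sup>+ i. ennreal (?w i) \<partial>count_space UNIV) = 1" by simp
  have w: "pmf (embed_pmf ?w) i = ?w i" for i by (rule pmf_embed_pmf[OF nn one])
  show sub: "set_pmf (embed_pmf ?w) \<subseteq> {..<k}"
  proof
    fix i assume "i \<in> set_pmf (embed_pmf ?w)"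
    then have "?w i \<noteq> 0" using w[of i] by (simp add: set_pmf_iff)
    then show "i \<in> {..<k}" by (auto split: if_splits)
  qed
  have "pmf (map_pmf e (embed_pmf ?w)) x = (\<Sum>i\<in>{i. i < k \<and> e i = x}. t i)" for x
  proof -
    have "measure_pmf.prob (embed_pmf ?w) (e -` {x}) = measure_pmf.prob (embed_pmf ?w) {i. i < k \<and> e i = x}"
    proof -
      have "e -` {x} \<inter> set_pmf (embed_pmf ?w) = {i. i < k \<and> e i = x} \<inter> set_pmf (embed_pmf ?w)"
        using sub by auto
      then have "measure_pmf.prob (embed_pmf ?w) (e -` {x} \<inter> set_pmf (embed_pmf ?w)) =
          measure_pmf.prob (embed_pmf ?w) ({i. i < k \<and> e i = x} \<inter> set_pmf (embed_pmf ?w))" by simp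
      then show ?thesis by (simp only: measure_Int_set_pmf)
    qed
    then show ?thesis by (simp add: pmf_map measure_measure_pmf_finite w)
  qed
  then have "(\<lambda>x. \<Sum>i\<in>{i. i < k \<and> e i = x}. t i) = pmf (map_pmf e (embed_pmf ?w))" by auto
  then show "convex_comb k (t, e) = map_pmf e (embed_pmf ?w)"
    by (simp add: convex_comb_def type_definition.Rep_inverse[OF td_pmf_embed_pmf])
qed

lemma continuous_map_join_topology:
  fixes E :: "'e::topological_space set" and E' :: "'f::topological_space set"
  assumes f: "continuous_on E f" "f ` E \<subseteq> E'"
  shows "continuous_map (join_topology k E) (join_topology k E') (map_pmf f)"
  unfolding join_topology_def
proof (rule continuous_map_quotient_topology)
  let ?F = "\<lambda>(t, e). (t, \<lambda>i\<in>{..<k}. f (e i))"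
  let ?D = "prob_simplex k \<times> power_space k E"
  have "continuous_on ?D (\<lambda>x. (\<lambda>i\<in>{..<k}. f (snd x i)) i)" for i
  proof (cases "i < k")
    case True
    have "continuous_on ?D (\<lambda>x. snd x i)"
      by (rule continuous_on_compose2[OF continuous_on_product_coordinates[of i]
            continuous_on_snd[OF continuous_on_id]]) simp
    then have "continuous_on ?D (\<lambda>x. f (snd x i))"
    proof (rule continuous_on_compose2[OF f(1)])
      have "e i \<in> E" if "e \<in> power_space k E" for e
        using that True unfolding power_space_def by (auto dest: PiE_mem)
      then show "(\<lambda>x. snd x i) ` ?D \<subseteq> E" by (simp add: image_subset_iff mem_Times_iff)
    qed
    with True show ?thesis by simp
  qed simp
  then have "continuous_on ?D (\<lambda>x. \<lambda>i\<in>{..<k}. f (snd x i))"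
    by (rule continuous_on_coordinatewise_then_product)
  then have "continuous_on ?D ?F"
    by (auto simp: case_prod_beta intro!: continuous_on_Pair continuous_on_fst continuous_on_id)
  moreover have "?F ` ?D \<subseteq> prob_simplex k \<times> power_space k E'"
    using f(2) by (auto simp: power_space_def image_subset_iff dest: PiE_mem)
  ultimately show "continuous_map (top_of_set ?D) (top_of_set (prob_simplex k \<times> power_space k E')) ?F"
    by (simp add: continuous_map_in_subtopology image_subset_iff_funcset)
  fix x assume "x \<in> topspace (top_of_set ?D)"
  then obtain t e where x: "x = (t, e)" "t \<in> prob_simplex k" by auto
  show "map_pmf f (convex_comb k x) = convex_comb k (?F x)"
    using convex_comb_eq_map_pmf(2)[OF x(2)]
    by (auto simp: x convex_comb_eq_map_pmf(1) pmf.map_comp intro!: map_pmf_cong)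
qed

section \<open>Continuity of push-forward for the Levy-Prokhorov metric\<close>

text \<open>The radii over which the infimum in \<^const>\<open>levy_prokhorov\<close> is taken. They are closed upwards, so that
  a distance below \<open>r\<close> makes \<open>r\<close> itself admissible.\<close>

definition levy_prokhorov_close :: "'e set \<Rightarrow> ('e \<Rightarrow> 'e \<Rightarrow> real) \<Rightarrow> 'e pmf \<Rightarrow> 'e pmf \<Rightarrow> real \<Rightarrow> bool" where
  "levy_prokhorov_close E d \<mu> \<nu> r \<longleftrightarrow> 0 < r \<and>
     (\<forall>A\<in>sigma_sets E {U. openin (Metric_space.mtopology E d) U}.
        measure_pmf.prob \<mu> A \<le> measure_pmf.prob \<nu> {x\<in>E. \<exists>a\<in>A. d a x < r} + r \<and>
        measure_pmf.prob \<nu> A \<le> measure_pmf.prob \<mu> {x\<in>E. \<exists>a\<in>A. d a x < r} + r)"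

lemma levy_prokhorov_eq: "levy_prokhorov E d \<mu> \<nu> = Inf {r. levy_prokhorov_close E d \<mu> \<nu> r}"
  by (simp add: levy_prokhorov_def levy_prokhorov_close_def)

lemma levy_prokhorov_close_sym: "levy_prokhorov_close E d \<mu> \<nu> r \<longleftrightarrow> levy_prokhorov_close E d \<nu> \<mu> r"
  by (auto simp: levy_prokhorov_close_def)

lemma levy_prokhorov_close_mono:
  assumes c: "levy_prokhorov_close E d \<mu> \<nu> r" and le: "r \<le> s"
  shows "levy_prokhorov_close E d \<mu> \<nu> s"
proof -
  have "measure_pmf.prob \<kappa> {x\<in>E. \<exists>a\<in>A. d a x < r} + r \<le> measure_pmf.prob \<kappa> {x\<in>E. \<exists>a\<in>A. d a x < s} + s"
    for A and \<kappa> :: "'a pmf"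
  proof (intro add_mono measure_pmf.finite_measure_mono le subsetI)
    fix x assume "x \<in> {x\<in>E. \<exists>a\<in>A. d a x < r}"
    then obtain a where "x \<in> E" "a \<in> A" "d a x < r" by blast
    with le show "x \<in> {x\<in>E. \<exists>a\<in>A. d a x < s}" by (auto intro!: bexI[of _ a])
  qed simp
  with c le show ?thesis unfolding levy_prokhorov_close_def by (meson order_trans less_le_trans)
qed

lemma levy_prokhorov_close_1: "levy_prokhorov_close E d \<mu> \<nu> 1"
proof -
  have "measure_pmf.prob \<kappa> A \<le> measure_pmf.prob \<kappa>' C + 1" for \<kappa> \<kappa>' :: "'a pmf" and A C
    using measure_pmf.prob_le_1[of \<kappa> A] measure_nonneg[of "measure_pmf \<kappa>'" C] by linarith
  then show ?thesis by (simp add: levy_prokhorov_close_def)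
qed

lemma levy_prokhorov_le:
  assumes "levy_prokhorov_close E d \<mu> \<nu> r" shows "levy_prokhorov E d \<mu> \<nu> \<le> r"
  unfolding levy_prokhorov_eq
  by (rule cInf_lower) (use assms in \<open>auto simp: levy_prokhorov_close_def intro!: bdd_belowI[of _ 0]\<close>)

lemma levy_prokhorov_closeI:
  assumes "levy_prokhorov E d \<mu> \<nu> < r" shows "levy_prokhorov_close E d \<mu> \<nu> r"
proof -
  have "{r. levy_prokhorov_close E d \<mu> \<nu> r} \<noteq> {}" using levy_prokhorov_close_1 by blast
  from cInf_lessD[OF this assms[unfolded levy_prokhorov_eq]] show ?thesis
    using levy_prokhorov_close_mono by fastforce
qed

lemma levy_prokhorov_nonneg: "0 \<le> levy_prokhorov E d \<mu> \<nu>"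
  unfolding levy_prokhorov_eq
proof (rule cInf_greatest)
  show "{r. levy_prokhorov_close E d \<mu> \<nu> r} \<noteq> {}" using levy_prokhorov_close_1 by blast
qed (simp add: levy_prokhorov_close_def)

context Metric_space
begin

lemma borel_neighbourhood:
  assumes "A \<subseteq> M"
  shows "{x \<in> M. \<exists>a\<in>A. d a x < r} \<in> sigma_sets M {U. openin mtopology U}"
proof -
  have "{x \<in> M. \<exists>a\<in>A. d a x < r} = (\<Union>a\<in>A. mball a r)" using assms by (auto simp: mball_def)
  then show ?thesis by (auto intro!: sigma_sets.Basic)
qed

lemma finite_borel:
  assumes "finite A" "A \<subseteq> M"
  shows "A \<in> sigma_sets M {U. openin mtopology U}"
proof -
  have "closedin mtopology A" using assms by (simp add: closedin_Hausdorff_finite Hausdorff_space_mtopology)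
  then have "M - A \<in> sigma_sets M {U. openin mtopology U}"
    by (intro sigma_sets.Basic) (auto simp: closedin_def)
  from sigma_sets.Compl[OF this] assms(2) show ?thesis by (simp add: double_diff)
qed

lemma borel_subset: "A \<in> sigma_sets M {U. openin mtopology U} \<Longrightarrow> A \<subseteq> M"
  by (rule sigma_sets_into_sp) (use openin_subset[of mtopology] in auto)

lemma levy_prokhorov_close_trans:
  assumes 1: "levy_prokhorov_close M d \<mu> \<nu> r" and 2: "levy_prokhorov_close M d \<nu> \<xi> s"
  shows "levy_prokhorov_close M d \<mu> \<xi> (r + s)"
proof -
  let ?N = "\<lambda>A r. {x \<in> M. \<exists>a\<in>A. d a x < r}"
  have half: "measure_pmf.prob \<mu> A \<le> measure_pmf.prob \<xi> (?N A (r + s)) + (r + s)"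
    if 1: "levy_prokhorov_close M d \<mu> \<nu> r" and 2: "levy_prokhorov_close M d \<nu> \<xi> s"
      and A: "A \<in> sigma_sets M {U. openin mtopology U}" for \<mu> \<xi> :: "'a pmf" and A r s
  proof -
    have AM: "A \<subseteq> M" using A by (rule borel_subset)
    have "?N (?N A r) s \<subseteq> ?N A (r + s)"
    proof clarify
      fix x b a assume "x \<in> M" "b \<in> M" "d b x < s" "a \<in> A" "d a b < r"
      moreover from this have "d a x \<le> d a b + d b x" using AM by (intro triangle) auto
      ultimately show "\<exists>a\<in>A. d a x < r + s" by (intro bexI[of _ a]) auto
    qed
    then have "measure_pmf.prob \<xi> (?N (?N A r) s) \<le> measure_pmf.prob \<xi> (?N A (r + s))"
      by (intro measure_pmf.finite_measure_mono) auto
    moreover have "measure_pmf.prob \<mu> A \<le> measure_pmf.prob \<nu> (?N A r) + r"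
      using 1 A by (auto simp: levy_prokhorov_close_def)
    moreover have "measure_pmf.prob \<nu> (?N A r) \<le> measure_pmf.prob \<xi> (?N (?N A r) s) + s"
      using 2 borel_neighbourhood[OF AM, of r] unfolding levy_prokhorov_close_def by blast
    ultimately show ?thesis by linarith
  qed
  have pos: "0 < r + s" using 1 2 by (auto simp: levy_prokhorov_close_def)
  have "measure_pmf.prob \<mu> A \<le> measure_pmf.prob \<xi> (?N A (r + s)) + (r + s)"
    "measure_pmf.prob \<xi> A \<le> measure_pmf.prob \<mu> (?N A (r + s)) + (r + s)"
    if "A \<in> sigma_sets M {U. openin mtopology U}" for A
    using half[OF 1 2 that]
      half[OF 2[unfolded levy_prokhorov_close_sym[of _ _ \<nu>]] 1[unfolded levy_prokhorov_close_sym[of _ _ \<mu>]] that]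
    by (simp_all add: add.commute)
  with pos show ?thesis by (simp add: levy_prokhorov_close_def)
qed

text \<open>For \<open>r\<close> smaller than the distance from \<open>x\<close> to the other atoms of \<open>\<nu>\<close>, the \<open>r\<close>-neighbourhood of \<open>x\<close> has no
  \<open>\<nu>\<close>-mass outside \<open>x\<close>. This uses that \<open>\<nu>\<close> has finite support.\<close>

lemma levy_prokhorov_zero_imp_pmf_le:
  assumes fin: "\<nu> \<in> fin_prob k M" and x: "x \<in> M" and z: "levy_prokhorov M d \<mu> \<nu> = 0"
  shows "pmf \<mu> x \<le> pmf \<nu> x"
proof (rule field_le_epsilon)
  fix \<epsilon> :: real assume e: "0 < \<epsilon>"
  let ?S = "set_pmf \<nu> - {x}"
  have S: "finite ?S" "?S \<subseteq> M" using fin by (auto simp: fin_prob_def)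
  obtain \<rho> where r: "0 < \<rho>" "\<And>y. y \<in> ?S \<Longrightarrow> \<rho> \<le> d x y"
  proof (rule that[of "Min (insert 1 (d x ` ?S))"])
    show "0 < Min (insert 1 (d x ` ?S))" using S x by (auto simp: mdist_pos_less)
    show "\<And>y. y \<in> ?S \<Longrightarrow> Min (insert 1 (d x ` ?S)) \<le> d x y" using S by auto
  qed
  define r where "r = min \<epsilon> \<rho>"
  have "levy_prokhorov_close M d \<mu> \<nu> r" using z e r by (intro levy_prokhorov_closeI) (simp add: r_def)
  moreover have "{x} \<in> sigma_sets M {U. openin mtopology U}" using x by (intro finite_borel) auto
  ultimately have "measure_pmf.prob \<mu> {x} \<le> measure_pmf.prob \<nu> {y \<in> M. \<exists>a\<in>{x}. d a y < r} + r"
    unfolding levy_prokhorov_close_def by blast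
  also have "measure_pmf.prob \<nu> {y \<in> M. \<exists>a\<in>{x}. d a y < r} = measure_pmf.prob \<nu> ({y \<in> M. \<exists>a\<in>{x}. d a y < r} \<inter> set_pmf \<nu>)"
    by (simp only: measure_Int_set_pmf)
  also have "\<dots> \<le> measure_pmf.prob \<nu> {x}"
    using r by (intro measure_pmf.finite_measure_mono) (fastforce simp: r_def)+
  finally show "pmf \<mu> x \<le> pmf \<nu> x + \<epsilon>" by (simp add: measure_pmf_single r_def)
qed

lemma Metric_space_levy_prokhorov: "Metric_space (fin_prob k M) (levy_prokhorov M d)"
proof
  fix \<mu> \<nu> \<xi> :: "'a pmf"
  show "0 \<le> levy_prokhorov M d \<mu> \<nu>" by (rule levy_prokhorov_nonneg)
  show comm: "levy_prokhorov M d \<mu> \<nu> = levy_prokhorov M d \<nu> \<mu>"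
    unfolding levy_prokhorov_eq using levy_prokhorov_close_sym[of M d \<mu> \<nu>] by presburger
  show "levy_prokhorov M d \<mu> \<nu> = 0 \<longleftrightarrow> \<mu> = \<nu>" if f: "\<mu> \<in> fin_prob k M" "\<nu> \<in> fin_prob k M"
  proof
    assume z: "levy_prokhorov M d \<mu> \<nu> = 0"
    show "\<mu> = \<nu>"
    proof (rule pmf_eqI)
      fix x show "pmf \<mu> x = pmf \<nu> x"
      proof (cases "x \<in> M")
        case True
        then show ?thesis
          using levy_prokhorov_zero_imp_pmf_le[OF f(2) True z]
            levy_prokhorov_zero_imp_pmf_le[OF f(1) True z[unfolded comm]] by simp
      next
        case False
        then have "x \<notin> set_pmf \<mu>" "x \<notin> set_pmf \<nu>" using f by (auto simp: fin_prob_def)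
        then show ?thesis by (simp add: set_pmf_iff)
      qed
    qed
  next
    assume "\<mu> = \<nu>"
    have "levy_prokhorov_close M d \<mu> \<mu> \<epsilon>" if e: "0 < \<epsilon>" for \<epsilon>
    proof -
      have "measure_pmf.prob \<mu> A \<le> measure_pmf.prob \<mu> {x \<in> M. \<exists>a\<in>A. d a x < \<epsilon>} + \<epsilon>"
        if "A \<in> sigma_sets M {U. openin mtopology U}" for A
      proof -
        have "A \<subseteq> {x \<in> M. \<exists>a\<in>A. d a x < \<epsilon>}" using borel_subset[OF that] e by (auto intro!: bexI)
        then have "measure_pmf.prob \<mu> A \<le> measure_pmf.prob \<mu> {x \<in> M. \<exists>a\<in>A. d a x < \<epsilon>}"
          by (intro measure_pmf.finite_measure_mono) auto
        with e show ?thesis by simp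
      qed
      with e show ?thesis by (simp add: levy_prokhorov_close_def)
    qed
    then have "levy_prokhorov M d \<mu> \<mu> \<le> 0 + \<epsilon>" if "0 < \<epsilon>" for \<epsilon> using levy_prokhorov_le that by fastforce
    then have "levy_prokhorov M d \<mu> \<mu> \<le> 0" by (rule field_le_epsilon)
    with levy_prokhorov_nonneg[of M d \<mu> \<mu>] \<open>\<mu> = \<nu>\<close> show "levy_prokhorov M d \<mu> \<nu> = 0" by simp
  qed
  show "levy_prokhorov M d \<mu> \<xi> \<le> levy_prokhorov M d \<mu> \<nu> + levy_prokhorov M d \<nu> \<xi>"
  proof (rule field_le_epsilon)
    fix \<epsilon> :: real assume "0 < \<epsilon>"
    then have "levy_prokhorov_close M d \<mu> \<nu> (levy_prokhorov M d \<mu> \<nu> + \<epsilon> / 2)"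
      "levy_prokhorov_close M d \<nu> \<xi> (levy_prokhorov M d \<nu> \<xi> + \<epsilon> / 2)"
      by (auto intro: levy_prokhorov_closeI)
    from levy_prokhorov_le[OF levy_prokhorov_close_trans[OF this]]
    show "levy_prokhorov M d \<mu> \<xi> \<le> levy_prokhorov M d \<mu> \<nu> + levy_prokhorov M d \<nu> \<xi> + \<epsilon>" by simp
  qed
qed

end

text \<open>Closeness of \<open>\<mu>\<close> and \<open>\<nu>\<close> enters only through the bound of \<open>\<mu>\<close> by \<open>\<nu>\<close> on sets of atoms of \<open>\<mu>\<close>. The atoms with
  image in \<open>A\<close> give one of the required inequalities. The atoms whose image is at distance at least \<open>\<epsilon>\<close>
  from \<open>A\<close> give the other one by passing to complements. Therefore continuity of \<open>f\<close> at the finitely many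
  atoms of \<open>\<mu>\<close> suffices, whichever metrics are chosen.\<close>

lemma levy_prokhorov_close_map_pmf:
  assumes M: "Metric_space M d" and M': "Metric_space M' d'"
    and f: "f ` M \<subseteq> M'" and mu: "\<mu> \<in> fin_prob k M" and nu: "\<nu> \<in> fin_prob k M"
    and c: "levy_prokhorov_close M d \<mu> \<nu> \<delta>" and le: "\<delta> \<le> \<epsilon>"
    and uc: "\<And>x y. x \<in> set_pmf \<mu> \<Longrightarrow> y \<in> M \<Longrightarrow> d x y < \<delta> \<Longrightarrow> d' (f x) (f y) < \<epsilon>"
  shows "levy_prokhorov_close M' d' (map_pmf f \<mu>) (map_pmf f \<nu>) \<epsilon>"
proof -
  interpret M: Metric_space M d by (rule M)
  interpret M': Metric_space M' d' by (rule M')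
  have S: "set_pmf \<mu> \<subseteq> M" "finite (set_pmf \<mu>)" "set_pmf \<nu> \<subseteq> M" using mu nu by (auto simp: fin_prob_def)
  have cl: "measure_pmf.prob \<mu> A \<le> measure_pmf.prob \<nu> {x \<in> M. \<exists>a\<in>A. d a x < \<delta>} + \<delta>" if "A \<subseteq> set_pmf \<mu>" for A
    using c M.finite_borel[of A] that S by (auto simp: levy_prokhorov_close_def intro: finite_subset)
  have "measure_pmf.prob (map_pmf f \<mu>) A \<le> measure_pmf.prob (map_pmf f \<nu>) {x \<in> M'. \<exists>a\<in>A. d' a x < \<epsilon>} + \<epsilon>"
    (is "_ \<le> measure_pmf.prob _ ?N + _")
    and "measure_pmf.prob (map_pmf f \<nu>) A \<le> measure_pmf.prob (map_pmf f \<mu>) {x \<in> M'. \<exists>a\<in>A. d' a x < \<epsilon>} + \<epsilon>"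
    if A: "A \<subseteq> M'" for A
  proof -
    let ?A1 = "set_pmf \<mu> \<inter> f -` A"
    have "measure_pmf.prob \<mu> (f -` A) = measure_pmf.prob \<mu> ?A1"
      by (subst Int_commute) (simp only: measure_Int_set_pmf)
    also have "\<dots> \<le> measure_pmf.prob \<nu> {x \<in> M. \<exists>a\<in>?A1. d a x < \<delta>} + \<delta>" by (rule cl) auto
    also have "measure_pmf.prob \<nu> {x \<in> M. \<exists>a\<in>?A1. d a x < \<delta>} \<le> measure_pmf.prob \<nu> (f -` ?N)"
      using uc f by (intro measure_pmf.finite_measure_mono) (auto intro!: bexI)
    finally show "measure_pmf.prob (map_pmf f \<mu>) A \<le> measure_pmf.prob (map_pmf f \<nu>) ?N + \<epsilon>"
      using le by (simp add: measure_map_pmf)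
    let ?B = "set_pmf \<mu> - f -` ?N"
    let ?C = "{x \<in> M. \<exists>a\<in>?B. d a x < \<delta>}"
    have B: "measure_pmf.prob \<mu> ?B \<le> measure_pmf.prob \<nu> ?C + \<delta>" by (rule cl) auto
    have disj: "f -` A \<inter> ?C = {}"
    proof (rule ccontr)
      assume "f -` A \<inter> ?C \<noteq> {}"
      then obtain y a where y: "f y \<in> A" "y \<in> M" "a \<in> set_pmf \<mu>" "f a \<notin> ?N" "d a y < \<delta>" by auto
      then have "d' (f a) (f y) < \<epsilon>" using uc by blast
      then have "d' (f y) (f a) < \<epsilon>" by (simp add: M'.commute)
      moreover have "f a \<in> M'" using y S f by auto
      ultimately show False using y by auto
    qed
    have "measure_pmf.prob \<nu> (f -` A) + measure_pmf.prob \<nu> ?C = measure_pmf.prob \<nu> (f -` A \<union> ?C)"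
      using disj by (intro measure_pmf.finite_measure_Union[symmetric]) auto
    also have "\<dots> \<le> 1" by simp
    finally have 1: "measure_pmf.prob \<nu> (f -` A) + measure_pmf.prob \<nu> ?C \<le> 1" .
    have "1 = measure_pmf.prob \<mu> (set_pmf \<mu>)" using measure_Int_set_pmf[of \<mu> UNIV] by simp
    also have "\<dots> \<le> measure_pmf.prob \<mu> (?B \<union> f -` ?N)"
      by (intro measure_pmf.finite_measure_mono) auto
    also have "\<dots> \<le> measure_pmf.prob \<mu> ?B + measure_pmf.prob \<mu> (f -` ?N)"
      by (rule measure_Un_le) auto
    finally show "measure_pmf.prob (map_pmf f \<nu>) A \<le> measure_pmf.prob (map_pmf f \<mu>) ?N + \<epsilon>"
      using B 1 le by (simp add: measure_map_pmf)
  qed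
  moreover have "0 < \<epsilon>" using c le by (simp add: levy_prokhorov_close_def)
  ultimately show ?thesis using M'.borel_subset by (simp add: levy_prokhorov_close_def)
qed

lemma continuous_map_LP_topology:
  fixes E :: "'e::topological_space set" and E' :: "'f::topological_space set"
  assumes E: "metrizable_space (top_of_set E)" and E': "metrizable_space (top_of_set E')"
    and f: "continuous_on E f" "f ` E \<subseteq> E'"
  shows "continuous_map (LP_topology k E) (LP_topology k E') (map_pmf f)"
proof -
  have ex: "\<exists>d. Metric_space S d \<and> Metric_space.mtopology S d = top_of_set S"
    if m: "metrizable_space (top_of_set S)" for S :: "'s::topological_space set"
  proof -
    from m obtain M d where M: "Metric_space M d" "top_of_set S = Metric_space.mtopology M d"
      by (auto simp: metrizable_space_def)
    have "M = S" using Metric_space.topspace_mtopology[OF M(1)] M(2) by (metis topspace_euclidean_subtopology)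
    with M show ?thesis by metis
  qed
  define d where "d = (SOME d. Metric_space E d \<and> Metric_space.mtopology E d = top_of_set E)"
  define d' where "d' = (SOME d. Metric_space E' d \<and> Metric_space.mtopology E' d = top_of_set E')"
  have d: "Metric_space E d" "Metric_space.mtopology E d = top_of_set E"
    using someI_ex[OF ex[OF E]] by (auto simp: d_def)
  have d': "Metric_space E' d'" "Metric_space.mtopology E' d' = top_of_set E'"
    using someI_ex[OF ex[OF E']] by (auto simp: d'_def)
  interpret L: Metric_space "fin_prob k E" "levy_prokhorov E d"
    by (rule Metric_space.Metric_space_levy_prokhorov[OF d(1)])
  have "continuous_map (top_of_set E) (top_of_set E') f"
    using f by (simp add: continuous_map_in_subtopology image_subset_iff_funcset)
  then have cont: "\<exists>\<delta>>0. \<forall>y. y \<in> E \<and> d x y < \<delta> \<longrightarrow> d' (f x) (f y) < \<epsilon>" if "x \<in> E" "0 < \<epsilon>" for x \<epsilon>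
    using Metric_space.metric_continuous_map[OF d(1) d'(1), of f] d(2) d'(2) that by simp
  have ucont: "\<exists>\<delta>>0. \<forall>x\<in>S. \<forall>y. y \<in> E \<and> d x y < \<delta> \<longrightarrow> d' (f x) (f y) < \<epsilon>"
    if "finite S" "S \<subseteq> E" "0 < \<epsilon>" for S \<epsilon>
    using that
  proof (induction S rule: finite_induct)
    case empty then show ?case by (intro exI[of _ 1]) auto
  next
    case (insert x S)
    then obtain \<delta>1 where 1: "\<delta>1 > 0" "\<forall>x\<in>S. \<forall>y. y \<in> E \<and> d x y < \<delta>1 \<longrightarrow> d' (f x) (f y) < \<epsilon>" by auto
    obtain \<delta>2 where 2: "\<delta>2 > 0" "\<forall>y. y \<in> E \<and> d x y < \<delta>2 \<longrightarrow> d' (f x) (f y) < \<epsilon>"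
      using cont[of x \<epsilon>] insert.prems by auto
    show ?case by (intro exI[of _ "min \<delta>1 \<delta>2"]) (use 1 2 in auto)
  qed
  have "continuous_map L.mtopology (Metric_space.mtopology (fin_prob k E') (levy_prokhorov E' d')) (map_pmf f)"
    unfolding L.metric_continuous_map[OF Metric_space.Metric_space_levy_prokhorov[OF d'(1)]]
  proof (intro conjI ballI allI impI)
    show "map_pmf f ` fin_prob k E \<subseteq> fin_prob k E'"
      using f(2) by (fastforce simp: fin_prob_def intro: card_image_le[THEN order_trans])
    fix \<mu> and \<epsilon> :: real assume mu: "\<mu> \<in> fin_prob k E" and e: "0 < \<epsilon>"
    have "finite (set_pmf \<mu>)" "set_pmf \<mu> \<subseteq> E" using mu by (auto simp: fin_prob_def)
    then obtain \<delta> where \<delta>: "\<delta> > 0" "\<And>x y. x \<in> set_pmf \<mu> \<Longrightarrow> y \<in> E \<Longrightarrow> d x y < \<delta> \<Longrightarrow> d' (f x) (f y) < \<epsilon> / 2"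
      using ucont[of "set_pmf \<mu>" "\<epsilon> / 2"] e by auto
    show "\<exists>\<delta>>0. \<forall>\<nu>. \<nu> \<in> fin_prob k E \<and> levy_prokhorov E d \<mu> \<nu> < \<delta> \<longrightarrow>
        levy_prokhorov E' d' (map_pmf f \<mu>) (map_pmf f \<nu>) < \<epsilon>"
    proof (intro exI[of _ "min \<delta> (\<epsilon> / 2)"] conjI allI impI)
      show "0 < min \<delta> (\<epsilon> / 2)" using \<delta> e by simp
      fix \<nu> assume nu: "\<nu> \<in> fin_prob k E \<and> levy_prokhorov E d \<mu> \<nu> < min \<delta> (\<epsilon> / 2)"
      have "levy_prokhorov_close E' d' (map_pmf f \<mu>) (map_pmf f \<nu>) (\<epsilon> / 2)"
        by (rule levy_prokhorov_close_map_pmf[OF d(1) d'(1) f(2) mu, of \<nu> "min \<delta> (\<epsilon> / 2)"])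
          (use nu \<delta> in \<open>auto intro: levy_prokhorov_closeI\<close>)
      from levy_prokhorov_le[OF this] e show "levy_prokhorov E' d' (map_pmf f \<mu>) (map_pmf f \<nu>) < \<epsilon>" by simp
    qed
  qed
  then show ?thesis by (simp add: LP_topology_def d_def d'_def)
qed

section \<open>Coverings homeomorphic over the base\<close>

lemma fibrewise_homeomorphism_invariance:
  fixes E :: "'e::topological_space set" and E' :: "'f::topological_space set" and B :: "'b::topological_space set"
  assumes hom: "homeomorphism E E' f g" and p: "\<And>x. x \<in> E \<Longrightarrow> p' (f x) = p x"
  shows "secat E p B = secat E' p' B"
    and "dsecat join_topology E p B = dsecat join_topology E' p' B"
    and "metrizable_space (top_of_set E) \<Longrightarrow> dsecat LP_topology E p B = dsecat LP_topology E' p' B"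
proof -
  have f: "continuous_on E f" "f ` E \<subseteq> E'" and g: "continuous_on E' g" "g ` E' \<subseteq> E"
    using hom by (auto simp: homeomorphism_def)
  have p': "p (g x) = p' x" if "x \<in> E'" for x
  proof -
    have "g x \<in> E" "f (g x) = x" using hom that by (auto simp: homeomorphism_def)
    with p[of "g x"] show ?thesis by simp
  qed
  show "secat E p B = secat E' p' B"
    by (rule antisym; rule secat_le_if_fibrewise_map) (fact f g p p')+
  show "dsecat join_topology E p B = dsecat join_topology E' p' B"
    by (rule antisym; rule dsecat_le_if_fibrewise_map)
      (fact f g p p' continuous_map_join_topology[OF f] continuous_map_join_topology[OF g])+
  assume m: "metrizable_space (top_of_set E)"
  have "top_of_set E homeomorphic_space top_of_set E'"
    unfolding homeomorphic_space_def homeomorphic_maps_def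
    by (intro exI[of _ f] exI[of _ g])
      (use hom in \<open>auto simp: homeomorphism_def continuous_map_in_subtopology\<close>)
  then have m': "metrizable_space (top_of_set E')" using m homeomorphic_metrizable_space by blast
  show "dsecat LP_topology E p B = dsecat LP_topology E' p' B"
    by (rule antisym; rule dsecat_le_if_fibrewise_map)
      (fact f g p p' continuous_map_LP_topology[OF m m' f] continuous_map_LP_topology[OF m' m g])+
qed

text \<open>The homeomorphism between \<open>Yt\<close> and the pullback of \<open>Zh\<close> to \<open>Y\<close> is pulled back further along \<open>f\<close>.\<close>

lemma pullback_universal_covering_homeomorphism:
  fixes X :: "'x::topological_space set" and Y :: "'y::topological_space set" and Z :: "'z::topological_space set"
    and Yt :: "'b::topological_space set" and Zh :: "'c::topological_space set"
  assumes Y: "standing_space Y" "y0 \<in> Y" and Z: "standing_space Z" "z0 \<in> Z"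
    and f: "continuous_on X f" "f ` X \<subseteq> Y" and h: "continuous_on Y h" "h ` Y \<subseteq> Z"
    and iso: "fund_map Z h \<in> iso (fund_group Y y0) (fund_group Z (h y0))"
    and Yt: "universal_covering Yt pY Y" and Zh: "diagonal_covering 2 Z z0 Zh qZ"
    and hs: "hs \<in> {[h \<circ> f, (\<lambda>_. z0) \<circ> f], [(\<lambda>_. z0) \<circ> f, h \<circ> f]}"
  obtains F K where "homeomorphism (pullback X f Yt pY) (pullback X (tuple_map hs) Zh qZ) F K"
    "\<And>x. x \<in> pullback X f Yt pY \<Longrightarrow> fst (F x) = fst x"
proof -
  obtain i k :: nat where ik: "{i, k} = {0, 1}" "i \<noteq> k"
    and hs': "tuple_map hs = (\<lambda>x. \<lambda>j\<in>{..<2}. if j = i then h (f x) else z0)"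
  proof -
    from hs have "hs = [h \<circ> f, (\<lambda>_. z0) \<circ> f] \<or> hs = [(\<lambda>_. z0) \<circ> f, h \<circ> f]"
      by (simp only: insert_iff empty_iff simp_thms)
    then consider "hs = [h \<circ> f, (\<lambda>_. z0) \<circ> f]" | "hs = [(\<lambda>_. z0) \<circ> f, h \<circ> f]" by (elim disjE)
    then show thesis
    proof cases
      case 1
      have "tuple_map hs = (\<lambda>x. \<lambda>j\<in>{..<2}. if j = 0 then h (f x) else z0)"
      proof (intro ext)
        fix x and j :: nat
        consider "j = 0" | "j = 1" | "\<not> j < 2" by linarith
        then show "tuple_map hs x j = (\<lambda>j\<in>{..<2}. if j = 0 then h (f x) else z0) j"
          by cases (simp_all add: tuple_map_def 1)
      qed
      then show thesis by (rule that[of 0 1, rotated 2]) auto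
    next
      case 2
      have "tuple_map hs = (\<lambda>x. \<lambda>j\<in>{..<2}. if j = 1 then h (f x) else z0)"
      proof (intro ext)
        fix x and j :: nat
        consider "j = 0" | "j = 1" | "\<not> j < 2" by linarith
        then show "tuple_map hs x j = (\<lambda>j\<in>{..<2}. if j = 1 then h (f x) else z0) j"
          by cases (simp_all add: tuple_map_def 2)
      qed
      then show thesis by (rule that[of 1 0, rotated 2]) auto
    qed
  qed
  define G where "G y = (\<lambda>j\<in>{..<2::nat}. if j = i then h y else z0)" for y
  have hsG: "tuple_map hs x = G (f x)" for x by (simp add: hs' G_def)
  obtain F K where F: "lift_on Zh qZ Yt (G \<circ> pY) F"
    and K: "continuous_on (pullback Y G Zh qZ) K" "K ` pullback Y G Zh qZ \<subseteq> Yt"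
    "\<And>z. z \<in> pullback Y G Zh qZ \<Longrightarrow> pY (K z) = fst z \<and> F (K z) = snd z"
    "\<And>t. t \<in> Yt \<Longrightarrow> K (pY t, F t) = t"
    using universal_covering_pullback_diagonal[OF _ _ Y(2) _ Z(2) h iso Yt Zh ik, of G] Y(1) Z(1)
    unfolding standing_space_def G_def by blast
  have F': "continuous_on Yt F" "F t \<in> Zh" "qZ (F t) = G (pY t)" if "t \<in> Yt" for t
    using F that by (auto simp: lift_on_def)
  have mem: "(f x, e) \<in> pullback Y G Zh qZ" if "(x, e) \<in> pullback X (tuple_map hs) Zh qZ" for x e
    using that f(2) by (auto simp: pullback_def hsG)
  let ?F = "\<lambda>z. (fst z, F (snd z))" and ?K = "\<lambda>z. (fst z, K (f (fst z), snd z))"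
  have cF: "continuous_on Yt F" using F by (simp add: lift_on_def)
  have "homeomorphism (pullback X f Yt pY) (pullback X (tuple_map hs) Zh qZ) ?F ?K"
  proof (rule homeomorphismI)
    show "continuous_on (pullback X f Yt pY) ?F"
      by (intro continuous_on_Pair continuous_on_fst continuous_on_id continuous_on_compose2[OF cF] continuous_on_snd)
        (auto simp: pullback_def)
    show "continuous_on (pullback X (tuple_map hs) Zh qZ) ?K"
      by (intro continuous_on_Pair continuous_on_fst continuous_on_id continuous_on_compose2[OF K(1)]
          continuous_on_snd continuous_on_compose2[OF f(1)])
        (use mem in \<open>auto simp: pullback_def hsG\<close>)
    show "?F ` pullback X f Yt pY \<subseteq> pullback X (tuple_map hs) Zh qZ"
      using F' by (auto simp: pullback_def hsG)
    show "?K ` pullback X (tuple_map hs) Zh qZ \<subseteq> pullback X f Yt pY"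
    proof (clarify)
      fix x e assume xe: "(x, e) \<in> pullback X (tuple_map hs) Zh qZ"
      then show "(fst (x, e), K (f (fst (x, e)), snd (x, e))) \<in> pullback X f Yt pY"
        using K(2) K(3)[OF mem[OF xe]] mem[OF xe] by (auto simp: pullback_def)
    qed
    show "?K (?F z) = z" if "z \<in> pullback X f Yt pY" for z
      using that K(4) by (auto simp: pullback_def)
    show "?F (?K z) = z" if "z \<in> pullback X (tuple_map hs) Zh qZ" for z
      using that K(3)[OF mem] by (cases z) auto
  qed
  then show thesis by (rule that) simp
qed

lemma tuple_map_of_projections: "tuple_map (map (\<lambda>i. f \<circ> proj i) [0..<m]) = power_map m f"
  by (intro ext) (auto simp: tuple_map_def power_map_def proj_def)

theorem proposition4p6:
  fixes X :: "'x::topological_space set" and Y :: "'y::topological_space set"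
    and Z :: "'z::topological_space set"
    and f :: "'x \<Rightarrow> 'y" and h :: "'y \<Rightarrow> 'z" and y0 :: 'y and z0 :: 'z and m :: nat
    and Yh :: "'a::topological_space set" and qY :: "'a \<Rightarrow> nat \<Rightarrow> 'y"
    and Yt :: "'b::topological_space set" and pY :: "'b \<Rightarrow> 'y"
    and Zh :: "'c::topological_space set" and qZ :: "'c \<Rightarrow> nat \<Rightarrow> 'z"
  assumes "m \<ge> 2"
    and "standing_space Y" and "y0 \<in> Y"
    and "continuous_on X f" and "f ` X \<subseteq> Y"
  shows
    "(diagonal_covering m Y y0 Yh qY \<longrightarrow>
        (let prs = map (\<lambda>i. f \<circ> proj i) [0..<m]; W = power_space m X in
          TCD m X f Yh qY = DD W prs Yh qY \<and>
          (locally path_connected X \<longrightarrow> TCD m X f Yh qY = DD_pi1 Y y0 W prs) \<and>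
          (metrizable_space (top_of_set (pullback W (power_map m f) Yh qY)) \<longrightarrow>
             dTCD LP_topology m X f Yh qY = dDD LP_topology W prs Yh qY) \<and>
          dTCD join_topology m X f Yh qY = dDD join_topology W prs Yh qY)) \<and>
     (standing_space Z \<and> z0 \<in> Z \<and> continuous_on Y h \<and> h ` Y \<subseteq> Z \<and>
      fund_map Z h \<in> iso (fund_group Y y0) (fund_group Z (h y0)) \<and>
      universal_covering Yt pY Y \<and> diagonal_covering 2 Z z0 Zh qZ \<longrightarrow>
        (let hs = [h \<circ> f, (\<lambda>_. z0) \<circ> f]; hs' = [(\<lambda>_. z0) \<circ> f, h \<circ> f] in
          cat1 X f Yt pY = DD X hs Zh qZ \<and>
          cat1 X f Yt pY = DD X hs' Zh qZ \<and>
          (locally path_connected X \<longrightarrow>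
             cat1 X f Yt pY = DD_pi1 Z z0 X hs \<and>
             cat1 X f Yt pY = DD_pi1 Z z0 X hs') \<and>
          (metrizable_space (top_of_set (pullback X f Yt pY)) \<longrightarrow>
             dcat1 LP_topology X f Yt pY = dDD LP_topology X hs Zh qZ \<and>
             dcat1 LP_topology X f Yt pY = dDD LP_topology X hs' Zh qZ) \<and>
          dcat1 join_topology X f Yt pY = dDD join_topology X hs Zh qZ \<and>
          dcat1 join_topology X f Yt pY = dDD join_topology X hs' Zh qZ))"
proof (intro conjI impI)
  have lpY: "locally path_connected Y" using \<open>standing_space Y\<close> by (simp add: standing_space_def)
  {
    assume E: "diagonal_covering m Y y0 Yh qY"
    let ?prs = "map (\<lambda>i. f \<circ> proj i) [0..<m]" and ?W = "power_space m X"
    have TCD: "TCD m X f Yh qY = DD ?W ?prs Yh qY"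
      by (simp only: TCD_def DD_def tuple_map_of_projections)
    have dTCD: "dTCD T m X f Yh qY = dDD T ?W ?prs Yh qY" for T
      by (simp only: dTCD_def dDD_def tuple_map_of_projections)
    have "DD ?W ?prs Yh qY = DD_pi1 Y y0 ?W ?prs" if X: "locally path_connected X"
    proof (rule DD_eq_DD_pi1[OF locally_path_connected_power_space[OF X] lpY])
      show "diagonal_covering (length ?prs) Y y0 Yh qY" using E by simp
      fix i assume i: "i < length ?prs"
      then have pr: "proj i ` ?W \<subseteq> X" by (intro proj_in) simp
      have "continuous_on ?W (f \<circ> proj i)"
        using continuous_on_proj continuous_on_subset[OF \<open>continuous_on X f\<close> pr]
        by (rule continuous_on_compose)
      moreover have "(f \<circ> proj i) ` ?W \<subseteq> Y" using pr \<open>f ` X \<subseteq> Y\<close> by fastforce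
      ultimately show "continuous_on ?W (?prs ! i) \<and> (?prs ! i) ` ?W \<subseteq> Y" using i by simp
    qed
    with TCD dTCD show "let prs = ?prs; W = ?W in
          TCD m X f Yh qY = DD W prs Yh qY \<and>
          (locally path_connected X \<longrightarrow> TCD m X f Yh qY = DD_pi1 Y y0 W prs) \<and>
          (metrizable_space (top_of_set (pullback W (power_map m f) Yh qY)) \<longrightarrow>
             dTCD LP_topology m X f Yh qY = dDD LP_topology W prs Yh qY) \<and>
          dTCD join_topology m X f Yh qY = dDD join_topology W prs Yh qY"
      unfolding Let_def by metis
  next
    assume "standing_space Z \<and> z0 \<in> Z \<and> continuous_on Y h \<and> h ` Y \<subseteq> Z \<and>
      fund_map Z h \<in> iso (fund_group Y y0) (fund_group Z (h y0)) \<and>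
      universal_covering Yt pY Y \<and> diagonal_covering 2 Z z0 Zh qZ"
    then have Z: "standing_space Z" "z0 \<in> Z" and h: "continuous_on Y h" "h ` Y \<subseteq> Z"
      and iso: "fund_map Z h \<in> iso (fund_group Y y0) (fund_group Z (h y0))"
      and Yt: "universal_covering Yt pY Y" and Zh: "diagonal_covering 2 Z z0 Zh qZ" by blast+
    let ?hs = "[h \<circ> f, (\<lambda>_. z0) \<circ> f]" and ?hs' = "[(\<lambda>_. z0) \<circ> f, h \<circ> f]"
    have eqs: "cat1 X f Yt pY = DD X hs Zh qZ \<and>
        (metrizable_space (top_of_set (pullback X f Yt pY)) \<longrightarrow>
           dcat1 LP_topology X f Yt pY = dDD LP_topology X hs Zh qZ) \<and>
        dcat1 join_topology X f Yt pY = dDD join_topology X hs Zh qZ" if hs: "hs \<in> {?hs, ?hs'}" for hs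
    proof -
      obtain F K where F: "homeomorphism (pullback X f Yt pY) (pullback X (tuple_map hs) Zh qZ) F K"
        "\<And>x. x \<in> pullback X f Yt pY \<Longrightarrow> fst (F x) = fst x"
        by (rule pullback_universal_covering_homeomorphism[OF \<open>standing_space Y\<close> \<open>y0 \<in> Y\<close> Z
              \<open>continuous_on X f\<close> \<open>f ` X \<subseteq> Y\<close> h iso Yt Zh hs]) blast
      show ?thesis
        unfolding cat1_def DD_def dcat1_def dDD_def
        using fibrewise_homeomorphism_invariance[where p = fst and p' = fst and B = X, OF F] by blast
    qed
    have hf: "continuous_on X (h \<circ> f)" "(h \<circ> f) ` X \<subseteq> Z"
      using continuous_on_compose[OF \<open>continuous_on X f\<close> continuous_on_subset[OF h(1) \<open>f ` X \<subseteq> Y\<close>]]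
        h(2) \<open>f ` X \<subseteq> Y\<close> by (blast, auto)
    have cf: "continuous_on X ((\<lambda>_. z0) \<circ> f)" "((\<lambda>_. z0) \<circ> f) ` X \<subseteq> Z"
      using Z(2) by (auto simp: comp_def)
    have lpZ: "locally path_connected Z" using Z(1) by (simp add: standing_space_def)
    have "DD X ?hs Zh qZ = DD_pi1 Z z0 X ?hs" "DD X ?hs' Zh qZ = DD_pi1 Z z0 X ?hs'"
      if X: "locally path_connected X"
    proof -
      have two: "diagonal_covering (length [a, b]) Z z0 Zh qZ" for a b :: "'x \<Rightarrow> 'z"
        using Zh by (simp add: numeral_2_eq_2)
      have "continuous_on X ([a, b] ! i) \<and> ([a, b] ! i) ` X \<subseteq> Z"
        if "continuous_on X a" "a ` X \<subseteq> Z" "continuous_on X b" "b ` X \<subseteq> Z" "i < length [a, b]"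
        for a b :: "'x \<Rightarrow> 'z" and i
        using that by (cases i) auto
      from DD_eq_DD_pi1[OF X lpZ two this[OF hf cf]] DD_eq_DD_pi1[OF X lpZ two this[OF cf hf]]
      show "DD X ?hs Zh qZ = DD_pi1 Z z0 X ?hs" "DD X ?hs' Zh qZ = DD_pi1 Z z0 X ?hs'" by blast+
    qed
    with eqs[of ?hs] eqs[of ?hs'] show "let hs = ?hs; hs' = ?hs' in
          cat1 X f Yt pY = DD X hs Zh qZ \<and>
          cat1 X f Yt pY = DD X hs' Zh qZ \<and>
          (locally path_connected X \<longrightarrow>
             cat1 X f Yt pY = DD_pi1 Z z0 X hs \<and>
             cat1 X f Yt pY = DD_pi1 Z z0 X hs') \<and>
          (metrizable_space (top_of_set (pullback X f Yt pY)) \<longrightarrow>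
             dcat1 LP_topology X f Yt pY = dDD LP_topology X hs Zh qZ \<and>
             dcat1 LP_topology X f Yt pY = dDD LP_topology X hs' Zh qZ) \<and>
          dcat1 join_topology X f Yt pY = dDD join_topology X hs Zh qZ \<and>
          dcat1 join_topology X f Yt pY = dDD join_topology X hs' Zh qZ"
      unfolding Let_def by (metis insertCI)
  }
qed

end
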